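(* Let $\alpha\ge0$ be a constant, let the marks $X_i$ be i.i.d. in the unit square with density $f$ satisfying $\epsilon_1\le f\le\epsilon_2$ for finite positive constants $\epsilon_1,\epsilon_2$, and let the cost factor be $r(X_u,X_v)=d(X_u,X_v)^{-\alpha}$. Suppose $p(u,v)=p=p(n)=o(1)$ for all edges $(u,v)$ and the edge weights satisfy $$\delta_0\le(\mathbb EW(u,v))^2\le\mathbb EW^2(u,v)\le\delta_1$$ for some constants $\delta_0,\delta_1>0$. (a) There are constants $M,\theta>0$ such that if $p\ge\frac{M\log n}{n}$, then $$\mathbb P\left(E_{con}\cap\left\{\chi_n\ge\theta n(np)^{\alpha/2}\right\}\right)\ge1-e^{-\theta np}-n\exp\left(-\frac\theta p\right).$$ (b) Let $0<\alpha<1$. If $\mathbb EW^s(u,v)<\infty$ for some $s\ge\frac2\alpha+1$, then there is a constant $\gamma>0$ such that if $p\ge\frac{\gamma\log n}{n}$, then $$\mathbb E\chi_n\le\gamma n(np)^{\alpha/2}\quad\text{and}\quad\mathbb P\left(\chi_n\le\gamma n\nu_n(np)^{\alpha/2}\right)\ge1-\frac{\gamma}{\log n}-\gamma p,$$ where $\nu_n:=1$ if $0<\alpha<\frac23$ and $\nu_n:=\log n$ if $\frac23\le\alpha<1$. Moreover, if $\alpha<\frac23$, then $\mathrm{var}(\chi_n)\le\gamma_0n^2p\,(np)^{\alpha}$ for some constant $\gamma_0>0$.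
   Context: For each integer $n\ge2$ let $K_n$ be the complete graph on $\{1,\dots,n\}$. Let $\{Z(h)\}_{h\in K_n}$ be independent Bernoulli random variables indexed by the edges, with $\mathbb P(Z(h)=1)=p(h)=p(u,v)\in(0,1)$ for $h=(u,v)$. The random graph $G$ has vertex set $\{1,\dots,n\}$ and edge set $\{h:Z(h)=1\}$; $E_{con}$ is the event that $G$ is connected. Each edge $h$ has a positive random weight $W(h)=W(u,v)$ (i.i.d. over edges, with law not depending on $n$). The vertex marks (locations) $X_1,\dots,X_n$ are i.i.d. with common density $f$ on $S=[0,1]^2$; $d(\cdot,\cdot)$ is Euclidean distance. The families $\{Z(h)\},\{W(h)\},\{X_u\}$ are mutually independent. The cost of the edge $(u,v)$ is $c(u,v)=r(X_u,X_v)W(u,v)$, where $r(X_u,X_v)$ is the cost factor. The cost of a tree is the sum of the costs of its edges, and $\chi_n$ is the maximum cost of a spanning tree of the largest component of $G$ (ties between largest components broken by any fixed rule). Constants do not depend on $n$. *)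

theory Defs
  imports "HOL-Probability.Probability" "HOL-Library.Ramsey"
begin

text \<open>A finite simple graph is given by its vertex set \<open>V\<close> and a set \<open>E\<close> of two-element subsets
  of \<open>V\<close>. The edge set of the complete graph on \<open>V\<close> is the library's \<open>nsets V 2\<close>. (The notions
  of tree in the AFP entry on digraphs refer to directed cycles and are not suitable here.)\<close>

definition adj :: "'v set set \<Rightarrow> ('v \<times> 'v) set" where
  "adj E = {(u, v). {u, v} \<in> E}"

definition connected_graph :: "'v set \<Rightarrow> 'v set set \<Rightarrow> bool" where
  "connected_graph V E \<longleftrightarrow> V \<noteq> {} \<and> (\<forall>u\<in>V. \<forall>v\<in>V. (u, v) \<in> (adj E)\<^sup>*)"

definition components_of_graph :: "'v set \<Rightarrow> 'v set set \<Rightarrow> 'v set set" where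
  "components_of_graph V E = {{v \<in> V. (u, v) \<in> (adj E)\<^sup>*} | u. u \<in> V}"

definition is_largest_component :: "'v set \<Rightarrow> 'v set set \<Rightarrow> 'v set \<Rightarrow> bool" where
  "is_largest_component V E C \<longleftrightarrow>
     C \<in> components_of_graph V E \<and> (\<forall>D \<in> components_of_graph V E. card D \<le> card C)"

definition is_cycle :: "'v set set \<Rightarrow> 'v list \<Rightarrow> bool" where
  "is_cycle E vs \<longleftrightarrow> 3 \<le> length vs \<and> distinct vs \<and>
     (\<forall>i < length vs. {vs ! i, vs ! (Suc i mod length vs)} \<in> E)"

definition is_tree :: "'v set \<Rightarrow> 'v set set \<Rightarrow> bool" where
  "is_tree V T \<longleftrightarrow> T \<subseteq> nsets V 2 \<and> connected_graph V T \<and> (\<nexists>vs. is_cycle T vs)"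

text \<open>Here \<open>C\<close> is the vertex set of a component of a graph with edge set \<open>E\<close>.\<close>

definition spanning_tree_of :: "'v set \<Rightarrow> 'v set set \<Rightarrow> 'v set set \<Rightarrow> bool" where
  "spanning_tree_of C E T \<longleftrightarrow> T \<subseteq> E \<and> is_tree C T"


type_synonym point = "real \<times> real"

text \<open>The product metric on \<open>real \<times> real\<close> is the Euclidean one.\<close>

definition unit_square :: "point set" where
  "unit_square = {0..1} \<times> {0..1}"

datatype source = Presence "nat set" | Weight "nat set" | Location nat

text \<open>The model for a single \<open>n\<close>: \<open>p\<close> gives the edge probabilities, \<open>\<mu>\<close> is the common law of the edge
  weights, and \<open>f\<close> (only its values on the unit square matter) is the common density of the
  locations. Since the three families take values in different types, mutual independence is
  stated for the \<open>\<sigma>\<close>-algebras they generate.\<close>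

locale marked_random_graph = prob_space \<Omega> for \<Omega> :: "'a measure" +
  fixes n :: nat
    and p :: "nat set \<Rightarrow> real"
    and \<mu> :: "real measure"
    and f :: "point \<Rightarrow> real"
    and Z :: "nat set \<Rightarrow> 'a \<Rightarrow> bool"
    and W :: "nat set \<Rightarrow> 'a \<Rightarrow> real"
    and X :: "nat \<Rightarrow> 'a \<Rightarrow> point"
  assumes p_range: "\<And>h. h \<in> nsets {1..n} 2 \<Longrightarrow> 0 < p h \<and> p h < 1"
    and Z_measurable: "\<And>h. h \<in> nsets {1..n} 2 \<Longrightarrow> random_variable (count_space UNIV) (Z h)"
    and Z_bernoulli: "\<And>h. h \<in> nsets {1..n} 2 \<Longrightarrow>
          distr \<Omega> (count_space UNIV) (Z h) = measure_pmf (bernoulli_pmf (p h))"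
    and W_measurable: "\<And>h. h \<in> nsets {1..n} 2 \<Longrightarrow> random_variable borel (W h)"
    and W_law: "\<And>h. h \<in> nsets {1..n} 2 \<Longrightarrow> distr \<Omega> borel (W h) = \<mu>"
    and W_pos: "\<And>h. h \<in> nsets {1..n} 2 \<Longrightarrow> AE \<omega> in \<Omega>. 0 < W h \<omega>"
    and X_density: "\<And>u. u \<in> {1..n} \<Longrightarrow>
          distributed \<Omega> lborel (X u) (\<lambda>x. ennreal (indicator unit_square x * f x))"
    and independence: "indep_sets
          (\<lambda>i. case i of
              Presence h \<Rightarrow> sets (vimage_algebra (space \<Omega>) (Z h) (count_space UNIV))
            | Weight h \<Rightarrow> sets (vimage_algebra (space \<Omega>) (W h) borel)
            | Location u \<Rightarrow> sets (vimage_algebra (space \<Omega>) (X u) borel))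
          (Presence ` nsets {1..n} 2 \<union> Weight ` nsets {1..n} 2 \<union> Location ` {1..n})"

definition graph_edges :: "nat \<Rightarrow> (nat set \<Rightarrow> 'a \<Rightarrow> bool) \<Rightarrow> 'a \<Rightarrow> nat set set" where
  "graph_edges n Z \<omega> = {h \<in> nsets {1..n} 2. Z h \<omega>}"

text \<open>The endpoints of an edge \<open>h\<close> are \<open>Min h\<close> and \<open>Max h\<close>; the order is irrelevant for the
  symmetric cost factors used below.\<close>

definition edge_cost ::
  "(point \<Rightarrow> point \<Rightarrow> real) \<Rightarrow> (nat set \<Rightarrow> 'a \<Rightarrow> real) \<Rightarrow> (nat \<Rightarrow> 'a \<Rightarrow> point) \<Rightarrow> 'a \<Rightarrow> nat set \<Rightarrow> real"
  where "edge_cost r W X \<omega> h = r (X (Min h) \<omega>) (X (Max h) \<omega>) * W h \<omega>"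

text \<open>\<open>0 powr a = 0\<close> for every \<open>a\<close>, so this is \<open>0\<close> at coinciding locations (also for \<open>\<alpha> = 0\<close>).
  Coincidences form a null event.\<close>

definition dist_cost_factor :: "real \<Rightarrow> point \<Rightarrow> point \<Rightarrow> real" where
  "dist_cost_factor \<alpha> x y = dist x y powr (- \<alpha>)"

text \<open>A tie-breaking rule: \<open>L n E\<close> is a largest component of the graph on \<open>{1..n}\<close> with edges \<open>E\<close>.\<close>

definition largest_component_rule :: "(nat \<Rightarrow> nat set set \<Rightarrow> nat set) \<Rightarrow> bool" where
  "largest_component_rule L \<longleftrightarrow>
     (\<forall>n\<ge>2. \<forall>E \<subseteq> nsets {1..n} 2. is_largest_component {1..n} E (L n E))"

definition max_spanning_cost ::
  "(nat \<Rightarrow> nat set set \<Rightarrow> nat set) \<Rightarrow> (point \<Rightarrow> point \<Rightarrow> real) \<Rightarrow> nat \<Rightarrow>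
   (nat set \<Rightarrow> 'a \<Rightarrow> bool) \<Rightarrow> (nat set \<Rightarrow> 'a \<Rightarrow> real) \<Rightarrow> (nat \<Rightarrow> 'a \<Rightarrow> point) \<Rightarrow> 'a \<Rightarrow> real"
  where "max_spanning_cost L r n Z W X \<omega> =
    Max {\<Sum>h\<in>T. edge_cost r W X \<omega> h | T.
           spanning_tree_of (L n (graph_edges n Z \<omega>)) (graph_edges n Z \<omega>) T}"

definition chi ::
  "(nat \<Rightarrow> nat set set \<Rightarrow> nat set) \<Rightarrow> real \<Rightarrow> nat \<Rightarrow>
   (nat set \<Rightarrow> 'a \<Rightarrow> bool) \<Rightarrow> (nat set \<Rightarrow> 'a \<Rightarrow> real) \<Rightarrow> (nat \<Rightarrow> 'a \<Rightarrow> point) \<Rightarrow> 'a \<Rightarrow> real"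
  where "chi L \<alpha> = max_spanning_cost L (dist_cost_factor \<alpha>)"

text \<open>A sequence of models with homogeneous edge probability \<open>p n = o(1)\<close>; the laws \<open>\<mu>\<close> and \<open>f\<close>
  do not depend on \<open>n\<close>.\<close>

definition homogeneous_sequence ::
  "(nat \<Rightarrow> real) \<Rightarrow> real measure \<Rightarrow> (point \<Rightarrow> real) \<Rightarrow> (nat \<Rightarrow> 'a measure) \<Rightarrow>
   (nat \<Rightarrow> nat set \<Rightarrow> 'a \<Rightarrow> bool) \<Rightarrow> (nat \<Rightarrow> nat set \<Rightarrow> 'a \<Rightarrow> real) \<Rightarrow> (nat \<Rightarrow> nat \<Rightarrow> 'a \<Rightarrow> point) \<Rightarrow> bool"
  where "homogeneous_sequence p \<mu> f \<Omega> Z W X \<longleftrightarrow> p \<longlonglongrightarrow> 0 \<and>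
    (\<forall>n\<ge>2. marked_random_graph (\<Omega> n) n (\<lambda>h. p n) \<mu> f (Z n) (W n) (X n))"

definition nu :: "real \<Rightarrow> nat \<Rightarrow> real" where
  "nu \<alpha> n = (if \<alpha> < 2/3 then 1 else ln (real n))"

end

theory Submission
  imports Defs
begin

text \<open>Every spanning tree cost is at most \<open>F\<close>, the maximal cost of a forest in the complete graph with
  absent edges counted as \<open>0\<close>, and \<open>\<chi>\<close> equals \<open>F\<close> when the graph is connected.

  Upper bounds: put \<open>\<tau> = (np) powr (\<alpha> / 2)\<close>. A forest has at most \<open>n\<close> edges; each of them costs at
  most \<open>\<tau>\<close>, apart from an excess whose second moment, summed over all edges of the complete graph, is
  still of order \<open>n \<tau>\<^sup>2\<close>, because the cost of an edge has tail \<open>t powr (- 2 / \<alpha>)\<close>. The variance of \<open>F\<close>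
  is bounded by the Efron-Stein inequality: resampling a vertex changes \<open>F\<close> by at most the values of the
  edges at this vertex in one optimal forest, and Cauchy-Schwarz together with a bound \<open>O(np)\<close> on the
  degrees gives \<open>n p \<cdot> n \<tau>\<^sup>2\<close>. The exceptional events (disconnected graph, large degree) depend only
  on the graph and are therefore independent of the costs.

  Lower bound: divide the square into about \<open>n p\<close> cells. With high probability each contains at least
  a constant times \<open>1 / p\<close> vertices of \<open>{n div 2 + 1..n}\<close>, and then at least half of the vertices of
  \<open>{1..n div 2}\<close> have a neighbour of the other half in their own cell along an edge of weight bounded
  below. One such edge for each of these vertices gives a star forest of the required cost.\<close>

section \<open>Graphs\<close>

text \<open>The scale \<open>(n p) powr (\<alpha> / 2)\<close> is geometric: a vertex has about
  \<open>n p\<close> neighbours, the closest at distance of order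
  \<open>(n p) powr (- 1 / 2)\<close>. At this level the tail \<open>t powr (- 2 / \<alpha>)\<close>
  equals \<open>1 / (n p)\<close>, so of the roughly \<open>n^2 p\<close> present edges only order
  \<open>n\<close> cost more, as many as a forest can hold. The tail exponent exceeds 2 because
  \<alpha> < 1, which makes second moments finite. The spanning tree cost itself is unsuited to
  resampling, since toggling one edge may replace the largest component by another one. A maximum
  over all forests has no such jumps, and the loss caused by resampling a source is controlled by a
  forest that was optimal before. Only losses are controlled in this way, hence the form of the
  Efron-Stein inequality with positive parts. Costs need not have fourth moments, so exceptional
  graphs are not treated by Cauchy-Schwarz; their probability is factored out exactly. In the lower
  bound, edges inside cells depend on the random locations. Summing over the finitely many
  assignments of vertices to cells fixes the relevant pairs, and what remains is independent over
  edges.\<close>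

definition acyclic_edges :: "'v set set \<Rightarrow> bool" where
  "acyclic_edges T \<longleftrightarrow> (\<nexists>vs. is_cycle T vs)"

lemma acyclic_edges_mono: "acyclic_edges T \<Longrightarrow> S \<subseteq> T \<Longrightarrow> acyclic_edges S"
  unfolding acyclic_edges_def is_cycle_def by blast

lemma acyclic_edges_empty [simp]: "acyclic_edges {}"
  by (auto simp: acyclic_edges_def is_cycle_def intro!: exI[of _ 0])

lemma sym_adj: "sym (adj E)"
  by (auto simp: adj_def sym_def insert_commute)

lemma adj_rtrancl_sym: "(u, v) \<in> (adj E)\<^sup>* \<Longrightarrow> (v, u) \<in> (adj E)\<^sup>*"
  using sym_adj sym_rtrancl symD by metis

lemma nsets_2_D:
  assumes "h \<in> nsets V 2" "v \<in> h"
  shows "\<exists>w. w \<noteq> v \<and> h = {v, w} \<and> v \<in> V \<and> w \<in> V"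
proof -
  from assms obtain a b where "h = {a, b}" "a \<noteq> b" "a \<in> V" "b \<in> V"
    by (auto simp: nsets_def card_2_iff)
  with assms(2) show ?thesis by (cases "v = a") auto
qed

text \<open>The last vertex of a longest path is a leaf.\<close>

lemma acyclic_leaf:
  assumes V: "finite V" and T: "T \<subseteq> nsets V 2" "T \<noteq> {}" "acyclic_edges T"
  shows "\<exists>v h. h \<in> T \<and> v \<in> h \<and> (\<forall>h'\<in>T. v \<in> h' \<longrightarrow> h' = h)"
proof (rule ccontr)
  assume "\<not> ?thesis"
  hence two: "\<And>v h. h \<in> T \<Longrightarrow> v \<in> h \<Longrightarrow> \<exists>h'\<in>T. v \<in> h' \<and> h' \<noteq> h" by blast
  define path where "path vs \<longleftrightarrow> distinct vs \<and> 2 \<le> length vs \<and>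
     (\<forall>i. Suc i < length vs \<longrightarrow> {vs ! i, vs ! Suc i} \<in> T)" for vs
  have path_V: "set vs \<subseteq> V" if "path vs" for vs
  proof
    fix v assume "v \<in> set vs"
    then obtain i where i: "i < length vs" "v = vs ! i" by (auto simp: in_set_conv_nth)
    have "\<exists>h\<in>T. v \<in> h"
    proof (cases "Suc i < length vs")
      case True with that i show ?thesis unfolding path_def by blast
    next
      case False
      with that i have "Suc (i - 1) = i" "Suc (i - 1) < length vs" unfolding path_def by linarith+
      with that i have "{vs ! (i - 1), vs ! i} \<in> T" unfolding path_def by metis
      with i show ?thesis by blast
    qed
    with T(1) show "v \<in> V" by (auto simp: nsets_def)
  qed
  have bound: "length vs \<le> card V" if "path vs" for vs
    using path_V[OF that] that V card_mono distinct_card unfolding path_def by metis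
  obtain h where "h \<in> T" using T(2) by blast
  then obtain a b where ab: "h = {a, b}" "a \<noteq> b" using T(1) by (auto simp: nsets_def card_2_iff)
  have "path [a, b]" using \<open>h \<in> T\<close> ab unfolding path_def by (auto simp: less_Suc_eq)
  then obtain vs where vs: "path vs" and max: "\<And>ws. path ws \<Longrightarrow> length ws \<le> length vs"
    using ex_has_greatest_nat[of path "[a, b]" length "Suc (card V)"] bound
    by (metis le_imp_less_Suc)
  define m where "m = length vs"
  have m: "2 \<le> m" using vs by (simp add: path_def m_def)
  have last_edge: "{vs ! (m - 2), vs ! (m - 1)} \<in> T"
    using vs m unfolding path_def m_def
    by (metis One_nat_def Suc_1 Suc_diff_Suc Suc_le_eq diff_Suc_less lessI less_le_trans pos2)
  from two[OF last_edge, of "vs ! (m - 1)"] obtain h' where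
    h': "h' \<in> T" "vs ! (m - 1) \<in> h'" "h' \<noteq> {vs ! (m - 2), vs ! (m - 1)}" by blast
  obtain w where w: "w \<noteq> vs ! (m - 1)" "h' = {vs ! (m - 1), w}"
    using nsets_2_D[of h' V "vs ! (m - 1)"] h' T(1) by blast
  have "w \<in> set vs"
  proof (rule ccontr)
    assume "w \<notin> set vs"
    have "path (vs @ [w])"
      unfolding path_def
    proof (intro conjI allI impI)
      fix i assume i: "Suc i < length (vs @ [w])"
      show "{(vs @ [w]) ! i, (vs @ [w]) ! Suc i} \<in> T"
      proof (cases "Suc i < length vs")
        case True then show ?thesis using vs by (simp add: path_def nth_append)
      next
        case False
        with i have "i = m - 1" "Suc i = length vs" unfolding m_def by auto
        then show ?thesis using h'(1) w(2) by (simp add: nth_append)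
      qed
    qed (use vs \<open>w \<notin> set vs\<close> in \<open>auto simp: path_def\<close>)
    from max[OF this] show False by simp
  qed
  then obtain i where i: "i < m" "w = vs ! i" by (auto simp: in_set_conv_nth m_def)
  \<comment> \<open>\<open>w\<close> is neither the end of the path nor its predecessor, so the
    segment from \<open>w\<close> to the end, closed by \<open>h'\<close>, has at least three
    vertices, as \<open>is_cycle\<close> demands.\<close>
  have "i \<noteq> m - 1" using w i by blast
  moreover have "i \<noteq> m - 2" using h'(3) w(2) i(2) by (auto simp: insert_commute)
  ultimately have i3: "i + 3 \<le> m" using i m by linarith
  define cs where "cs = drop i vs"
  have len: "length cs = m - i" by (simp add: cs_def m_def)
  have "is_cycle T cs"
    unfolding is_cycle_def
  proof (intro conjI allI impI)
    show "3 \<le> length cs" using i3 len by simp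
    show "distinct cs" using vs by (simp add: cs_def path_def)
    fix j assume j: "j < length cs"
    show "{cs ! j, cs ! (Suc j mod length cs)} \<in> T"
    proof (cases "Suc j < length cs")
      case True
      then have "Suc (i + j) < length vs" using len m_def by simp
      with vs have "{vs ! (i + j), vs ! Suc (i + j)} \<in> T" unfolding path_def by blast
      with True show ?thesis by (simp add: cs_def)
    next
      case False
      with j have "Suc j = length cs" by simp
      then have "i + j = m - 1" "Suc j mod length cs = 0" using len i3 by auto
      with h'(1) w(2) i(2) show ?thesis using len i3 by (simp add: cs_def m_def)
    qed
  qed
  with T(3) show False by (auto simp: acyclic_edges_def)
qed

text \<open>Removing a leaf together with its only edge lowers both cardinalities by one. The bound
  \<open>card V\<close> instead of \<open>card V - 1\<close> also covers the empty vertex set and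
  suffices for all later uses.\<close>

lemma acyclic_card_le:
  assumes "finite V" "T \<subseteq> nsets V 2" "acyclic_edges T"
  shows "card T \<le> card V"
  using assms
proof (induction "card V" arbitrary: V T rule: less_induct)
  case less
  show ?case
  proof (cases "T = {}")
    case False
    obtain v h where vh: "h \<in> T" "v \<in> h" "\<And>h'. h' \<in> T \<Longrightarrow> v \<in> h' \<Longrightarrow> h' = h"
      using acyclic_leaf[OF less.prems(1,2) False less.prems(3)] by blast
    have vV: "v \<in> V" using vh less.prems(2) by (auto simp: nsets_def)
    have finT: "finite T"
      using less.prems(1,2) finite_imp_finite_nsets finite_subset by blast
    have sub: "T - {h} \<subseteq> nsets (V - {v}) 2"
    proof
      fix h' assume "h' \<in> T - {h}"
      then have "h' \<in> nsets V 2" "v \<notin> h'" using less.prems(2) vh(3) by auto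
      then show "h' \<in> nsets (V - {v}) 2" by (auto simp: nsets_def)
    qed
    have "card (T - {h}) \<le> card (V - {v})"
      using less.hyps[of "V - {v}" "T - {h}"] less.prems sub acyclic_edges_mono[of T "T - {h}"]
        card_Diff1_less[OF less.prems(1) vV] by auto
    then show ?thesis
      using vV vh(1) finT less.prems(1)
      by (metis card_Suc_Diff1 Suc_le_mono)
  qed simp
qed

text \<open>A new cycle must use the new edge; rotated so that this edge closes it, the rest of the
  cycle is a walk in \<open>T\<close> between \<open>u\<close> and \<open>v\<close>.\<close>

lemma acyclic_insert_edge:
  assumes T: "acyclic_edges T" and uv: "(u, v) \<notin> (adj T)\<^sup>*"
  shows "acyclic_edges (insert {u, v} T)"
proof (rule ccontr)
  assume "\<not> ?thesis"
  then obtain vs where c: "is_cycle (insert {u, v} T) vs" by (auto simp: acyclic_edges_def)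
  define m where "m = length vs"
  have m: "3 \<le> m" "distinct vs" using c by (auto simp: is_cycle_def m_def)
  have edge: "\<And>i. i < m \<Longrightarrow> {vs ! i, vs ! (Suc i mod m)} \<in> insert {u, v} T"
    using c by (auto simp: is_cycle_def m_def)
  have "\<exists>i<m. {vs ! i, vs ! (Suc i mod m)} \<notin> T"
    using T c by (auto simp: acyclic_edges_def is_cycle_def m_def)
  then obtain i where i: "i < m" "{vs ! i, vs ! (Suc i mod m)} = {u, v}" using edge by blast
  \<comment> \<open>The positions of the cycle in cyclic order, starting just after the new edge, so
    that \<open>k 0\<close> and \<open>k (m - 1) = i\<close> are its two ends.\<close>
  define k where "k j = (Suc i + j) mod m" for j
  have km: "k j < m" for j using m by (simp add: k_def)
  have kS: "k (Suc j) = Suc (k j) mod m" for j by (simp add: k_def mod_Suc_eq)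
  have k_last: "k (m - 1) = i" using i m by (simp add: k_def)
  have k_inj: "j = j'" if "k j = k j'" "j < m" "j' < m" for j j'
  proof -
    have "(int (Suc i) + int j) mod int m = (int (Suc i) + int j') mod int m"
      using that(1) unfolding k_def by (metis of_nat_add of_nat_mod)
    then have "int m dvd int j - int j'" by (simp add: mod_eq_dvd_iff)
    then show ?thesis using that(2,3) using dvd_imp_le_int[of "int j - int j'" "int m"] by linarith
  qed
  have walk: "(vs ! k 0, vs ! k j) \<in> (adj T)\<^sup>*" if "j < m" for j
    using that
  proof (induction j)
    case (Suc j)
    \<comment> \<open>The new edge occurs only once in the cycle: the vertices are distinct and
      \<open>m\<close> is at least 3, so no other pair of consecutive positions carries the same two
      vertices.\<close>
    have "{vs ! k j, vs ! k (Suc j)} \<noteq> {u, v}"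
    proof
      assume "{vs ! k j, vs ! k (Suc j)} = {u, v}"
      then have "{vs ! k j, vs ! k (Suc j)} = {vs ! k (m - 1), vs ! k 0}"
        using i k_last by (simp add: k_def)
      then have "vs ! k j = vs ! k (m - 1) \<or> vs ! k (Suc j) = vs ! k (m - 1) \<and> vs ! k j = vs ! k 0"
        by (auto simp: doubleton_eq_iff)
      then have "k j = k (m - 1) \<or> k (Suc j) = k (m - 1) \<and> k j = k 0"
        using m(2) km by (simp add: nth_eq_iff_index_eq m_def)
      then have "j = m - 1 \<or> Suc j = m - 1 \<and> j = 0"
        using k_inj Suc.prems m by (metis Suc_lessD diff_less less_numeral_extra(1)
            less_le_trans zero_less_numeral)
      then show False using Suc.prems m by auto
    qed
    then have "{vs ! k j, vs ! k (Suc j)} \<in> T" using edge[OF km, of j] kS by auto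
    then have "(vs ! k j, vs ! k (Suc j)) \<in> adj T" by (simp add: adj_def)
    with Suc show ?case by (meson Suc_lessD rtrancl.rtrancl_into_rtrancl)
  qed simp
  have "(vs ! k 0, vs ! i) \<in> (adj T)\<^sup>*" using walk[of "m - 1"] m k_last by simp
  moreover have "{vs ! i, vs ! k 0} = {u, v}" using i by (simp add: k_def)
  ultimately show False using uv adj_rtrancl_sym[of _ _ T] by (auto simp: doubleton_eq_iff)
qed

section \<open>Extension of forests to spanning trees, and cuts\<close>

lemma connected_graph_not_closed:
  assumes "connected_graph V E" "u \<in> V" "v \<in> V" "u \<in> S" "v \<notin> S"
  shows "\<exists>a b. {a, b} \<in> E \<and> a \<in> S \<and> b \<notin> S"
proof -
  have "(u, v) \<in> (adj E)\<^sup>*" using assms by (auto simp: connected_graph_def)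
  then show ?thesis using assms(4,5)
    by (induction rule: rtrancl_induct) (auto simp: adj_def)
qed

text \<open>Among the acyclic edge sets between \<open>T\<close> and \<open>E\<close> one of maximal
  size is connected: otherwise some edge of \<open>E\<close> leaves the set of vertices reachable
  from \<open>u\<close>, and adding it creates no cycle.\<close>

lemma forest_extends_to_spanning_tree:
  assumes V: "finite V" and E: "connected_graph V E" "E \<subseteq> nsets V 2"
    and T: "T \<subseteq> E" "acyclic_edges T"
  shows "\<exists>T'. T \<subseteq> T' \<and> spanning_tree_of V E T'"
proof -
  have finE: "finite E" using V E(2) finite_imp_finite_nsets finite_subset by blast
  define P where "P S \<longleftrightarrow> T \<subseteq> S \<and> S \<subseteq> E \<and> acyclic_edges S" for S
  have "P T" using T by (simp add: P_def)
  moreover have "card S \<le> card E" if "P S" for S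
    using that finE by (auto simp: P_def intro: card_mono)
  ultimately obtain S where S: "P S" and max: "\<And>S'. P S' \<Longrightarrow> card S' \<le> card S"
    using ex_has_greatest_nat[of P T card "Suc (card E)"] by (metis le_imp_less_Suc)
  have finS: "finite S" using S finE finite_subset by (auto simp: P_def)
  have "connected_graph V S"
  proof (rule ccontr)
    assume "\<not> connected_graph V S"
    then obtain u v where uv: "u \<in> V" "v \<in> V" "(u, v) \<notin> (adj S)\<^sup>*"
      using E(1) by (auto simp: connected_graph_def)
    obtain a b where ab: "{a, b} \<in> E" "(u, a) \<in> (adj S)\<^sup>*" "(u, b) \<notin> (adj S)\<^sup>*"
      using connected_graph_not_closed[OF E(1) uv(1,2), of "{w. (u, w) \<in> (adj S)\<^sup>*}"] uv(3) by auto
    have nab: "(a, b) \<notin> (adj S)\<^sup>*" using ab by (meson rtrancl_trans)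
    then have "{a, b} \<notin> S" by (auto simp: adj_def)
    moreover have "P (insert {a, b} S)"
      using S ab acyclic_insert_edge[OF _ nab] by (auto simp: P_def)
    ultimately show False using max[of "insert {a, b} S"] finS by simp
  qed
  with S E(2) show ?thesis
    by (auto simp: P_def spanning_tree_of_def is_tree_def acyclic_edges_def)
qed

lemma component_subset: "C \<in> components_of_graph V E \<Longrightarrow> C \<subseteq> V"
  by (auto simp: components_of_graph_def)

text \<open>Paths starting in a component stay in it, so the edges inside \<open>C\<close> already
  connect \<open>C\<close>. This guarantees that the maximum defining the spanning tree cost is over
  a nonempty set.\<close>

lemma component_spanning_tree:
  assumes V: "finite V" and E: "E \<subseteq> nsets V 2" and C: "C \<in> components_of_graph V E"
  shows "\<exists>T. spanning_tree_of C E T"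
proof -
  obtain u where u: "u \<in> V" "C = {v \<in> V. (u, v) \<in> (adj E)\<^sup>*}"
    using C by (auto simp: components_of_graph_def)
  define E' where "E' = E \<inter> nsets C 2"
  have reach: "(u, v) \<in> (adj E')\<^sup>*" if "(u, v) \<in> (adj E)\<^sup>*" for v
    using that
  proof (induction rule: rtrancl_induct)
    case (step y z)
    have e: "{y, z} \<in> E" using step by (simp add: adj_def)
    then have "y \<in> V" "z \<in> V" using E by (auto simp: nsets_def)
    moreover have "(u, z) \<in> (adj E)\<^sup>*" using step by auto
    ultimately have "y \<in> C" "z \<in> C" using u step by auto
    with e E have "{y, z} \<in> E'" by (auto simp: E'_def nsets_def)
    then have "(y, z) \<in> adj E'" by (simp add: adj_def)
    with step show ?case by auto
  qed simp
  have "connected_graph C E'"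
    unfolding connected_graph_def
  proof (intro conjI ballI)
    show "C \<noteq> {}" using u by auto
    fix v w assume "v \<in> C" "w \<in> C"
    then have "(u, v) \<in> (adj E')\<^sup>*" "(u, w) \<in> (adj E')\<^sup>*" using u reach by auto
    then show "(v, w) \<in> (adj E')\<^sup>*" by (meson adj_rtrancl_sym rtrancl_trans)
  qed
  moreover have "finite C" using V u by auto
  ultimately obtain T where "spanning_tree_of C E' T"
    using forest_extends_to_spanning_tree[of C E' "{}"] by (auto simp: E'_def)
  then show ?thesis by (auto simp: spanning_tree_of_def E'_def)
qed

lemma components_of_connected_graph:
  "connected_graph V E \<Longrightarrow> components_of_graph V E = {V}"
  by (auto simp: components_of_graph_def connected_graph_def)

text \<open>Since every \<open>b u\<close> lies outside \<open>A\<close>, each edge contains exactly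
  one vertex of \<open>A\<close>; this vertex is isolated before its edge is added, so no cycle can
  arise.\<close>

lemma star_forest:
  assumes "finite A" and "\<And>u. u \<in> A \<Longrightarrow> b u \<notin> A"
  shows "acyclic_edges ((\<lambda>u. {u, b u}) ` A) \<and> card ((\<lambda>u. {u, b u}) ` A) = card A"
proof
  show "card ((\<lambda>u. {u, b u}) ` A) = card A"
    by (rule card_image) (use assms in \<open>unfold inj_on_def doubleton_eq_iff, metis\<close>)
  show "acyclic_edges ((\<lambda>u. {u, b u}) ` A)"
    using assms
  proof (induction A rule: finite_induct)
    case (insert a A)
    define T where "T = (\<lambda>u. {u, b u}) ` A"
    have "(a, x) \<in> (adj T)\<^sup>* \<Longrightarrow> x = a" for x
    proof (induction rule: rtrancl_induct)
      case (step y z)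
      then have "{a, z} \<in> T" by (simp add: adj_def)
      then obtain u where "u \<in> A" "a = u \<or> a = b u" by (auto simp: T_def doubleton_eq_iff)
      with insert.hyps(2) insert.prems[of u] show ?case by blast
    qed simp
    moreover have "b a \<noteq> a" using insert.prems by auto
    ultimately have "(a, b a) \<notin> (adj T)\<^sup>*" by blast
    then show ?case
      using acyclic_insert_edge[of T a "b a"] insert by (simp add: T_def)
  qed simp
qed

text \<open>Either a component or its complement has at most half of the vertices. The smaller side
  is what the union bound over cuts needs: each of its vertices then has at least half of the
  vertices opposite.\<close>

lemma not_connected_cut:
  assumes V: "finite V" "V \<noteq> {}" and E: "E \<subseteq> nsets V 2" and nc: "\<not> connected_graph V E"
  shows "\<exists>S\<subseteq>V. S \<noteq> {} \<and> 2 * card S \<le> card V \<and> (\<forall>a\<in>S. \<forall>b\<in>V - S. {a, b} \<notin> E)"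
proof -
  obtain u v where uv: "u \<in> V" "v \<in> V" "(u, v) \<notin> (adj E)\<^sup>*"
    using nc V by (auto simp: connected_graph_def)
  define C where "C = {w \<in> V. (u, w) \<in> (adj E)\<^sup>*}"
  have cut: "{a, b} \<notin> E" if "a \<in> C" "b \<in> V - C" for a b
  proof
    assume "{a, b} \<in> E"
    then have "(a, b) \<in> adj E" by (simp add: adj_def)
    with that show False by (auto simp: C_def intro: rtrancl_into_rtrancl)
  qed
  have sub: "C \<subseteq> V" "u \<in> C" "v \<in> V - C" using uv by (auto simp: C_def)
  have sum: "card C + card (V - C) = card V"
    using V(1) sub(1) by (simp add: card_Diff_subset finite_subset card_mono)
  show ?thesis
  proof (cases "2 * card C \<le> card V")
    case True then show ?thesis using sub cut by (intro exI[of _ C]) auto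
  next
    case False
    then have "2 * card (V - C) \<le> card V" using sum by linarith
    moreover have "{a, b} \<notin> E" if "a \<in> V - C" "b \<in> V - (V - C)" for a b
      using cut[of b a] that by (auto simp: insert_commute)
    ultimately show ?thesis using sub by (intro exI[of _ "V - C"]) auto
  qed
qed

section \<open>The Efron-Stein inequality\<close>

text \<open>Jensen's inequality for the convex function \<open>(max 0 y)\<^sup>2\<close>; it is
  needed when a coordinate is averaged out in the Efron-Stein induction.\<close>

lemma square_nn_integral_le:
  assumes "prob_space M" and f: "f \<in> borel_measurable M"
    and "\<And>x. x \<in> space M \<Longrightarrow> \<bar>f x\<bar> \<le> (B::real)"
  shows "ennreal ((max 0 (\<integral>x. f x \<partial>M))\<^sup>2) \<le> (\<integral>\<^sup>+x. ennreal ((max 0 (f x))\<^sup>2) \<partial>M)"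
proof -
  interpret prob_space M by fact
  have B: "AE x in M. norm (f x) \<le> B" using assms by (auto intro: AE_I2)
  have int: "integrable M f" by (rule integrable_const_bound[OF B f])
  have int0: "integrable M (\<lambda>x. max 0 (f x))" using int by (auto intro: integrable_max)
  have int2: "integrable M (\<lambda>x. (max 0 (f x))\<^sup>2)"
  proof (rule integrable_const_bound)
    show "AE x in M. norm ((max 0 (f x))\<^sup>2) \<le> B\<^sup>2"
    proof (rule AE_I2)
      fix x assume "x \<in> space M"
      then have "\<bar>f x\<bar> \<le> B" by fact
      then have "max 0 (f x) \<le> B" by linarith
      then show "norm ((max 0 (f x))\<^sup>2) \<le> B\<^sup>2" by (simp add: power_mono)
    qed
  qed (use f in measurable)
  have "(max 0 (expectation f))\<^sup>2 \<le> (expectation (\<lambda>x. max 0 (f x)))\<^sup>2"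
    by (intro power_mono max.boundedI integral_nonneg_AE integral_mono int int0) auto
  also have "\<dots> \<le> expectation (\<lambda>x. (max 0 (f x))\<^sup>2)"
  proof -
    have "0 \<le> expectation (\<lambda>x. (max 0 (f x) - expectation (\<lambda>x. max 0 (f x)))\<^sup>2)" by simp
    also have "\<dots> = expectation (\<lambda>x. (max 0 (f x))\<^sup>2) - (expectation (\<lambda>x. max 0 (f x)))\<^sup>2"
      by (rule variance_eq[OF int0 int2])
    finally show ?thesis by simp
  qed
  finally show ?thesis
    using int2 by (simp add: nn_integral_eq_integral)
qed

text \<open>The variance is half of the double integral of \<open>(f x - f z)\<^sup>2\<close>, and
  by symmetry in \<open>x\<close> and \<open>z\<close> the squared positive parts make up exactly
  half of that double integral.\<close>

lemma variance_le_positive_differences: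
  assumes "prob_space M" and f: "f \<in> borel_measurable M"
    and B: "\<And>x. x \<in> space M \<Longrightarrow> \<bar>f x\<bar> \<le> (B::real)"
  shows "ennreal ((\<integral>x. (f x)\<^sup>2 \<partial>M) - (\<integral>x. f x \<partial>M)\<^sup>2)
    \<le> (\<integral>\<^sup>+x. \<integral>\<^sup>+z. ennreal ((max 0 (f x - f z))\<^sup>2) \<partial>M \<partial>M)"
proof -
  interpret Q: prob_space M by fact
  interpret PP: pair_prob_space M M ..
  note [measurable] = f
  have int: "integrable M f"
    by (rule Q.integrable_const_bound[of _ B]) (auto intro!: AE_I2 B f)
  have int2: "integrable M (\<lambda>x. (f x)\<^sup>2)"
  proof (rule Q.integrable_const_bound[of _ "B\<^sup>2"])
    show "AE x in M. norm ((f x)\<^sup>2) \<le> B\<^sup>2"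
      by (intro AE_I2) (metis B abs_ge_zero norm_power power2_abs power_mono real_norm_def)
  qed measurable
  define D where "D = (\<integral>\<^sup>+x. \<integral>\<^sup>+z. ennreal ((max 0 (f x - f z))\<^sup>2) \<partial>M \<partial>M)"
  define m where "m = Q.expectation f"
  have sw: "D = (\<integral>\<^sup>+x. \<integral>\<^sup>+z. ennreal ((max 0 (f z - f x))\<^sup>2) \<partial>M \<partial>M)"
    unfolding D_def by (rule PP.Fubini') measurable
  have pt: "ennreal ((f x - f z)\<^sup>2) = ennreal ((max 0 (f x - f z))\<^sup>2) + ennreal ((max 0 (f z - f x))\<^sup>2)" for x z
    by (cases "f z \<le> f x") (auto simp: max_def power2_commute simp flip: ennreal_plus)
  have "2 * D = (\<integral>\<^sup>+x. \<integral>\<^sup>+z. ennreal ((f x - f z)\<^sup>2) \<partial>M \<partial>M)"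
    unfolding pt by (subst nn_integral_add, measurable, subst nn_integral_add)
      (auto simp: D_def[symmetric] sw[symmetric] mult_2)
  also have "\<dots> = (\<integral>\<^sup>+x. ennreal ((f x)\<^sup>2 - 2 * f x * m + Q.expectation (\<lambda>z. (f z)\<^sup>2)) \<partial>M)"
  proof (rule nn_integral_cong)
    fix x assume "x \<in> space M"
    have "(\<integral>\<^sup>+z. ennreal ((f x - f z)\<^sup>2) \<partial>M) = ennreal (\<integral>z. (f x - f z)\<^sup>2 \<partial>M)"
    proof (rule nn_integral_eq_integral)
      show "integrable M (\<lambda>z. (f x - f z)\<^sup>2)" using int int2 by (simp add: power2_diff)
    qed simp
    also have "(\<integral>z. (f x - f z)\<^sup>2 \<partial>M) = (f x)\<^sup>2 - 2 * f x * m + Q.expectation (\<lambda>z. (f z)\<^sup>2)"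
      using int int2 by (simp add: power2_diff m_def Q.prob_space algebra_simps)
    finally show "(\<integral>\<^sup>+z. ennreal ((f x - f z)\<^sup>2) \<partial>M) = ennreal ((f x)\<^sup>2 - 2 * f x * m + Q.expectation (\<lambda>z. (f z)\<^sup>2))" .
  qed
  also have "\<dots> = ennreal (Q.expectation (\<lambda>x. (f x)\<^sup>2 - 2 * f x * m + Q.expectation (\<lambda>z. (f z)\<^sup>2)))"
  proof (rule nn_integral_eq_integral)
    show "integrable M (\<lambda>x. (f x)\<^sup>2 - 2 * f x * m + Q.expectation (\<lambda>z. (f z)\<^sup>2))"
      using int int2 by auto
    have var: "Q.expectation (\<lambda>z. (f z)\<^sup>2) \<ge> m\<^sup>2"
      using Q.variance_eq[OF int int2] Bochner_Integration.integral_nonneg[of M "\<lambda>x. (f x - Q.expectation f)\<^sup>2"]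
      by (simp add: m_def)
    have "0 \<le> (f x)\<^sup>2 - 2 * f x * m + Q.expectation (\<lambda>z. (f z)\<^sup>2)" for x
    proof -
      have "0 \<le> (f x - m)\<^sup>2" by simp
      with var show ?thesis unfolding power2_diff by linarith
    qed
    then show "AE x in M. 0 \<le> (f x)\<^sup>2 - 2 * f x * m + Q.expectation (\<lambda>z. (f z)\<^sup>2)" by simp
  qed
  also have "Q.expectation (\<lambda>x. (f x)\<^sup>2 - 2 * f x * m + Q.expectation (\<lambda>z. (f z)\<^sup>2))
     = 2 * (Q.expectation (\<lambda>z. (f z)\<^sup>2) - m\<^sup>2)"
    using int int2 by (simp add: Q.prob_space m_def power2_eq_square algebra_simps)
  also have "ennreal \<dots> = 2 * ennreal (Q.expectation (\<lambda>z. (f z)\<^sup>2) - m\<^sup>2)"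
    by (subst ennreal_mult') auto
  finally have "2 * D = 2 * ennreal (Q.expectation (\<lambda>z. (f z)\<^sup>2) - m\<^sup>2)" .
  then have "D = ennreal (Q.expectation (\<lambda>z. (f z)\<^sup>2) - m\<^sup>2)"
    by (simp add: ennreal_mult_cancel_left)
  then show ?thesis by (simp add: D_def m_def)
qed

lemma fun_upd_measurable:
  assumes "j \<in> I" "finite I"
  shows "(\<lambda>(x, z). x(j := z)) \<in> measurable (PiM I M \<Otimes>\<^sub>M M j) (PiM I M)"
proof -
  have "(\<lambda>p. (fst p)(j := snd p)) \<in> measurable (PiM I M \<Otimes>\<^sub>M M j) (PiM I M)"
  proof (rule measurable_PiM_single')
    fix i assume i: "i \<in> I"
    show "(\<lambda>p. ((fst p)(j := snd p)) i) \<in> measurable (PiM I M \<Otimes>\<^sub>M M j) (M i)"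
      using i by (cases "i = j") (auto intro: measurable_compose[OF measurable_fst])
  next
    show "(\<lambda>p i. ((fst p)(j := snd p)) i) \<in> space (PiM I M \<Otimes>\<^sub>M M j) \<rightarrow> Pi\<^sub>E I (\<lambda>i. space (M i))"
      using assms by (auto simp: space_pair_measure space_PiM PiE_iff extensional_def)
  qed
  then show ?thesis by (simp add: case_prod_unfold)
qed

text \<open>Induction on the coordinates. Conditioning on those in \<open>I\<close> splits the
  variance into the mean conditional variance in coordinate \<open>i\<close>, bounded by
  \<open>variance_le_positive_differences\<close>, and the variance of the conditional mean, bounded
  by the induction hypothesis. Boundedness of \<open>f\<close> settles integrability; unbounded
  functions are reached later by truncation.\<close>

theorem efron_stein:
  fixes M :: "'i \<Rightarrow> 'b measure"
  assumes "finite I" and M: "\<And>i. prob_space (M i)"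
    and "f \<in> borel_measurable (PiM I M)"
    and "\<And>x. x \<in> space (PiM I M) \<Longrightarrow> \<bar>f x\<bar> \<le> (B::real)"
  shows "ennreal ((\<integral>x. (f x)\<^sup>2 \<partial>PiM I M) - (\<integral>x. f x \<partial>PiM I M)\<^sup>2)
    \<le> (\<integral>\<^sup>+x. (\<Sum>i\<in>I. \<integral>\<^sup>+z. ennreal ((max 0 (f x - f (x(i := z))))\<^sup>2) \<partial>M i) \<partial>PiM I M)"
  using assms(1,3,4)
proof (induction I arbitrary: f rule: finite_induct)
  case empty
  interpret product_prob_space M "{}" by (intro product_prob_spaceI M)
  show ?case by (simp add: PiM_empty lebesgue_integral_count_space_finite)
next
  case (insert i I f)
  interpret Mi: prob_space "M i" by (rule M)
  interpret product_prob_space M I by (intro product_prob_spaceI M)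
  interpret P: prob_space "PiM I M" by (intro prob_space_PiM M)
  interpret Q: prob_space "PiM (insert i I) M" by (intro prob_space_PiM M)
  interpret PP: pair_prob_space "PiM I M" "M i" ..
  note [measurable] = insert.prems(1)
  have upd [measurable]: "(\<lambda>(x, w). x(i := w)) \<in> measurable (PiM I M \<Otimes>\<^sub>M M i) (PiM (insert i I) M)"
    by (rule measurable_add_dim)
  have mf [measurable]: "(\<lambda>(x, w). f (x(i := w))) \<in> borel_measurable (PiM I M \<Otimes>\<^sub>M M i)"
    using measurable_compose[OF upd insert.prems(1)] by (simp add: case_prod_unfold)
  have mfx [measurable]: "(\<lambda>w. f (x(i := w))) \<in> borel_measurable (M i)" if "x \<in> space (PiM I M)" for x
    using measurable_compose[OF measurable_Pair1'[OF that] mf] by simp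
  have sp: "x(i := w) \<in> space (PiM (insert i I) M)" if "x \<in> space (PiM I M)" "w \<in> space (M i)" for x w
    using that insert.hyps by (auto simp: space_PiM PiE_iff extensional_def)
  have fB: "\<bar>f (x(i := w))\<bar> \<le> B" if "x \<in> space (PiM I M)" "w \<in> space (M i)" for x w
    using insert.prems(2) sp that by blast
  have B0: "0 \<le> B"
    using P.not_empty Mi.not_empty fB by (metis abs_ge_zero ex_in_conv order_trans)
  define F where "F x = (\<integral>w. f (x(i := w)) \<partial>M i)" for x
  define S where "S x = (\<integral>w. (f (x(i := w)))\<^sup>2 \<partial>M i)" for x
  have F_meas [measurable]: "F \<in> borel_measurable (PiM I M)"
    unfolding F_def using Mi.borel_measurable_lebesgue_integral[OF mf] by simp
  have S_meas [measurable]: "S \<in> borel_measurable (PiM I M)"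
    unfolding S_def using Mi.borel_measurable_lebesgue_integral[of "\<lambda>x w. (f (x(i := w)))\<^sup>2" "PiM I M"] by simp
  have int_f: "integrable (M i) (\<lambda>w. f (x(i := w)))" if "x \<in> space (PiM I M)" for x
    by (rule Mi.integrable_const_bound[of _ B]) (use that fB in auto)
  have sq: "y\<^sup>2 \<le> B\<^sup>2" if "\<bar>y\<bar> \<le> B" for y
    using that by (metis abs_ge_zero power2_abs power_mono)
  have FB: "\<bar>F x\<bar> \<le> B" if "x \<in> space (PiM I M)" for x
  proof -
    have "norm (F x) \<le> (\<integral>w. norm (f (x(i := w))) \<partial>M i)"
      unfolding F_def by (rule integral_norm_bound)
    also have "\<dots> \<le> (\<integral>w. B \<partial>M i)"
      using fB that int_f[OF that] by (intro integral_mono) auto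
    finally show ?thesis by (simp add: Mi.prob_space)
  qed
  have int_f2: "integrable (M i) (\<lambda>w. (f (x(i := w)))\<^sup>2)" if "x \<in> space (PiM I M)" for x
    by (rule Mi.integrable_const_bound[of _ "B\<^sup>2"]) (use that fB sq in auto)
  have SB: "0 \<le> S x \<and> S x \<le> B\<^sup>2" if "x \<in> space (PiM I M)" for x
  proof -
    have "S x \<le> (\<integral>w. B\<^sup>2 \<partial>M i)"
      unfolding S_def using fB sq that int_f2[OF that] by (intro integral_mono) auto
    moreover have "0 \<le> S x" unfolding S_def by simp
    ultimately show ?thesis by (simp add: Mi.prob_space)
  qed
  have int_S: "integrable (PiM I M) S"
    by (rule P.integrable_const_bound[of _ "B\<^sup>2"]) (use SB in auto)
  have int_F2: "integrable (PiM I M) (\<lambda>x. (F x)\<^sup>2)"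
    by (rule P.integrable_const_bound[of _ "B\<^sup>2"]) (use FB sq in auto)
  have e1: "(\<integral>x. f x \<partial>PiM (insert i I) M) = (\<integral>x. F x \<partial>PiM I M)"
    unfolding F_def
    by (rule product_integral_insert[OF insert.hyps])
       (rule Q.integrable_const_bound[of _ B], use insert.prems in auto)
  have e2: "(\<integral>x. (f x)\<^sup>2 \<partial>PiM (insert i I) M) = (\<integral>x. S x \<partial>PiM I M)"
    unfolding S_def
    by (rule product_integral_insert[OF insert.hyps])
       (rule Q.integrable_const_bound[of _ "B\<^sup>2"], use insert.prems sq in auto)
  have nonneg: "0 \<le> S x - (F x)\<^sup>2" if "x \<in> space (PiM I M)" for x
    using Mi.variance_eq[OF int_f[OF that] int_f2[OF that]]
      Bochner_Integration.integral_nonneg[of "M i" "\<lambda>w. (f (x(i := w)) - F x)\<^sup>2"]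
    by (simp add: S_def F_def)
  have nonneg': "0 \<le> (\<integral>x. (F x)\<^sup>2 \<partial>PiM I M) - (\<integral>x. F x \<partial>PiM I M)\<^sup>2"
  proof -
    have "integrable (PiM I M) F"
      by (rule P.integrable_const_bound[of _ B]) (use FB in auto)
    from P.variance_eq[OF this int_F2] show ?thesis
      using Bochner_Integration.integral_nonneg[of "PiM I M" "\<lambda>x. (F x - P.expectation F)\<^sup>2"] by simp
  qed
  define q where "q y = ennreal ((max 0 y)\<^sup>2)" for y :: real
  have q_meas [measurable]: "q \<in> borel_measurable borel" unfolding q_def by measurable
  have upd_j: "(\<lambda>(x, w). x(i := w, j := z)) \<in> measurable (PiM I M \<Otimes>\<^sub>M M i) (PiM (insert i I) M)"
    if "j \<in> insert i I" "z \<in> space (M j)" for j z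
  proof -
    have "(\<lambda>p. ((fst p)(i := snd p), z)) \<in> measurable (PiM I M \<Otimes>\<^sub>M M i) (PiM (insert i I) M \<Otimes>\<^sub>M M j)"
      using upd that by (intro measurable_Pair) (auto simp: case_prod_unfold)
    from measurable_compose[OF this fun_upd_measurable[of j "insert i I" M]] that insert.hyps
    show ?thesis by (simp add: case_prod_unfold)
  qed
  have upd3: "(\<lambda>((x, w), z). x(i := w, j := z)) \<in>
      measurable ((PiM I M \<Otimes>\<^sub>M M i) \<Otimes>\<^sub>M M j) (PiM (insert i I) M)"
    if "j \<in> insert i I" for j
  proof -
    have "(\<lambda>p. ((fst (fst p))(i := snd (fst p)), snd p)) \<in>
        measurable ((PiM I M \<Otimes>\<^sub>M M i) \<Otimes>\<^sub>M M j) (PiM (insert i I) M \<Otimes>\<^sub>M M j)"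
      using measurable_compose[OF measurable_fst upd]
      by (intro measurable_Pair) (auto simp: case_prod_unfold)
    from measurable_compose[OF this fun_upd_measurable[of j "insert i I" M]] that insert.hyps
    show ?thesis by (simp add: case_prod_unfold)
  qed
  have m3 [measurable]: "(\<lambda>((x, w), z). f (x(i := w, j := z))) \<in>
      borel_measurable ((PiM I M \<Otimes>\<^sub>M M i) \<Otimes>\<^sub>M M j)" if "j \<in> insert i I" for j
    using measurable_compose[OF upd3[OF that] insert.prems(1)]
    by (simp add: case_prod_unfold del: fun_upd_apply)
  have m3' [measurable]: "(\<lambda>((x, w), z). f (x(i := w))) \<in>
      borel_measurable ((PiM I M \<Otimes>\<^sub>M M i) \<Otimes>\<^sub>M M j)" for j
    using measurable_compose[OF measurable_fst mf, of "M j"] by (simp add: case_prod_unfold)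
  define g where "g j x w = (\<integral>\<^sup>+z. q (f (x(i := w)) - f (x(i := w, j := z))) \<partial>M j)" for j x w
  have g_meas [measurable]: "(\<lambda>(x, w). g j x w) \<in> borel_measurable (PiM I M \<Otimes>\<^sub>M M i)"
    if "j \<in> insert i I" for j
  proof -
    have "(\<lambda>(p, z). q (f ((fst p)(i := snd p)) - f ((fst p)(i := snd p, j := z))))
        \<in> borel_measurable ((PiM I M \<Otimes>\<^sub>M M i) \<Otimes>\<^sub>M M j)"
      using m3[OF that] m3'[of j] by (simp add: case_prod_unfold)
    from M.borel_measurable_nn_integral[OF this] show ?thesis
      by (simp add: g_def case_prod_unfold)
  qed
  have g_meas1: "(\<lambda>w. g j x w) \<in> borel_measurable (M i)" if "j \<in> insert i I" "x \<in> space (PiM I M)" for j x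
    using measurable_compose[OF measurable_Pair1'[OF that(2)] g_meas[OF that(1)]] by simp
  \<comment> \<open>The law of total variance; both summands are nonnegative, which allows passing
    to \<open>ennreal\<close> separately.\<close>
  have "ennreal ((\<integral>x. (f x)\<^sup>2 \<partial>PiM (insert i I) M) - (\<integral>x. f x \<partial>PiM (insert i I) M)\<^sup>2)
      = ennreal ((\<integral>x. S x - (F x)\<^sup>2 \<partial>PiM I M) + ((\<integral>x. (F x)\<^sup>2 \<partial>PiM I M) - (\<integral>x. F x \<partial>PiM I M)\<^sup>2))"
    using int_S int_F2 by (simp add: e1 e2)
  also have "\<dots> = ennreal (\<integral>x. S x - (F x)\<^sup>2 \<partial>PiM I M)
      + ennreal ((\<integral>x. (F x)\<^sup>2 \<partial>PiM I M) - (\<integral>x. F x \<partial>PiM I M)\<^sup>2)"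
    using nonneg nonneg' by (intro ennreal_plus integral_nonneg_AE AE_I2) auto
  also have "ennreal (\<integral>x. S x - (F x)\<^sup>2 \<partial>PiM I M) = (\<integral>\<^sup>+x. ennreal (S x - (F x)\<^sup>2) \<partial>PiM I M)"
    using nonneg int_S int_F2 by (intro nn_integral_eq_integral[symmetric] AE_I2) auto
  also have "\<dots> \<le> (\<integral>\<^sup>+x. \<integral>\<^sup>+w. g i x w \<partial>M i \<partial>PiM I M)"
  proof (rule nn_integral_mono)
    fix x assume x: "x \<in> space (PiM I M)"
    show "ennreal (S x - (F x)\<^sup>2) \<le> (\<integral>\<^sup>+w. g i x w \<partial>M i)"
      using variance_le_positive_differences[OF M, of "\<lambda>w. f (x(i := w))" i B] x fB[OF x]
      by (simp add: S_def F_def g_def q_def)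
  qed
  also have "ennreal ((\<integral>x. (F x)\<^sup>2 \<partial>PiM I M) - (\<integral>x. F x \<partial>PiM I M)\<^sup>2)
      \<le> (\<integral>\<^sup>+x. (\<Sum>j\<in>I. \<integral>\<^sup>+z. q (F x - F (x(j := z))) \<partial>M j) \<partial>PiM I M)"
    unfolding q_def by (rule insert.IH) (use FB in auto)
  also have "\<dots> \<le> (\<integral>\<^sup>+x. (\<Sum>j\<in>I. \<integral>\<^sup>+w. g j x w \<partial>M i) \<partial>PiM I M)"
  proof (intro nn_integral_mono sum_mono)
    fix x j assume x: "x \<in> space (PiM I M)" and j: "j \<in> I"
    interpret PJ: pair_prob_space "M i" "M j" ..
    have ij: "i \<noteq> j" using insert.hyps j by auto
    have xj: "x(j := z) \<in> space (PiM I M)" if "z \<in> space (M j)" for z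
      using that x j by (auto simp: space_PiM PiE_iff extensional_def)
    have mm: "(\<lambda>(w, z). q (f (x(i := w)) - f (x(i := w, j := z)))) \<in> borel_measurable (M i \<Otimes>\<^sub>M M j)"
    proof -
      have 1: "(\<lambda>p. ((x, fst p), snd p)) \<in> measurable (M i \<Otimes>\<^sub>M M j) ((PiM I M \<Otimes>\<^sub>M M i) \<Otimes>\<^sub>M M j)"
        using x by measurable
      have [measurable]: "(\<lambda>p. f (x(i := fst p, j := snd p))) \<in> borel_measurable (M i \<Otimes>\<^sub>M M j)"
        using measurable_compose[OF 1 m3[of j]] j by simp
      have [measurable]: "(\<lambda>p. f (x(i := fst p))) \<in> borel_measurable (M i \<Otimes>\<^sub>M M j)"
        using measurable_compose[OF 1 m3'[of j]] by simp
      show ?thesis unfolding case_prod_unfold by measurable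
    qed
    have "(\<integral>\<^sup>+z. q (F x - F (x(j := z))) \<partial>M j)
        \<le> (\<integral>\<^sup>+z. \<integral>\<^sup>+w. q (f (x(i := w)) - f (x(i := w, j := z))) \<partial>M i \<partial>M j)"
    proof (rule nn_integral_mono)
      fix z assume z: "z \<in> space (M j)"
      \<comment> \<open>Updates at \<open>i\<close> and at \<open>j\<close> commute because
        \<open>i\<close> is not in \<open>I\<close>, so the difference of two averages is the
        average of differences and Jensen applies.\<close>
      have tw: "x(i := w, j := z) = (x(j := z))(i := w)" for w using ij by (simp add: fun_upd_twist)
      have "F x - F (x(j := z)) = (\<integral>w. f (x(i := w)) - f (x(i := w, j := z)) \<partial>M i)"
        unfolding F_def tw using int_f x xj z by simp
      moreover have "ennreal ((max 0 (\<integral>w. f (x(i := w)) - f (x(i := w, j := z)) \<partial>M i))\<^sup>2)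
        \<le> (\<integral>\<^sup>+w. ennreal ((max 0 (f (x(i := w)) - f (x(i := w, j := z))))\<^sup>2) \<partial>M i)"
      proof (rule square_nn_integral_le[OF M])
        show "(\<lambda>w. f (x(i := w)) - f (x(i := w, j := z))) \<in> borel_measurable (M i)"
          unfolding tw using x xj z by measurable
        show "\<bar>f (x(i := w)) - f (x(i := w, j := z))\<bar> \<le> 2 * B" if "w \<in> space (M i)" for w
          using fB[OF x that] fB[OF xj[OF z] that] unfolding tw by linarith
      qed
      ultimately show "q (F x - F (x(j := z)))
          \<le> (\<integral>\<^sup>+w. q (f (x(i := w)) - f (x(i := w, j := z))) \<partial>M i)"
        by (simp add: q_def)
    qed
    also have "\<dots> = (\<integral>\<^sup>+w. g j x w \<partial>M i)"
      unfolding g_def by (rule PJ.Fubini'[OF mm])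
    finally show "(\<integral>\<^sup>+z. q (F x - F (x(j := z))) \<partial>M j) \<le> (\<integral>\<^sup>+w. g j x w \<partial>M i)" .
  qed
  also have "(\<integral>\<^sup>+x. \<integral>\<^sup>+w. g i x w \<partial>M i \<partial>PiM I M) + (\<integral>\<^sup>+x. (\<Sum>j\<in>I. \<integral>\<^sup>+w. g j x w \<partial>M i) \<partial>PiM I M)
      = (\<integral>\<^sup>+x. (\<Sum>j\<in>insert i I. \<integral>\<^sup>+w. g j x w \<partial>M i) \<partial>PiM I M)"
    using insert.hyps by (subst nn_integral_add[symmetric]) auto
  also have "\<dots> = (\<integral>\<^sup>+x. \<integral>\<^sup>+w. (\<Sum>j\<in>insert i I. g j x w) \<partial>M i \<partial>PiM I M)"
    by (intro nn_integral_cong nn_integral_sum[symmetric] g_meas1)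
  also have "\<dots> = (\<integral>\<^sup>+x. (\<Sum>j\<in>insert i I. \<integral>\<^sup>+z. q (f x - f (x(j := z))) \<partial>M j) \<partial>PiM (insert i I) M)"
    unfolding g_def
  proof (rule product_nn_integral_insert[OF insert.hyps, symmetric], rule borel_measurable_sum)
    fix j assume j: "j \<in> insert i I"
    have "(\<lambda>(x, z). f (x(j := z))) \<in> borel_measurable (PiM (insert i I) M \<Otimes>\<^sub>M M j)"
      using measurable_compose[OF fun_upd_measurable[of j "insert i I" M] insert.prems(1)] j insert.hyps
      by (simp add: case_prod_unfold del: fun_upd_apply)
    then have "(\<lambda>(x, z). q (f x - f (x(j := z)))) \<in> borel_measurable (PiM (insert i I) M \<Otimes>\<^sub>M M j)"
      by (simp add: case_prod_unfold)
    then show "(\<lambda>x. \<integral>\<^sup>+z. q (f x - f (x(j := z))) \<partial>M j) \<in> borel_measurable (PiM (insert i I) M)"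
      by (rule M.borel_measurable_nn_integral)
  qed
  finally show ?case by (simp add: q_def add_left_mono add_right_mono del: fun_upd_apply)
qed

section \<open>Moments of the cost of an edge\<close>

lemma nn_integral_abs_powr_le:
  fixes \<gamma> s :: real
  assumes "\<gamma> < 1" "0 < s"
  shows "(\<integral>\<^sup>+a. ennreal (\<bar>a - x\<bar> powr (- \<gamma>)) * indicator {a. \<bar>a - x\<bar> < s} a \<partial>lborel)
    \<le> ennreal (2 * s powr (1 - \<gamma>) / (1 - \<gamma>))"
proof -
  \<comment> \<open>The one-sided singularity. The two-sided integrand is dominated by a translate
    of \<open>g\<close> plus a reflected translate, which accounts for the factor 2.\<close>
  define g where "g a = indicator {0..s} a * (a powr (- \<gamma>))" for a :: real
  have gm [measurable]: "g \<in> borel_measurable borel" unfolding g_def by measurable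
  have int: "((\<lambda>a. a powr (- \<gamma>)) has_integral (s powr (1 - \<gamma>) / (1 - \<gamma>))) {0..s}"
    using has_integral_powr_from_0[of "- \<gamma>" s] assms by simp
  have I: "(\<integral>\<^sup>+a. ennreal (g a) \<partial>lborel) = ennreal (s powr (1 - \<gamma>) / (1 - \<gamma>))"
  proof (intro nn_integral_has_integral_lborel)
    show "(g has_integral s powr (1 - \<gamma>) / (1 - \<gamma>)) UNIV"
      using int has_integral_restrict_UNIV[of "{0..s}" "\<lambda>a. a powr (- \<gamma>)"]
      by (simp add: g_def[abs_def] indicator_def of_bool_def if_distrib[of "\<lambda>x. x * _"] cong: if_cong)
  qed (auto simp: g_def)
  have "(\<integral>\<^sup>+a. ennreal (\<bar>a - x\<bar> powr (- \<gamma>)) * indicator {a. \<bar>a - x\<bar> < s} a \<partial>lborel)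
    \<le> (\<integral>\<^sup>+a. ennreal (g (a - x)) + ennreal (g (x - a)) \<partial>lborel)"
    by (intro nn_integral_mono) (auto simp: g_def indicator_def)
  also have "\<dots> = (\<integral>\<^sup>+a. ennreal (g (a - x)) \<partial>lborel) + (\<integral>\<^sup>+a. ennreal (g (x - a)) \<partial>lborel)"
    by (rule nn_integral_add) auto
  also have "(\<integral>\<^sup>+a. ennreal (g (a - x)) \<partial>lborel) = (\<integral>\<^sup>+a. ennreal (g a) \<partial>lborel)"
    using nn_integral_real_affine[of "\<lambda>a. ennreal (g (a - x))" 1 x] by simp
  also have "(\<integral>\<^sup>+a. ennreal (g (x - a)) \<partial>lborel) = (\<integral>\<^sup>+a. ennreal (g a) \<partial>lborel)"
    using nn_integral_real_affine[of "\<lambda>a. ennreal (g (x - a))" "-1" x] by simp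
  also have "(\<integral>\<^sup>+a. ennreal (g a) \<partial>lborel) + (\<integral>\<^sup>+a. ennreal (g a) \<partial>lborel)
      = ennreal (2 * s powr (1 - \<gamma>) / (1 - \<gamma>))"
    unfolding I using assms by (simp flip: ennreal_plus)
  finally show ?thesis .
qed

text \<open>Since \<open>a\<^sup>2 + b\<^sup>2 \<ge> \<bar>a\<bar> * \<bar>b\<bar>\<close>, the singularity \<open>dist x y powr (- \<beta>)\<close> is dominated by
  a product of one-dimensional singularities of order \<open>\<beta> / 2 < 1\<close>.\<close>

lemma nn_integral_dist_powr_le:
  fixes x :: point and \<beta> s :: real
  assumes "0 \<le> \<beta>" "\<beta> < 2" "0 < s"
  shows "(\<integral>\<^sup>+y. ennreal (dist x y powr (- \<beta>)) * indicator {y. dist x y < s} y \<partial>lborel)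
    \<le> ennreal (4 / (1 - \<beta> / 2)\<^sup>2 * s powr (2 - \<beta>))"
proof -
  obtain x1 x2 where x: "x = (x1, x2)" by (cases x)
  define \<gamma> where "\<gamma> = \<beta> / 2"
  have \<gamma>: "0 \<le> \<gamma>" "\<gamma> < 1" using assms by (auto simp: \<gamma>_def)
  define g where "g c a = ennreal (\<bar>a - c\<bar> powr (- \<gamma>)) * indicator {a. \<bar>a - c\<bar> < s} a" for a c :: real
  have gm [measurable]: "g c \<in> borel_measurable borel" for c unfolding g_def by measurable
  define K where "K = ennreal (2 * s powr (1 - \<gamma>) / (1 - \<gamma>))"
  have gK: "(\<integral>\<^sup>+a. g c a \<partial>lborel) \<le> K" for c
    unfolding g_def K_def by (rule nn_integral_abs_powr_le) (use \<gamma> assms in auto)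
  \<comment> \<open>On the lines \<open>a = x1\<close> and \<open>b = x2\<close> the product on the
    right is 0, because \<open>0 powr _ = 0\<close>, and the estimate could fail; these lines are
    null sets and are removed below.\<close>
  have pt: "ennreal (dist x (a, b) powr (- \<beta>)) * indicator {y. dist x y < s} (a, b) \<le> g x1 a * g x2 b"
    if "a \<noteq> x1" "b \<noteq> x2" for a b
  proof (cases "dist x (a, b) < s")
    case True
    define u v where "u = \<bar>a - x1\<bar>" and "v = \<bar>b - x2\<bar>"
    have uv: "u > 0" "v > 0" using that by (auto simp: u_def v_def)
    have d: "dist x (a, b) = sqrt (u\<^sup>2 + v\<^sup>2)"
      by (simp add: x dist_prod_def dist_real_def u_def v_def abs_minus_commute)
    have "u * v \<le> u\<^sup>2 + v\<^sup>2"
    proof -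
      have "0 < u * v" using uv by simp
      then show ?thesis using sum_squares_bound[of u v] by linarith
    qed
    then have "(sqrt (u\<^sup>2 + v\<^sup>2)) powr (- \<beta>) \<le> (sqrt (u * v)) powr (- \<beta>)"
      using uv assms by (intro powr_mono2') auto
    also have "\<dots> = (u * v) powr (- \<gamma>)"
      using uv by (simp add: powr_half_sqrt[symmetric] powr_powr \<gamma>_def)
    also have "\<dots> = u powr (- \<gamma>) * v powr (- \<gamma>)"
      using uv by (simp add: powr_mult)
    finally have "dist x (a, b) powr (- \<beta>) \<le> u powr (- \<gamma>) * v powr (- \<gamma>)" by (simp add: d)
    moreover have "u < s" "v < s"
      using True d real_sqrt_sum_squares_ge1[of u v] real_sqrt_sum_squares_ge2[of v u] by linarith+
    ultimately show ?thesis
      by (simp add: g_def u_def v_def True ennreal_mult'[symmetric] ennreal_leI)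
  qed simp
  have "(\<integral>\<^sup>+y. ennreal (dist x y powr (- \<beta>)) * indicator {y. dist x y < s} y \<partial>lborel)
      = (\<integral>\<^sup>+y. ennreal (dist x y powr (- \<beta>)) * indicator {y. dist x y < s} y \<partial>(lborel \<Otimes>\<^sub>M lborel))"
    by (simp add: lborel_prod)
  also have "\<dots> = (\<integral>\<^sup>+a. \<integral>\<^sup>+b. ennreal (dist x (a, b) powr (- \<beta>)) * indicator {y. dist x y < s} (a, b)
      \<partial>lborel \<partial>lborel)"
    by (subst lborel.nn_integral_fst[symmetric]) (simp_all add: lborel_prod)
  also have "\<dots> \<le> (\<integral>\<^sup>+a. \<integral>\<^sup>+b. g x1 a * g x2 b \<partial>lborel \<partial>lborel)"
  proof (rule nn_integral_mono_AE, rule AE_mp[OF AE_lborel_singleton[of x1]], intro AE_I2 impI)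
    fix a assume a: "a \<noteq> x1"
    show "(\<integral>\<^sup>+b. ennreal (dist x (a, b) powr (- \<beta>)) * indicator {y. dist x y < s} (a, b) \<partial>lborel)
       \<le> (\<integral>\<^sup>+b. g x1 a * g x2 b \<partial>lborel)"
      by (rule nn_integral_mono_AE, rule AE_mp[OF AE_lborel_singleton[of x2]], intro AE_I2 impI pt a)
  qed
  also have "\<dots> = (\<integral>\<^sup>+a. g x1 a \<partial>lborel) * (\<integral>\<^sup>+b. g x2 b \<partial>lborel)"
    by (simp add: nn_integral_cmult nn_integral_multc)
  also have "\<dots> \<le> K * K" by (intro mult_mono gK) auto
  also have "\<dots> = ennreal (4 / (1 - \<beta> / 2)\<^sup>2 * s powr (2 - \<beta>))"
  proof -
    have "s powr (2 - \<beta>) = s powr (1 - \<gamma>) * s powr (1 - \<gamma>)"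
      by (simp add: powr_add[symmetric] \<gamma>_def)
    then show ?thesis
      using \<gamma> unfolding K_def
      by (subst ennreal_mult[symmetric]) (auto simp: power2_eq_square \<gamma>_def)
  qed
  finally show ?thesis .
qed

definition location_law :: "(point \<Rightarrow> real) \<Rightarrow> point measure" where
  "location_law f = density lborel (\<lambda>x. ennreal (indicator unit_square x * f x))"

lemma measurable_density_fun:
  assumes "set_borel_measurable lborel unit_square f"
  shows "(\<lambda>x. ennreal (indicator unit_square x * f x)) \<in> borel_measurable borel"
  using assms by (simp add: set_borel_measurable_def)

lemma nn_integral_location_law_le:
  assumes f: "set_borel_measurable lborel unit_square f" and "\<And>x. x \<in> unit_square \<Longrightarrow> f x \<le> \<epsilon>"
    and g: "g \<in> borel_measurable borel" and "0 \<le> \<epsilon>"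
  shows "(\<integral>\<^sup>+y. g y \<partial>location_law f) \<le> ennreal \<epsilon> * (\<integral>\<^sup>+y. g y \<partial>lborel)"
proof -
  have "(\<integral>\<^sup>+y. g y \<partial>location_law f) = (\<integral>\<^sup>+y. ennreal (indicator unit_square y * f y) * g y \<partial>lborel)"
    unfolding location_law_def using measurable_density_fun[OF f] g
    by (subst nn_integral_density) auto
  also have "\<dots> \<le> (\<integral>\<^sup>+y. ennreal \<epsilon> * g y \<partial>lborel)"
    using assms(2,4) by (intro nn_integral_mono mult_right_mono ennreal_leI)
      (auto split: split_indicator)
  also have "\<dots> = ennreal \<epsilon> * (\<integral>\<^sup>+y. g y \<partial>lborel)"
    using g by (intro nn_integral_cmult) auto
  finally show ?thesis .
qed

lemma powr_integrable_mono:
  fixes \<mu> :: "real measure"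
  assumes "real_distribution \<mu>" "AE w in \<mu>. 0 < w" "integrable \<mu> (\<lambda>w. w powr s)" "0 \<le> a" "a \<le> s"
  shows "integrable \<mu> (\<lambda>w. w powr a)"
proof -
  interpret real_distribution \<mu> by fact
  show ?thesis
  proof (rule Bochner_Integration.integrable_bound)
    show "integrable \<mu> (\<lambda>w. 1 + w powr s)" using assms(3) by simp
    show "AE w in \<mu>. norm (w powr a) \<le> norm (1 + w powr s)"
      using assms(2)
    proof eventually_elim
      case (elim w)
      have "w powr a \<le> 1 + w powr s"
      proof (cases "w \<le> 1")
        case True
        then have "w powr a \<le> 1" using elim assms(4) powr_le1 by auto
        then show ?thesis by (simp add: add_increasing2)
      next
        case False
        then have "w powr a \<le> w powr s" using assms(5) by (intro powr_mono) auto
        then show ?thesis by simp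
      qed
      then show ?case by simp
    qed
  qed measurable
qed

text \<open>The tail of the cost of a single edge is that of \<open>dist x y powr (- \<alpha>)\<close>, up to a moment of
  the weight of order \<open>2 / \<alpha>\<close>.\<close>

lemma truncated_second_moment:
  fixes \<mu> :: "real measure"
  assumes \<alpha>: "0 < \<alpha>" "\<alpha> < 1"
    and \<mu>: "real_distribution \<mu>" "AE w in \<mu>. 0 < w" "integrable \<mu> (\<lambda>w. w powr (2 / \<alpha>))"
    and f: "set_borel_measurable lborel unit_square f" "\<And>x. x \<in> unit_square \<Longrightarrow> f x \<le> \<epsilon>" "0 \<le> \<epsilon>"
    and D: "prob_space (location_law f)" and t: "0 < t"
  shows "(\<integral>\<^sup>+w. \<integral>\<^sup>+x. \<integral>\<^sup>+y. ennreal ((\<bar>w\<bar> * dist x y powr (- \<alpha>))\<^sup>2)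
        * indicator {t<..} (\<bar>w\<bar> * dist x y powr (- \<alpha>)) \<partial>location_law f \<partial>location_law f \<partial>\<mu>)
    \<le> ennreal (\<epsilon> * (4 / (1 - \<alpha>)\<^sup>2) * (\<integral>w. w powr (2 / \<alpha>) \<partial>\<mu>) * t powr (2 - 2 / \<alpha>))"
proof -
  interpret real_distribution \<mu> by fact
  interpret D: prob_space "location_law f" by fact
  define K where "K = \<epsilon> * (4 / (1 - \<alpha>)\<^sup>2)"
  have K: "0 \<le> K" using f(3) by (simp add: K_def)
  have inner: "(\<integral>\<^sup>+y. ennreal ((\<bar>w\<bar> * dist x y powr (- \<alpha>))\<^sup>2)
        * indicator {t<..} (\<bar>w\<bar> * dist x y powr (- \<alpha>)) \<partial>location_law f)
     \<le> ennreal (K * t powr (2 - 2 / \<alpha>) * w powr (2 / \<alpha>))" if w: "0 < w" for w and x :: point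
  proof -
    \<comment> \<open>The critical radius: at positive distance the cost exceeds \<open>t\<close>
      precisely when the distance is below \<open>s\<close>.\<close>
    define s where "s = (w / t) powr (1 / \<alpha>)"
    have s: "0 < s" using w t by (simp add: s_def)
    have pt: "ennreal ((\<bar>w\<bar> * dist x y powr (- \<alpha>))\<^sup>2) * indicator {t<..} (\<bar>w\<bar> * dist x y powr (- \<alpha>))
        \<le> ennreal (w\<^sup>2) * (ennreal (dist x y powr (- (2 * \<alpha>))) * indicator {y. dist x y < s} y)" for y
    proof (cases "t < \<bar>w\<bar> * dist x y powr (- \<alpha>)")
      case True
      define d where "d = dist x y"
      have d: "0 < d" using True t by (cases "x = y") (auto simp: d_def)
      have "t < w * d powr (- \<alpha>)" using True w by (simp add: d_def)
      then have "t * d powr \<alpha> < w" using d by (simp add: powr_minus field_simps)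
      then have "d powr \<alpha> < w / t" using t by (simp add: field_simps)
      then have "(d powr \<alpha>) powr (1 / \<alpha>) < (w / t) powr (1 / \<alpha>)"
        using \<alpha> by (intro powr_less_mono2) auto
      then have "d < s" using d \<alpha> by (simp add: powr_powr s_def)
      moreover have "(\<bar>w\<bar> * d powr (- \<alpha>))\<^sup>2 = w\<^sup>2 * d powr (- (2 * \<alpha>))"
        by (simp add: power_mult_distrib) (simp add: power2_eq_square powr_add[symmetric])
      ultimately show ?thesis
        by (simp add: d_def[symmetric] True[folded d_def] ennreal_mult)
    qed simp
    have "(\<integral>\<^sup>+y. ennreal ((\<bar>w\<bar> * dist x y powr (- \<alpha>))\<^sup>2)
        * indicator {t<..} (\<bar>w\<bar> * dist x y powr (- \<alpha>)) \<partial>location_law f)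
      \<le> (\<integral>\<^sup>+y. ennreal (w\<^sup>2) * (ennreal (dist x y powr (- (2 * \<alpha>))) * indicator {y. dist x y < s} y) \<partial>location_law f)"
      by (intro nn_integral_mono pt)
    also have "\<dots> \<le> ennreal \<epsilon> * (\<integral>\<^sup>+y. ennreal (w\<^sup>2) * (ennreal (dist x y powr (- (2 * \<alpha>))) * indicator {y. dist x y < s} y) \<partial>lborel)"
      by (rule nn_integral_location_law_le[OF f(1,2)]) (use f(3) in auto)
    also have "\<dots> = ennreal \<epsilon> * (ennreal (w\<^sup>2) * (\<integral>\<^sup>+y. ennreal (dist x y powr (- (2 * \<alpha>))) * indicator {y. dist x y < s} y \<partial>lborel))"
      by (subst nn_integral_cmult) auto
    also have "\<dots> \<le> ennreal \<epsilon> * (ennreal (w\<^sup>2) * ennreal (4 / (1 - (2 * \<alpha>) / 2)\<^sup>2 * s powr (2 - 2 * \<alpha>)))"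
      by (intro mult_left_mono nn_integral_dist_powr_le) (use \<alpha> s in auto)
    also have "\<dots> = ennreal (K * (w\<^sup>2 * s powr (2 - 2 * \<alpha>)))"
      using f(3) by (simp add: K_def ennreal_mult[symmetric] algebra_simps)
    \<comment> \<open>This is where the moment of order \<open>2 / \<alpha>\<close> comes from: the
      integral over a disc of radius \<open>s\<close> is of order
      \<open>s powr (2 - 2 * \<alpha>)\<close>, and \<open>s\<close> is a power of
      \<open>w / t\<close>.\<close>
    also have "w\<^sup>2 * s powr (2 - 2 * \<alpha>) = t powr (2 - 2 / \<alpha>) * w powr (2 / \<alpha>)"
    proof -
      have "s powr (2 - 2 * \<alpha>) = (w / t) powr (2 / \<alpha> - 2)"
        using \<alpha> by (simp add: s_def powr_powr field_simps)
      also have "\<dots> = w powr (2 / \<alpha> - 2) * t powr (2 - 2 / \<alpha>)"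
        using w t powr_minus[of t "2 / \<alpha> - 2"] powr_divide[of w t "2 / \<alpha> - 2"]
        by (simp add: divide_inverse)
      moreover have "w\<^sup>2 * w powr (2 / \<alpha> - 2) = w powr (2 / \<alpha>)"
        using w powr_add[of w 2 "2 / \<alpha> - 2"] by (simp add: powr_numeral)
      ultimately show ?thesis by simp
    qed
    finally show ?thesis by (simp add: mult.assoc)
  qed
  have "(\<integral>\<^sup>+w. \<integral>\<^sup>+x. \<integral>\<^sup>+y. ennreal ((\<bar>w\<bar> * dist x y powr (- \<alpha>))\<^sup>2)
        * indicator {t<..} (\<bar>w\<bar> * dist x y powr (- \<alpha>)) \<partial>location_law f \<partial>location_law f \<partial>\<mu>)
    \<le> (\<integral>\<^sup>+w. ennreal (K * t powr (2 - 2 / \<alpha>) * w powr (2 / \<alpha>)) \<partial>\<mu>)"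
  proof (rule nn_integral_mono_AE, rule AE_mp[OF \<mu>(2)], intro AE_I2 impI)
    fix w :: real assume w: "0 < w"
    have "(\<integral>\<^sup>+x. \<integral>\<^sup>+y. ennreal ((\<bar>w\<bar> * dist x y powr (- \<alpha>))\<^sup>2)
        * indicator {t<..} (\<bar>w\<bar> * dist x y powr (- \<alpha>)) \<partial>location_law f \<partial>location_law f)
      \<le> (\<integral>\<^sup>+x. ennreal (K * t powr (2 - 2 / \<alpha>) * w powr (2 / \<alpha>)) \<partial>location_law f)"
      by (intro nn_integral_mono inner w)
    then show "(\<integral>\<^sup>+x. \<integral>\<^sup>+y. ennreal ((\<bar>w\<bar> * dist x y powr (- \<alpha>))\<^sup>2)
        * indicator {t<..} (\<bar>w\<bar> * dist x y powr (- \<alpha>)) \<partial>location_law f \<partial>location_law f)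
      \<le> ennreal (K * t powr (2 - 2 / \<alpha>) * w powr (2 / \<alpha>))"
      by (simp add: D.emeasure_space_1)
  qed
  also have "\<dots> = ennreal (\<integral>w. K * t powr (2 - 2 / \<alpha>) * w powr (2 / \<alpha>) \<partial>\<mu>)"
    using \<mu>(3) K by (intro nn_integral_eq_integral) auto
  also have "\<dots> = ennreal (K * (\<integral>w. w powr (2 / \<alpha>) \<partial>\<mu>) * t powr (2 - 2 / \<alpha>))"
    by (simp add: algebra_simps)
  finally show ?thesis by (simp add: K_def)
qed

section \<open>The random graph\<close>

definition sources :: "nat \<Rightarrow> source set" where
  "sources n = Presence ` nsets {1..n} 2 \<union> Weight ` nsets {1..n} 2 \<union> Location ` {1..n}"

declare finite_imp_finite_nsets [simp]

lemma finite_sources [simp]: "finite (sources n)"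
  by (simp add: sources_def)

lemma card_nsets_2_le: "real (card (nsets {1..n::nat} 2)) \<le> (real n)\<^sup>2"
proof -
  have "card (nsets {1..n::nat} 2) = n choose 2" by (simp add: card_nsets)
  also have "\<dots> \<le> n ^ 2"
    by (cases "2 \<le> n") (simp_all add: binomial_le_pow binomial_eq_0)
  finally show ?thesis by (metis of_nat_le_iff of_nat_power)
qed

lemma nsets_2_Min_Max:
  fixes h :: "nat set"
  assumes "h \<in> nsets V 2"
  shows "h = {Min h, Max h}" "Min h \<in> V" "Max h \<in> V" "Min h < Max h"
proof -
  obtain a b where "h = {a, b}" "a < b" "a \<in> V" "b \<in> V"
  proof -
    obtain a b where ab: "h = {a, b}" "a \<noteq> b" "a \<in> V" "b \<in> V"
      using assms by (auto simp: nsets_def card_2_iff)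
    show ?thesis
      by (rule that[of "min a b" "max a b"]) (use ab in \<open>auto simp: min_def max_def\<close>)
  qed
  then show "h = {Min h, Max h}" "Min h \<in> V" "Max h \<in> V" "Min h < Max h" by auto
qed

text \<open>The random subset takes finitely many values, so any predicate of it is a finite
  disjunction of events. Connectivity and degree conditions thus become measurable without
  inspecting their definitions.\<close>

lemma pred_finite_subset [measurable (raw)]:
  assumes "finite K" and Q: "\<And>h. h \<in> K \<Longrightarrow> Measurable.pred M (Q h)"
  shows "Measurable.pred M (\<lambda>x. P {h \<in> K. Q h x})"
proof -
  have "P {h \<in> K. Q h x} \<longleftrightarrow> (\<exists>S\<in>Pow K. P S \<and> (\<forall>h\<in>K. Q h x \<longleftrightarrow> h \<in> S))" for x
  proof
    assume "\<exists>S\<in>Pow K. P S \<and> (\<forall>h\<in>K. Q h x \<longleftrightarrow> h \<in> S)"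
    then obtain S where S: "S \<in> Pow K" "P S" "\<forall>h\<in>K. Q h x \<longleftrightarrow> h \<in> S" by blast
    then have "{h \<in> K. Q h x} = S" by auto
    with S show "P {h \<in> K. Q h x}" by simp
  qed (intro bexI[of _ "{h \<in> K. Q h x}"], auto)
  moreover have "Measurable.pred M (\<lambda>x. \<exists>S\<in>Pow K. P S \<and> (\<forall>h\<in>K. Q h x \<longleftrightarrow> h \<in> S))"
    using assms by (intro pred_intros_finite pred_intros_logic) auto
  ultimately show ?thesis by presburger
qed

text \<open>The product rule for nonnegative functions, where no integrability has to be
  checked.\<close>

lemma (in prob_space) indep_var_nn_integral_mult:
  assumes ind: "indep_var M1 X1 M2 X2"
    and \<phi>: "\<phi> \<in> borel_measurable M1" and \<psi>: "\<psi> \<in> borel_measurable M2"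
  shows "(\<integral>\<^sup>+\<omega>. \<phi> (X1 \<omega>) * \<psi> (X2 \<omega>) \<partial>M) = (\<integral>\<^sup>+\<omega>. \<phi> (X1 \<omega>) \<partial>M) * (\<integral>\<^sup>+\<omega>. \<psi> (X2 \<omega>) \<partial>M)"
proof -
  note [measurable] = \<phi> \<psi> indep_var_rv1[OF ind] indep_var_rv2[OF ind]
  interpret D1: prob_space "distr M M1 X1" by (rule prob_space_distr) simp
  interpret D2: prob_space "distr M M2 X2" by (rule prob_space_distr) simp
  have "(\<integral>\<^sup>+\<omega>. \<phi> (X1 \<omega>) * \<psi> (X2 \<omega>) \<partial>M)
      = (\<integral>\<^sup>+p. \<phi> (fst p) * \<psi> (snd p) \<partial>distr M (M1 \<Otimes>\<^sub>M M2) (\<lambda>\<omega>. (X1 \<omega>, X2 \<omega>)))"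
    by (subst nn_integral_distr) auto
  also have "\<dots> = (\<integral>\<^sup>+p. \<phi> (fst p) * \<psi> (snd p) \<partial>(distr M M1 X1 \<Otimes>\<^sub>M distr M M2 X2))"
    using ind by (simp add: indep_var_distribution_eq)
  also have "\<dots> = (\<integral>\<^sup>+x. \<integral>\<^sup>+y. \<phi> x * \<psi> y \<partial>distr M M2 X2 \<partial>distr M M1 X1)"
    by (subst D2.nn_integral_fst[symmetric]) auto
  also have "\<dots> = (\<integral>\<^sup>+x. \<phi> x \<partial>distr M M1 X1) * (\<integral>\<^sup>+y. \<psi> y \<partial>distr M M2 X2)"
    by (simp add: nn_integral_cmult nn_integral_multc)
  finally show ?thesis by (simp add: nn_integral_distr)
qed

locale homogeneous_graph = marked_random_graph \<Omega> n "\<lambda>_. p" \<mu> f Z W X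
  for \<Omega> :: "'a measure" and n :: nat and p :: real and \<mu> f Z W X +
  assumes n2: "2 \<le> n"
begin

text \<open>Presence, weight and location have different types; padding them to points makes one
  family indexed by sources, as \<open>indep_vars\<close> and the product space of the Efron-Stein
  inequality require. Presence is coded by first component 1.\<close>

definition Y :: "source \<Rightarrow> 'a \<Rightarrow> point" where
  "Y i \<omega> = (case i of Presence h \<Rightarrow> (if Z h \<omega> then 1 else 0, 0)
     | Weight h \<Rightarrow> (W h \<omega>, 0) | Location u \<Rightarrow> X u \<omega>)"

abbreviation "K \<equiv> nsets {1..n} 2"

lemma edge_exists: "{1, 2} \<in> K"
  using n2 by (auto simp: nsets_def)

lemma p_pos: "0 < p" and p_less_1: "p < 1"
  using p_range[OF edge_exists] by auto

lemmas [measurable] = Z_measurable W_measurable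

lemma X_measurable [measurable]: "u \<in> {1..n} \<Longrightarrow> random_variable borel (X u)"
  using X_density[of u] by (auto simp: distributed_def)

lemma Y_measurable [measurable]: "i \<in> sources n \<Longrightarrow> random_variable borel (Y i)"
proof -
  assume "i \<in> sources n"
  then consider h where "i = Presence h" "h \<in> K" | h where "i = Weight h" "h \<in> K"
    | u where "i = Location u" "u \<in> {1..n}"
    by (auto simp: sources_def)
  then show ?thesis
  proof cases
    case 1
    then have "(\<lambda>\<omega>. ((if Z h \<omega> then 1 else 0) :: real, 0 :: real)) \<in> measurable \<Omega> borel"
      unfolding borel_prod[symmetric] by measurable
    with 1 show ?thesis by (simp add: Y_def[abs_def])
  next
    case 2
    then have "(\<lambda>\<omega>. (W h \<omega>, 0 :: real)) \<in> measurable \<Omega> borel"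
      unfolding borel_prod[symmetric] by measurable
    with 2 show ?thesis by (simp add: Y_def[abs_def])
  next
    case 3
    with X_measurable[of u] show ?thesis by (simp add: Y_def[abs_def])
  qed
qed

text \<open>Each \<open>Y i\<close> is a measurable function of one original variable, so its
  preimages belong to the \<sigma>-algebra in the assumption \<open>independence\<close>, and
  independence is inherited by smaller families of sets.\<close>

lemma indep_Y: "indep_vars (\<lambda>_. borel) Y (sources n)"
proof -
  have "indep_sets (\<lambda>i. {Y i -` A \<inter> space \<Omega> |A. A \<in> sets borel}) (sources n)"
  proof (rule indep_sets_mono_sets[OF independence[folded sources_def]])
    fix i assume i: "i \<in> sources n"
    show "{Y i -` A \<inter> space \<Omega> |A. A \<in> sets borel} \<subseteq> (case i of
              Presence h \<Rightarrow> sets (vimage_algebra (space \<Omega>) (Z h) (count_space UNIV))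
            | Weight h \<Rightarrow> sets (vimage_algebra (space \<Omega>) (W h) borel)
            | Location u \<Rightarrow> sets (vimage_algebra (space \<Omega>) (X u) borel))"
    proof (cases i)
      case (Presence h)
      show ?thesis
      proof safe
        fix A :: "point set"
        have "Y i -` A \<inter> space \<Omega> = Z h -` {b. (if b then 1 else 0, 0) \<in> A} \<inter> space \<Omega>"
          by (auto simp: Y_def Presence)
        then show "Y i -` A \<inter> space \<Omega> \<in> (case i of
              Presence h \<Rightarrow> sets (vimage_algebra (space \<Omega>) (Z h) (count_space UNIV))
            | Weight h \<Rightarrow> sets (vimage_algebra (space \<Omega>) (W h) borel)
            | Location u \<Rightarrow> sets (vimage_algebra (space \<Omega>) (X u) borel))"
          by (simp only: Presence source.case) (rule in_vimage_algebra, simp)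
      qed
    next
      case (Weight h)
      show ?thesis
      proof safe
        fix A :: "point set" assume A: "A \<in> sets borel"
        have "(\<lambda>w::real. (w, 0::real)) \<in> measurable borel borel"
          by (simp add: borel_prod[symmetric])
        then have "(\<lambda>w. (w, 0)) -` A \<in> sets (borel :: real measure)"
          using measurable_sets[of "\<lambda>w::real. (w, 0::real)" borel borel A] A by simp
        moreover have "Y i -` A \<inter> space \<Omega> = W h -` ((\<lambda>w. (w, 0)) -` A) \<inter> space \<Omega>"
          by (auto simp: Y_def Weight)
        ultimately show "Y i -` A \<inter> space \<Omega> \<in> (case i of
              Presence h \<Rightarrow> sets (vimage_algebra (space \<Omega>) (Z h) (count_space UNIV))
            | Weight h \<Rightarrow> sets (vimage_algebra (space \<Omega>) (W h) borel)
            | Location u \<Rightarrow> sets (vimage_algebra (space \<Omega>) (X u) borel))"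
          by (simp add: Weight in_vimage_algebra)
      qed
    next
      case (Location u)
      show ?thesis
        unfolding Location source.case
        by (auto simp: Y_def[abs_def] intro: in_vimage_algebra[of _ _ "X u"])
    qed
  qed
  then show ?thesis
    by (simp add: indep_vars_def2)
qed

lemma prod_sources:
  fixes g :: "source \<Rightarrow> point \<Rightarrow> ennreal"
  assumes "J \<subseteq> sources n" "\<And>i. i \<in> J \<Longrightarrow> g i \<in> borel_measurable borel"
  shows "(\<integral>\<^sup>+\<omega>. (\<Prod>i\<in>J. g i (Y i \<omega>)) \<partial>\<Omega>) = (\<Prod>i\<in>J. \<integral>\<^sup>+\<omega>. g i (Y i \<omega>) \<partial>\<Omega>)"
proof (rule indep_vars_nn_integral)
  show "finite J" using assms(1) finite_sources finite_subset by blast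
  show "indep_vars (\<lambda>_. borel) (\<lambda>i \<omega>. g i (Y i \<omega>)) J"
    by (rule indep_vars_compose2[OF indep_vars_subset[OF indep_Y assms(1)]]) (use assms(2) in auto)
qed simp

lemma indep_sources:
  fixes \<phi> \<psi> :: "(source \<Rightarrow> point) \<Rightarrow> ennreal"
  assumes "A \<inter> B = {}" "A \<subseteq> sources n" "B \<subseteq> sources n"
    and "\<phi> \<in> borel_measurable (PiM A (\<lambda>_. borel))" "\<psi> \<in> borel_measurable (PiM B (\<lambda>_. borel))"
  shows "(\<integral>\<^sup>+\<omega>. \<phi> (restrict (\<lambda>i. Y i \<omega>) A) * \<psi> (restrict (\<lambda>i. Y i \<omega>) B) \<partial>\<Omega>)
    = (\<integral>\<^sup>+\<omega>. \<phi> (restrict (\<lambda>i. Y i \<omega>) A) \<partial>\<Omega>) * (\<integral>\<^sup>+\<omega>. \<psi> (restrict (\<lambda>i. Y i \<omega>) B) \<partial>\<Omega>)"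
  by (rule indep_var_nn_integral_mult[OF indep_var_restrict[OF indep_Y assms(1-3)] assms(4,5)])

text \<open>The absolute value makes costs nonnegative at every sample point. Weights are almost
  surely positive, so almost surely this is the cost of the edge.\<close>

definition cost :: "real \<Rightarrow> nat set \<Rightarrow> 'a \<Rightarrow> real" where
  "cost \<alpha> h \<omega> = \<bar>W h \<omega>\<bar> * dist (X (Min h) \<omega>) (X (Max h) \<omega>) powr (- \<alpha>)"

definition graph :: "'a \<Rightarrow> nat set set" where
  "graph \<omega> = graph_edges n Z \<omega>"

lemma graph_subset: "graph \<omega> \<subseteq> K"
  by (auto simp: graph_def graph_edges_def)

lemma pred_graph [measurable]: "Measurable.pred \<Omega> (\<lambda>\<omega>. P (graph \<omega>))"
  unfolding graph_def graph_edges_def by (rule pred_finite_subset) auto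

lemma cost_measurable [measurable]: "h \<in> K \<Longrightarrow> cost \<alpha> h \<in> borel_measurable \<Omega>"
  using nsets_2_Min_Max[of h "{1..n}"] unfolding cost_def by measurable

lemma cost_nonneg [simp]: "0 \<le> cost \<alpha> h \<omega>"
  by (simp add: cost_def)

text \<open>The graph is determined by the \<open>Presence\<close> sources, the costs by the others.\<close>

lemma graph_cost_indep:
  fixes \<psi> :: "real \<Rightarrow> ennreal"
  assumes h: "h \<in> K" and \<psi> [measurable]: "\<psi> \<in> borel_measurable borel"
  shows "(\<integral>\<^sup>+\<omega>. indicator {\<omega>. P (graph \<omega>)} \<omega> * \<psi> (cost \<alpha> h \<omega>) \<partial>\<Omega>)
    = ennreal (prob {\<omega> \<in> space \<Omega>. P (graph \<omega>)}) * (\<integral>\<^sup>+\<omega>. \<psi> (cost \<alpha> h \<omega>) \<partial>\<Omega>)"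
proof -
  define A where "A = Presence ` K"
  define B where "B = {Weight h, Location (Min h), Location (Max h)}"
  note mm = nsets_2_Min_Max[OF h]
  have sub: "A \<inter> B = {}" "A \<subseteq> sources n" "B \<subseteq> sources n"
    using h mm by (auto simp: A_def B_def sources_def)
  define G where "G x = {h \<in> K. fst (x (Presence h)) = 1}" for x :: "source \<Rightarrow> point"
  define \<phi> where "\<phi> x = (indicator {x. P (G x)} x :: ennreal)" for x
  define \<psi>' where "\<psi>' x = \<psi> (\<bar>fst (x (Weight h))\<bar> * dist (x (Location (Min h))) (x (Location (Max h))) powr (- \<alpha>))"
    for x :: "source \<Rightarrow> point"
  have fst_m: "(fst :: point \<Rightarrow> real) \<in> borel_measurable borel"
    by (intro borel_measurable_continuous_onI continuous_intros)
  have m1: "(\<lambda>x. fst (x i)) \<in> borel_measurable (PiM I (\<lambda>_. borel :: point measure))" if "i \<in> I" for i I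
    using measurable_compose[OF measurable_component_singleton[OF that] fst_m] .
  have [measurable]: "Measurable.pred (PiM A (\<lambda>_. borel)) (\<lambda>x. P (G x))"
    unfolding G_def
  proof (rule pred_finite_subset)
    fix h' assume "h' \<in> K"
    then have "(\<lambda>x. fst (x (Presence h'))) \<in> borel_measurable (PiM A (\<lambda>_. borel :: point measure))"
      by (intro m1) (auto simp: A_def)
    from measurable_compose[OF this, of "\<lambda>r. r = 1" "count_space UNIV"]
    show "Measurable.pred (PiM A (\<lambda>_. borel)) (\<lambda>x. fst ((x :: source \<Rightarrow> point) (Presence h')) = 1)"
      by simp
  qed simp
  have \<phi>_m: "\<phi> \<in> borel_measurable (PiM A (\<lambda>_. borel))" unfolding \<phi>_def by measurable
  have \<psi>_m: "\<psi>' \<in> borel_measurable (PiM B (\<lambda>_. borel))"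
  proof -
    have [measurable]: "(\<lambda>x. fst (x (Weight h))) \<in> borel_measurable (PiM B (\<lambda>_. borel :: point measure))"
      by (intro m1) (auto simp: B_def)
    have [measurable]: "(\<lambda>x. x i) \<in> measurable (PiM B (\<lambda>_. borel :: point measure)) borel" if "i \<in> B" for i
      by (rule measurable_component_singleton[OF that])
    show ?thesis unfolding \<psi>'_def by (measurable; simp add: B_def)
  qed
  have e1: "\<phi> (restrict (\<lambda>i. Y i \<omega>) A) = indicator {\<omega>. P (graph \<omega>)} \<omega>" for \<omega>
  proof -
    have "G (restrict (\<lambda>i. Y i \<omega>) A) = graph \<omega>"
      by (auto simp: G_def graph_def graph_edges_def A_def Y_def)
    then show ?thesis by (simp add: \<phi>_def indicator_def)
  qed
  have e2: "\<psi>' (restrict (\<lambda>i. Y i \<omega>) B) = \<psi> (cost \<alpha> h \<omega>)" for \<omega>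
    by (simp add: \<psi>'_def B_def Y_def cost_def)
  have "(\<integral>\<^sup>+\<omega>. indicator {\<omega>. P (graph \<omega>)} \<omega> \<partial>\<Omega>) = (\<integral>\<^sup>+\<omega>. indicator {\<omega> \<in> space \<Omega>. P (graph \<omega>)} \<omega> \<partial>\<Omega>)"
    by (intro nn_integral_cong) (auto simp: indicator_def)
  also have "\<dots> = ennreal (prob {\<omega> \<in> space \<Omega>. P (graph \<omega>)})"
    by (subst nn_integral_indicator) (auto simp: emeasure_eq_measure)
  finally show ?thesis
    using indep_sources[OF sub \<phi>_m \<psi>_m] by (simp add: e1 e2)
qed

lemma prob_present: "h \<in> K \<Longrightarrow> prob {\<omega> \<in> space \<Omega>. Z h \<omega>} = p"
proof -
  assume h: "h \<in> K"
  have "measure (distr \<Omega> (count_space UNIV) (Z h)) {True} = p"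
    using Z_bernoulli[OF h] p_pos p_less_1 by (simp add: measure_pmf_single)
  then have "prob (Z h -` {True} \<inter> space \<Omega>) = p"
    using Z_measurable[OF h] by (simp add: measure_distr)
  moreover have "Z h -` {True} \<inter> space \<Omega> = {\<omega> \<in> space \<Omega>. Z h \<omega>}" by auto
  ultimately show ?thesis by simp
qed

lemma location_law: "u \<in> {1..n} \<Longrightarrow> distr \<Omega> borel (X u) = location_law f"
  using X_density[of u] by (auto simp: distributed_def location_law_def cong: distr_cong)

lemma prob_location_law: "prob_space (location_law f)"
  using location_law[of 1] n2 prob_space_distr[of "X 1" borel] by auto

lemma sets_location_law [simp, measurable_cong]: "sets (location_law f) = sets borel"
  by (simp add: location_law_def)

text \<open>The weight and the two locations belong to three distinct sources, hence are
  independent. The right-hand side involves neither \<open>h\<close> nor \<open>n\<close> nor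
  \<open>p\<close>, which is why moment constants are uniform.\<close>

lemma nn_integral_cost:
  fixes \<psi> :: "real \<Rightarrow> ennreal"
  assumes h: "h \<in> K" and \<psi> [measurable]: "\<psi> \<in> borel_measurable borel"
  shows "(\<integral>\<^sup>+\<omega>. \<psi> (cost \<alpha> h \<omega>) \<partial>\<Omega>)
    = (\<integral>\<^sup>+w. \<integral>\<^sup>+x. \<integral>\<^sup>+y. \<psi> (\<bar>w\<bar> * dist x y powr (- \<alpha>)) \<partial>location_law f \<partial>location_law f \<partial>\<mu>)"
proof -
  define u v where "u = Min h" and "v = Max h"
  note mm = nsets_2_Min_Max[OF h, folded u_def v_def]
  interpret D: prob_space "location_law f" by (rule prob_location_law)
  interpret DD: pair_prob_space "location_law f" "location_law f" ..
  have in_src: "Weight h \<in> sources n" "Location u \<in> sources n" "Location v \<in> sources n"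
    using h mm by (auto simp: sources_def)
  have comp: "(\<lambda>x. x i) \<in> measurable (PiM I (\<lambda>_. borel :: point measure)) borel" if "i \<in> I" for i I
    by (rule measurable_component_singleton[OF that])
  have i1: "indep_var borel (X u) borel (X v)"
  proof -
    have "indep_var (PiM {Location u} (\<lambda>_. borel)) (\<lambda>\<omega>. restrict (\<lambda>i. Y i \<omega>) {Location u})
        (PiM {Location v} (\<lambda>_. borel)) (\<lambda>\<omega>. restrict (\<lambda>i. Y i \<omega>) {Location v})"
      by (rule indep_var_restrict[OF indep_Y]) (use in_src mm in auto)
    from indep_var_compose[OF this comp[of "Location u"] comp[of "Location v"]] show ?thesis
      by (simp add: comp_def Y_def)
  qed
  \<comment> \<open>The weight is padded with zeros because \<open>indep_var\<close> relates two
    variables of the same type.\<close>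
  have i2: "indep_var borel (\<lambda>\<omega>. ((W h \<omega>, 0) :: point, 0 :: point)) borel (\<lambda>\<omega>. (X u \<omega>, X v \<omega>))"
  proof -
    have ind: "indep_var (PiM {Weight h} (\<lambda>_. borel)) (\<lambda>\<omega>. restrict (\<lambda>i. Y i \<omega>) {Weight h})
        (PiM {Location u, Location v} (\<lambda>_. borel)) (\<lambda>\<omega>. restrict (\<lambda>i. Y i \<omega>) {Location u, Location v})"
      by (rule indep_var_restrict[OF indep_Y]) (use in_src mm in auto)
    have m1: "(\<lambda>x. (x (Weight h), 0 :: point)) \<in> measurable (PiM {Weight h} (\<lambda>_. borel :: point measure)) borel"
      unfolding borel_prod[symmetric, where 'a = point] by (intro measurable_Pair comp) auto
    have m2: "(\<lambda>x. (x (Location u), x (Location v))) \<in>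
        measurable (PiM {Location u, Location v} (\<lambda>_. borel :: point measure)) borel"
      unfolding borel_prod[symmetric, where 'a = point] by (intro measurable_Pair comp) auto
    show ?thesis
      using indep_var_compose[OF ind m1 m2] by (simp add: comp_def Y_def)
  qed
  have [measurable]: "random_variable borel (X u)" "random_variable borel (X v)"
    "random_variable borel (W h)"
    using mm h by auto
  have d2: "distr \<Omega> borel (\<lambda>\<omega>. (X u \<omega>, X v \<omega>)) = location_law f \<Otimes>\<^sub>M location_law f"
    using i1 mm by (simp add: indep_var_distribution_eq location_law borel_prod)
  have [measurable_cong]: "sets \<mu> = sets borel" using W_law[OF h] by (metis sets_distr)
  define g where "g a q = \<psi> (\<bar>fst (fst a)\<bar> * dist (fst q) (snd q) powr (- \<alpha>))" for a q :: "point \<times> point"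
  have gm [measurable]: "(\<lambda>(a, q). g a q) \<in> borel_measurable (borel \<Otimes>\<^sub>M borel)"
  proof -
    have [measurable]: "(\<lambda>a. fst (fst a)) \<in> borel_measurable (borel :: (point \<times> point) measure)"
      by (intro borel_measurable_continuous_onI continuous_intros)
    have "(\<lambda>q. dist (fst q) (snd q)) \<in> borel_measurable (borel :: (point \<times> point) measure)"
      by (intro borel_measurable_continuous_onI continuous_intros)
    from measurable_compose[OF measurable_snd this]
    have [measurable]: "(\<lambda>z. dist (fst (snd z)) (snd (snd z)))
        \<in> borel_measurable (borel \<Otimes>\<^sub>M borel :: ((point \<times> point) \<times> point \<times> point) measure)" .
    from measurable_compose[OF measurable_fst \<open>(\<lambda>a. fst (fst a)) \<in> _\<close>]
    have [measurable]: "(\<lambda>z. fst (fst (fst z)))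
        \<in> borel_measurable (borel \<Otimes>\<^sub>M borel :: ((point \<times> point) \<times> point \<times> point) measure)" .
    show ?thesis unfolding g_def case_prod_unfold by measurable
  qed
  define V where "V \<omega> = ((W h \<omega>, 0) :: point, 0 :: point)" for \<omega>
  have V [measurable]: "random_variable borel V" using i2 by (simp add: indep_var_distribution_eq V_def[abs_def])
  have inner_m: "(\<lambda>a. \<integral>\<^sup>+q. g a q \<partial>(location_law f \<Otimes>\<^sub>M location_law f)) \<in> borel_measurable borel"
  proof (rule DD.borel_measurable_nn_integral)
    show "(\<lambda>(a, q). g a q) \<in> borel_measurable (borel \<Otimes>\<^sub>M (location_law f \<Otimes>\<^sub>M location_law f))"
      using gm by (simp add: borel_prod[symmetric] cong: measurable_cong_sets)
  qed
  have d3: "distr \<Omega> (borel \<Otimes>\<^sub>M borel) (\<lambda>\<omega>. (V \<omega>, X u \<omega>, X v \<omega>))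
      = distr \<Omega> borel V \<Otimes>\<^sub>M (location_law f \<Otimes>\<^sub>M location_law f)"
    using i2 by (simp add: indep_var_distribution_eq V_def[abs_def] d2)
  have "(\<integral>\<^sup>+\<omega>. \<psi> (cost \<alpha> h \<omega>) \<partial>\<Omega>)
    = (\<integral>\<^sup>+q. (case q of (a, q) \<Rightarrow> g a q) \<partial>distr \<Omega> (borel \<Otimes>\<^sub>M borel) (\<lambda>\<omega>. (V \<omega>, X u \<omega>, X v \<omega>)))"
    by (subst nn_integral_distr, measurable) (simp add: cost_def u_def v_def g_def V_def)
  also have "\<dots> = (\<integral>\<^sup>+a. \<integral>\<^sup>+q. g a q \<partial>(location_law f \<Otimes>\<^sub>M location_law f) \<partial>distr \<Omega> borel V)"
    unfolding d3
  proof (subst DD.nn_integral_fst[symmetric])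
    show "(\<lambda>(a, q). g a q) \<in> borel_measurable (distr \<Omega> borel V \<Otimes>\<^sub>M (location_law f \<Otimes>\<^sub>M location_law f))"
      using gm by (simp add: borel_prod[symmetric] cong: measurable_cong_sets)
  qed simp
  also have "\<dots> = (\<integral>\<^sup>+\<omega>. \<integral>\<^sup>+q. g (V \<omega>) q \<partial>(location_law f \<Otimes>\<^sub>M location_law f) \<partial>\<Omega>)"
    by (rule nn_integral_distr[OF V]) (use inner_m in simp)
  also have "\<dots> = (\<integral>\<^sup>+\<omega>. \<integral>\<^sup>+x. \<integral>\<^sup>+y. \<psi> (\<bar>W h \<omega>\<bar> * dist x y powr (- \<alpha>)) \<partial>location_law f \<partial>location_law f \<partial>\<Omega>)"
    unfolding g_def V_def by (subst D.nn_integral_fst[symmetric]) auto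
  also have "\<dots> = (\<integral>\<^sup>+w. \<integral>\<^sup>+x. \<integral>\<^sup>+y. \<psi> (\<bar>w\<bar> * dist x y powr (- \<alpha>)) \<partial>location_law f \<partial>location_law f \<partial>\<mu>)"
    unfolding W_law[OF h, symmetric] by (rule nn_integral_distr[symmetric]) auto
  finally show ?thesis .
qed

end

section \<open>Maximal forests\<close>

definition forests :: "'v set \<Rightarrow> 'v set set set" where
  "forests V = {T. T \<subseteq> nsets V 2 \<and> acyclic_edges T}"

definition forest_max :: "'v set \<Rightarrow> ('v set \<Rightarrow> real) \<Rightarrow> real" where
  "forest_max V y = Max ((\<lambda>T. \<Sum>h\<in>T. y h) ` forests V)"

lemma finite_forests [simp]: "finite V \<Longrightarrow> finite (forests V)"
  by (rule finite_subset[of _ "Pow (nsets V 2)"]) (auto simp: forests_def)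

lemma empty_forest [simp]: "{} \<in> forests V"
  by (simp add: forests_def)

lemma forest_finite: "finite V \<Longrightarrow> T \<in> forests V \<Longrightarrow> finite T"
  by (auto simp: forests_def intro: finite_subset[of _ "nsets V 2"])

lemma forest_max_ge: "finite V \<Longrightarrow> T \<in> forests V \<Longrightarrow> (\<Sum>h\<in>T. y h) \<le> forest_max V y"
  unfolding forest_max_def by (rule Max_ge) auto

lemma forest_max_attained:
  assumes "finite V"
  obtains T where "T \<in> forests V" "forest_max V y = (\<Sum>h\<in>T. y h)"
proof -
  have "forest_max V y \<in> (\<lambda>T. \<Sum>h\<in>T. y h) ` forests V"
    unfolding forest_max_def by (rule Max_in) (use assms empty_forest[of V] in \<open>auto simp del: empty_forest\<close>)
  with that show ?thesis by blast
qed

lemma forest_max_nonneg: "finite V \<Longrightarrow> 0 \<le> forest_max V y"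
  using forest_max_ge[of V "{}" y] by simp

lemma forest_max_mono:
  assumes "finite V" "\<And>h. h \<in> nsets V 2 \<Longrightarrow> y h \<le> y' h"
  shows "forest_max V y \<le> forest_max V y'"
proof -
  obtain T where T: "T \<in> forests V" "forest_max V y = (\<Sum>h\<in>T. y h)"
    using forest_max_attained[OF assms(1)] .
  have "(\<Sum>h\<in>T. y h) \<le> (\<Sum>h\<in>T. y' h)"
    by (rule sum_mono) (use T assms(2) in \<open>auto simp: forests_def\<close>)
  also have "\<dots> \<le> forest_max V y'" by (rule forest_max_ge[OF assms(1) T(1)])
  finally show ?thesis using T by simp
qed

lemma forest_max_cong:
  assumes "finite V" "\<And>h. h \<in> nsets V 2 \<Longrightarrow> y h = y' h"
  shows "forest_max V y = forest_max V y'"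
  by (rule antisym; rule forest_max_mono) (use assms in auto)

text \<open>A forest optimal for \<open>y\<close> remains a candidate for \<open>y'\<close>; off
  \<open>H\<close> it loses nothing, and on \<open>H\<close> it loses at most \<open>y h\<close>
  because \<open>y'\<close> is nonnegative. The forest \<open>T\<close> depends only on
  \<open>y\<close>, so it can be used for all changes \<open>y'\<close> simultaneously.\<close>

lemma forest_max_diff_le:
  assumes "finite V" and T: "T \<in> forests V" "forest_max V y = (\<Sum>h\<in>T. y h)"
    and y': "\<And>h. h \<in> nsets V 2 \<Longrightarrow> 0 \<le> y' h"
    and eq: "\<And>h. h \<in> nsets V 2 \<Longrightarrow> h \<notin> H \<Longrightarrow> y' h = y h"
  shows "forest_max V y - forest_max V y' \<le> (\<Sum>h\<in>T \<inter> H. y h)"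
proof -
  have TV: "h \<in> nsets V 2" if "h \<in> T" for h using that T(1) by (auto simp: forests_def)
  have fin: "finite T" by (rule forest_finite[OF assms(1) T(1)])
  have "(\<Sum>h\<in>T. y h) - (\<Sum>h\<in>T. y' h) = (\<Sum>h\<in>T. y h - y' h)" by (simp add: sum_subtractf)
  also have "\<dots> \<le> (\<Sum>h\<in>T. if h \<in> H then y h else 0)"
    by (rule sum_mono) (use y' eq TV in auto)
  also have "\<dots> = (\<Sum>h\<in>T \<inter> H. y h)" using fin by (simp add: sum.inter_restrict)
  finally show ?thesis using forest_max_ge[OF assms(1) T(1), of y'] T(2) by linarith
qed

lemma forest_max_measurable [measurable (raw)]:
  assumes "finite V" "\<And>h. h \<in> nsets V 2 \<Longrightarrow> y h \<in> borel_measurable M"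
  shows "(\<lambda>x. forest_max V (\<lambda>h. y h x)) \<in> borel_measurable M"
  unfolding forest_max_def
  by (intro borel_measurable_Max borel_measurable_sum finite_forests assms) (auto simp: forests_def)

lemma forest_card_le: "finite V \<Longrightarrow> T \<in> forests V \<Longrightarrow> card T \<le> card V"
  by (auto simp: forests_def intro: acyclic_card_le)

text \<open>The square serves two purposes: it bounds second moments directly, and divided by
  \<open>\<tau>\<close> it bounds the part of a value above \<open>\<tau>\<close>.\<close>

definition excess :: "real \<Rightarrow> real \<Rightarrow> real" where
  "excess \<tau> y = (if \<tau> < y then y\<^sup>2 else 0)"

lemma excess_nonneg [simp]: "0 \<le> excess \<tau> y"
  by (simp add: excess_def)

lemma excess_measurable [measurable]: "excess \<tau> \<in> borel_measurable borel"
  unfolding excess_def by measurable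

text \<open>A forest has at most \<open>card V\<close> edges, so an edge of value at most \<open>\<tau>\<close> may be counted as \<open>\<tau>\<close>,
  while the values above \<open>\<tau>\<close> are so rare that they may be summed over the complete graph.\<close>

lemma forest_sum_squares_le:
  fixes y :: "'v set \<Rightarrow> real"
  assumes "finite V" "T \<in> forests V" "0 < \<tau>"
    and y: "\<And>h. h \<in> nsets V 2 \<Longrightarrow> 0 \<le> y h"
  shows "(\<Sum>h\<in>T. (y h)\<^sup>2) \<le> real (card V) * \<tau>\<^sup>2 + (\<Sum>h\<in>nsets V 2. excess \<tau> (y h))"
    and "(\<Sum>h\<in>T. y h) \<le> real (card V) * \<tau> + (\<Sum>h\<in>nsets V 2. excess \<tau> (y h)) / \<tau>"
proof -
  have TV: "T \<subseteq> nsets V 2" using assms by (auto simp: forests_def)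
  have c: "real (card T) \<le> real (card V)" using forest_card_le assms(1,2) by auto
  have e: "(\<Sum>h\<in>T. excess \<tau> (y h)) \<le> (\<Sum>h\<in>nsets V 2. excess \<tau> (y h))"
    by (rule sum_mono2) (use TV assms(1) in auto)
  have "(\<Sum>h\<in>T. (y h)\<^sup>2) \<le> (\<Sum>h\<in>T. \<tau>\<^sup>2 + excess \<tau> (y h))"
  proof (rule sum_mono)
    fix h assume "h \<in> T"
    then have "0 \<le> y h" using TV y by auto
    then show "(y h)\<^sup>2 \<le> \<tau>\<^sup>2 + excess \<tau> (y h)" by (simp add: excess_def power_mono)
  qed
  also have "\<dots> = real (card T) * \<tau>\<^sup>2 + (\<Sum>h\<in>T. excess \<tau> (y h))" by (simp add: sum.distrib)
  also have "\<dots> \<le> real (card V) * \<tau>\<^sup>2 + (\<Sum>h\<in>nsets V 2. excess \<tau> (y h))"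
    using c e by (intro add_mono mult_right_mono) auto
  finally show "(\<Sum>h\<in>T. (y h)\<^sup>2) \<le> real (card V) * \<tau>\<^sup>2 + (\<Sum>h\<in>nsets V 2. excess \<tau> (y h))" .
  \<comment> \<open>A value above \<open>\<tau>\<close> is at most its square divided by
    \<open>\<tau>\<close>.\<close>
  have "(\<Sum>h\<in>T. y h) \<le> (\<Sum>h\<in>T. \<tau> + excess \<tau> (y h) / \<tau>)"
    using assms(3) by (intro sum_mono) (auto simp: excess_def power2_eq_square field_simps
        intro: add_increasing mult_left_mono)
  also have "\<dots> = real (card T) * \<tau> + (\<Sum>h\<in>T. excess \<tau> (y h)) / \<tau>"
    by (simp add: sum.distrib sum_divide_distrib)
  also have "\<dots> \<le> real (card V) * \<tau> + (\<Sum>h\<in>nsets V 2. excess \<tau> (y h)) / \<tau>"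
    using c e assms(3) by (intro add_mono mult_right_mono divide_right_mono) auto
  finally show "(\<Sum>h\<in>T. y h) \<le> real (card V) * \<tau> + (\<Sum>h\<in>nsets V 2. excess \<tau> (y h)) / \<tau>" .
qed

text \<open>Cauchy-Schwarz over the at most \<open>card V\<close> edges of a forest. This crude
  bound is for integrability and for disconnected graphs, where a small probability makes up for its
  size.\<close>

lemma forest_max_square_le:
  assumes "finite V" "\<And>h. h \<in> nsets V 2 \<Longrightarrow> 0 \<le> y h"
  shows "(forest_max V y)\<^sup>2 \<le> real (card V) * (\<Sum>h\<in>nsets V 2. (y h)\<^sup>2)"
proof -
  obtain T where T: "T \<in> forests V" "forest_max V y = (\<Sum>h\<in>T. y h)"
    using forest_max_attained[OF assms(1)] .
  have "(\<Sum>h\<in>T. y h)\<^sup>2 \<le> (\<Sum>h\<in>T. (y h)\<^sup>2) * real (card T)"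
    by (rule sum_squared_le_sum_of_squares)
  also have "\<dots> \<le> (\<Sum>h\<in>nsets V 2. (y h)\<^sup>2) * real (card V)"
    by (intro mult_mono sum_mono2)
      (use T forest_card_le[OF assms(1) T(1)] assms(1) in \<open>auto simp: forests_def intro: sum_nonneg\<close>)
  finally show ?thesis using T by (simp add: mult.commute)
qed

lemma largest_component_ruleD:
  assumes "largest_component_rule L" "2 \<le> n" "E \<subseteq> nsets {1..n} 2"
  shows "L n E \<in> components_of_graph {1..n} E"
  using assms by (auto simp: largest_component_rule_def is_largest_component_def)

lemma spanning_tree_is_forest:
  assumes "spanning_tree_of C E T" "C \<subseteq> V"
  shows "T \<in> forests V"
  using assms by (auto simp: spanning_tree_of_def is_tree_def forests_def acyclic_edges_def
      intro: nsets_mono[THEN subsetD])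

section \<open>Comparison of the spanning tree cost with the maximal forest\<close>

context homogeneous_graph
begin

definition val :: "real \<Rightarrow> nat set \<Rightarrow> 'a \<Rightarrow> real" where
  "val \<alpha> h \<omega> = (if Z h \<omega> then cost \<alpha> h \<omega> else 0)"

definition F :: "real \<Rightarrow> 'a \<Rightarrow> real" where
  "F \<alpha> \<omega> = forest_max {1..n} (\<lambda>h. val \<alpha> h \<omega>)"

lemma val_nonneg [simp]: "0 \<le> val \<alpha> h \<omega>"
  by (simp add: val_def)

lemma val_le_cost: "val \<alpha> h \<omega> \<le> cost \<alpha> h \<omega>"
  by (simp add: val_def)

lemma val_measurable [measurable]: "h \<in> K \<Longrightarrow> val \<alpha> h \<in> borel_measurable \<Omega>"
  unfolding val_def by measurable

lemma F_measurable [measurable]: "F \<alpha> \<in> borel_measurable \<Omega>"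
  unfolding F_def by (rule forest_max_measurable) auto

lemma F_nonneg: "0 \<le> F \<alpha> \<omega>"
  unfolding F_def by (rule forest_max_nonneg) simp

lemma AE_W_pos: "AE \<omega> in \<Omega>. \<forall>h\<in>K. 0 < W h \<omega>"
  by (rule AE_finite_allI) (use W_pos in auto)

lemma in_graph_iff: "h \<in> graph \<omega> \<longleftrightarrow> h \<in> K \<and> Z h \<omega>"
  by (auto simp: graph_def graph_edges_def)

context
  fixes L :: "nat \<Rightarrow> nat set set \<Rightarrow> nat set" and \<alpha> :: real
  assumes rule: "largest_component_rule L"
begin

abbreviation "tree_cost \<equiv> chi L \<alpha> n Z W X"

lemma chi_eq:
  "tree_cost \<omega> = Max ((\<lambda>T. \<Sum>h\<in>T. edge_cost (dist_cost_factor \<alpha>) W X \<omega> h)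
     ` {T. spanning_tree_of (L n (graph \<omega>)) (graph \<omega>) T})"
  unfolding chi_def max_spanning_cost_def graph_def by (intro arg_cong[where f = Max]) auto

lemma finite_spanning_trees: "E \<subseteq> K \<Longrightarrow> finite {T. spanning_tree_of C E T}"
  by (rule finite_subset[of _ "Pow K"]) (auto simp: spanning_tree_of_def)

lemma spanning_tree_exists: "{T. spanning_tree_of (L n (graph \<omega>)) (graph \<omega>) T} \<noteq> {}"
  using component_spanning_tree[OF _ graph_subset largest_component_ruleD[OF rule n2 graph_subset]] by auto

text \<open>The family of trees over which the maximum runs is random, but it depends only on the
  graph. On each of the finitely many values of the graph it is a fixed finite family.\<close>

lemma chi_measurable [measurable]: "tree_cost \<in> borel_measurable \<Omega>"
proof -
  have e_m: "(\<lambda>\<omega>. edge_cost (dist_cost_factor \<alpha>) W X \<omega> h) \<in> borel_measurable \<Omega>" if "h \<in> K" for h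
    using that nsets_2_Min_Max[OF that] unfolding edge_cost_def dist_cost_factor_def by measurable
  define m where "m E \<omega> = Max ((\<lambda>T. \<Sum>h\<in>T. edge_cost (dist_cost_factor \<alpha>) W X \<omega> h)
     ` {T. spanning_tree_of (L n E) E T})" for E \<omega>
  have m_m: "m E \<in> borel_measurable \<Omega>" if "E \<in> Pow K" for E
    unfolding m_def using that
    by (intro borel_measurable_Max borel_measurable_sum finite_spanning_trees e_m)
      (auto simp: spanning_tree_of_def)
  have "tree_cost \<omega> = (\<Sum>E\<in>Pow K. if graph \<omega> = E then m E \<omega> else 0)" for \<omega>
    using graph_subset[of \<omega>] by (simp add: sum.delta' chi_eq m_def)
  moreover have "(\<lambda>\<omega>. \<Sum>E\<in>Pow K. if graph \<omega> = E then m E \<omega> else 0) \<in> borel_measurable \<Omega>"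
    by (intro borel_measurable_sum measurable_If m_m pred_graph) auto
  ultimately show ?thesis by presburger
qed

lemma edge_cost_eq:
  assumes "0 < W h \<omega>"
  shows "edge_cost (dist_cost_factor \<alpha>) W X \<omega> h = cost \<alpha> h \<omega>"
  using assms by (simp add: edge_cost_def dist_cost_factor_def cost_def mult.commute)

lemma chi_bounds:
  assumes pos: "\<forall>h\<in>K. 0 < W h \<omega>"
  shows "0 \<le> tree_cost \<omega>" "tree_cost \<omega> \<le> F \<alpha> \<omega>"
proof -
  let ?ST = "{T. spanning_tree_of (L n (graph \<omega>)) (graph \<omega>) T}"
  have sum_eq: "(\<Sum>h\<in>T. edge_cost (dist_cost_factor \<alpha>) W X \<omega> h) = (\<Sum>h\<in>T. val \<alpha> h \<omega>)" if "T \<in> ?ST" for T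
  proof (rule sum.cong)
    fix h assume "h \<in> T"
    with that have "h \<in> K" "Z h \<omega>" by (auto simp: spanning_tree_of_def in_graph_iff)
    with pos show "edge_cost (dist_cost_factor \<alpha>) W X \<omega> h = val \<alpha> h \<omega>"
      by (simp add: edge_cost_eq val_def)
  qed simp
  have "tree_cost \<omega> \<in> (\<lambda>T. \<Sum>h\<in>T. edge_cost (dist_cost_factor \<alpha>) W X \<omega> h) ` ?ST"
    unfolding chi_eq by (rule Max_in) (use spanning_tree_exists finite_spanning_trees graph_subset in auto)
  then obtain T where T: "T \<in> ?ST" "tree_cost \<omega> = (\<Sum>h\<in>T. val \<alpha> h \<omega>)" using sum_eq by auto
  then show "0 \<le> tree_cost \<omega>" by (simp add: sum_nonneg)
  have "L n (graph \<omega>) \<subseteq> {1..n}"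
    by (rule component_subset[OF largest_component_ruleD[OF rule n2 graph_subset]])
  then have "T \<in> forests {1..n}" using T(1) spanning_tree_is_forest by blast
  then show "tree_cost \<omega> \<le> F \<alpha> \<omega>" unfolding F_def T(2) by (rule forest_max_ge[rotated]) simp
qed

text \<open>Connectedness forces the rule \<open>L\<close> to return all vertices, the forest
  extends to a spanning tree, and the added edges have nonnegative cost.\<close>

lemma chi_ge_forest:
  assumes pos: "\<forall>h\<in>K. 0 < W h \<omega>" and conn: "connected_graph {1..n} (graph \<omega>)"
    and T: "T \<subseteq> graph \<omega>" "acyclic_edges T"
  shows "(\<Sum>h\<in>T. cost \<alpha> h \<omega>) \<le> tree_cost \<omega>"
proof -
  obtain T' where T': "T \<subseteq> T'" "spanning_tree_of {1..n} (graph \<omega>) T'"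
    using forest_extends_to_spanning_tree[OF _ conn graph_subset T] by auto
  have L: "L n (graph \<omega>) = {1..n}"
    using largest_component_ruleD[OF rule n2 graph_subset, of \<omega>] components_of_connected_graph[OF conn]
    by simp
  have sub: "T' \<subseteq> K" using T'(2) graph_subset[of \<omega>] by (auto simp: spanning_tree_of_def)
  have "(\<Sum>h\<in>T. cost \<alpha> h \<omega>) \<le> (\<Sum>h\<in>T'. cost \<alpha> h \<omega>)"
    by (rule sum_mono2) (use T' in \<open>auto intro: finite_subset[OF sub]\<close>)
  also have "\<dots> = (\<Sum>h\<in>T'. edge_cost (dist_cost_factor \<alpha>) W X \<omega> h)"
    by (rule sum.cong) (use sub pos edge_cost_eq in auto)
  also have "\<dots> \<le> tree_cost \<omega>"
    unfolding chi_eq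
    by (rule Max_ge) (use T' L finite_spanning_trees graph_subset in auto)
  finally show ?thesis .
qed

text \<open>Absent edges of an optimal forest have value 0 and can be deleted; what is left is a
  forest in the graph.\<close>

lemma chi_eq_F:
  assumes pos: "\<forall>h\<in>K. 0 < W h \<omega>" and conn: "connected_graph {1..n} (graph \<omega>)"
  shows "tree_cost \<omega> = F \<alpha> \<omega>"
proof (rule antisym[OF chi_bounds(2)[OF pos]])
  obtain T where T: "T \<in> forests {1..n}" "F \<alpha> \<omega> = (\<Sum>h\<in>T. val \<alpha> h \<omega>)"
    unfolding F_def using forest_max_attained[of "{1..n}"] by auto
  have fin: "finite T" using T(1) forest_finite by blast
  have "(\<Sum>h\<in>T. val \<alpha> h \<omega>) = (\<Sum>h\<in>T \<inter> graph \<omega>. cost \<alpha> h \<omega>)"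
    unfolding sum.inter_restrict[OF fin]
    by (rule sum.cong) (use T(1) in \<open>auto simp: val_def in_graph_iff forests_def\<close>)
  also have "\<dots> \<le> tree_cost \<omega>"
    by (rule chi_ge_forest[OF pos conn])
      (use T(1) in \<open>auto simp: forests_def intro: acyclic_edges_mono\<close>)
  finally show "F \<alpha> \<omega> \<le> tree_cost \<omega>" using T(2) by simp
qed

end

end

section \<open>Exceptional graphs\<close>

text \<open>The binomial theorem in subset form, used to sum the union bound over all cuts without
  binomial coefficients.\<close>

lemma sum_Pow_power_card:
  fixes x :: real
  assumes "finite V"
  shows "(\<Sum>S\<in>Pow V. x ^ card S) = (1 + x) ^ card V"
  using assms
proof (induction V rule: finite_induct)
  case (insert a V)
  have inj: "inj_on (insert a) (Pow V)" using insert.hyps by (auto simp: inj_on_def)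
  have "(\<Sum>S\<in>Pow (insert a V). x ^ card S) = (\<Sum>S\<in>Pow V. x ^ card S) + (\<Sum>S\<in>insert a ` Pow V. x ^ card S)"
    unfolding Pow_insert using insert.hyps by (intro sum.union_disjoint) auto
  also have "(\<Sum>S\<in>insert a ` Pow V. x ^ card S) = (\<Sum>S\<in>Pow V. x * x ^ card S)"
  proof (subst sum.reindex[OF inj], rule sum.cong)
    fix S assume "S \<in> Pow V"
    then have "card (insert a S) = Suc (card S)"
      using insert.hyps by (subst card_insert_disjoint) (auto intro: finite_subset)
    then show "((\<lambda>S. x ^ card S) \<circ> insert a) S = x * x ^ card S" by simp
  qed simp
  finally show ?case using insert by (simp add: sum_distrib_left[symmetric] algebra_simps)
qed simp

lemma power_1_plus_exp_bound:
  fixes x :: real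
  assumes "0 \<le> x" "real n * x \<le> 1"
  shows "(1 + x) ^ n - 1 \<le> 2 * (real n * x)"
proof -
  have "(1 + x) ^ n \<le> exp x ^ n" using assms by (intro power_mono exp_ge_add_one_self) auto
  also have "\<dots> = exp (real n * x)" by (simp add: exp_of_nat_mult)
  also have "\<dots> \<le> 1 + real n * x + (real n * x)\<^sup>2" by (rule exp_bound) (use assms in auto)
  also have "(real n * x)\<^sup>2 \<le> real n * x"
    using assms by (simp add: power2_eq_square mult_left_le)
  finally show ?thesis by (simp add: mult.commute)
qed

context homogeneous_graph
begin

text \<open>A common generating function: with \<open>g\<close> the indicator of absence it gives
  the probability of an empty edge set, with \<open>g\<close> exponential the moment generating
  function of a degree.\<close>

lemma nn_integral_presence_prod:
  fixes g :: "bool \<Rightarrow> ennreal"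
  assumes D: "D \<subseteq> K"
  shows "(\<integral>\<^sup>+\<omega>. (\<Prod>h\<in>D. g (Z h \<omega>)) \<partial>\<Omega>) = (ennreal p * g True + ennreal (1 - p) * g False) ^ card D"
proof -
  define G where "G i x = g (fst x = 1)" for i :: source and x :: point
  have inj: "inj_on Presence D" by (auto simp: inj_on_def)
  have gm: "G i \<in> borel_measurable borel" for i
  proof -
    have "(\<lambda>r::real. g (r = 1)) \<in> borel_measurable borel" by measurable
    moreover have "(fst :: point \<Rightarrow> real) \<in> borel_measurable borel"
      by (intro borel_measurable_continuous_onI continuous_intros)
    ultimately show ?thesis unfolding G_def by (rule measurable_compose[rotated])
  qed
  have G: "G (Presence h) (Y (Presence h) \<omega>) = g (Z h \<omega>)" for h \<omega>
    by (simp add: G_def Y_def)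
  have "(\<integral>\<^sup>+\<omega>. (\<Prod>i\<in>Presence ` D. G i (Y i \<omega>)) \<partial>\<Omega>) = (\<Prod>i\<in>Presence ` D. \<integral>\<^sup>+\<omega>. G i (Y i \<omega>) \<partial>\<Omega>)"
    by (rule prod_sources) (use D gm in \<open>auto simp: sources_def\<close>)
  then have "(\<integral>\<^sup>+\<omega>. (\<Prod>h\<in>D. g (Z h \<omega>)) \<partial>\<Omega>) = (\<Prod>h\<in>D. \<integral>\<^sup>+\<omega>. g (Z h \<omega>) \<partial>\<Omega>)"
    by (simp add: prod.reindex[OF inj] G)
  also have "\<dots> = (\<Prod>h\<in>D. ennreal p * g True + ennreal (1 - p) * g False)"
  proof (rule prod.cong)
    fix h assume "h \<in> D"
    then have h: "h \<in> K" using D by auto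
    note [measurable] = Z_measurable[OF h]
    have "prob {\<omega> \<in> space \<Omega>. \<not> Z h \<omega>} = 1 - p"
      using prob_neg[of "Z h"] prob_present[OF h] h by simp
    then have e: "emeasure \<Omega> {\<omega> \<in> space \<Omega>. \<not> Z h \<omega>} = ennreal (1 - p)"
        "emeasure \<Omega> {\<omega> \<in> space \<Omega>. Z h \<omega>} = ennreal p"
      using prob_present[OF h] by (simp_all add: emeasure_eq_measure)
    have "(\<integral>\<^sup>+\<omega>. g (Z h \<omega>) \<partial>\<Omega>) = (\<integral>\<^sup>+\<omega>. g True * indicator {\<omega> \<in> space \<Omega>. Z h \<omega>} \<omega>
        + g False * indicator {\<omega> \<in> space \<Omega>. \<not> Z h \<omega>} \<omega> \<partial>\<Omega>)"
      by (intro nn_integral_cong) (auto split: split_indicator)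
    also have "\<dots> = ennreal p * g True + ennreal (1 - p) * g False"
      by (subst nn_integral_add) (auto simp: nn_integral_cmult e mult.commute)
    finally show "(\<integral>\<^sup>+\<omega>. g (Z h \<omega>) \<partial>\<Omega>) = ennreal p * g True + ennreal (1 - p) * g False" .
  qed simp
  finally show ?thesis by simp
qed

section \<open>Empty cuts and connectivity\<close>

lemma prob_no_edges:
  assumes D: "D \<subseteq> K"
  shows "prob {\<omega> \<in> space \<Omega>. D \<inter> graph \<omega> = {}} = (1 - p) ^ card D"
proof -
  have "ennreal (prob {\<omega> \<in> space \<Omega>. D \<inter> graph \<omega> = {}})
      = (\<integral>\<^sup>+\<omega>. indicator {\<omega> \<in> space \<Omega>. D \<inter> graph \<omega> = {}} \<omega> \<partial>\<Omega>)"
    by (subst nn_integral_indicator) (auto simp: emeasure_eq_measure)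
  also have "\<dots> = (\<integral>\<^sup>+\<omega>. (\<Prod>h\<in>D. if Z h \<omega> then 0 else 1) \<partial>\<Omega>)"
  proof (rule nn_integral_cong)
    fix \<omega> assume w: "\<omega> \<in> space \<Omega>"
    have fin: "finite D" using D finite_subset by fastforce
    show "indicator {\<omega> \<in> space \<Omega>. D \<inter> graph \<omega> = {}} \<omega> = (\<Prod>h\<in>D. if Z h \<omega> then 0 else 1 :: ennreal)"
    proof (cases "\<exists>h\<in>D. Z h \<omega>")
      case True
      then have "(\<Prod>h\<in>D. if Z h \<omega> then 0 else 1 :: ennreal) = 0" using fin by auto
      moreover have "D \<inter> graph \<omega> \<noteq> {}" using True D in_graph_iff by blast
      ultimately show ?thesis by simp
    next
      case False
      then have "D \<inter> graph \<omega> = {}" by (auto simp: in_graph_iff)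
      with False w show ?thesis by simp
    qed
  qed
  also have "\<dots> = ennreal ((1 - p) ^ card D)"
    using p_less_1 by (subst nn_integral_presence_prod[OF D]) (simp add: ennreal_power)
  finally show ?thesis using p_less_1 by (subst (asm) ennreal_inj) auto
qed

text \<open>Some nonempty set \<open>S\<close> of at most half of the vertices has no edge to its
  complement. This excludes at least \<open>card S * n / 2\<close> pairs, so its probability is at
  most the power \<open>card S\<close> of \<open>exp (- n p / 2)\<close>, and the sum over nonempty
  \<open>S\<close> is binomial.\<close>

lemma prob_disconnected:
  "prob {\<omega> \<in> space \<Omega>. \<not> connected_graph {1..n} (graph \<omega>)} \<le> (1 + exp (- (real n * p) / 2)) ^ n - 1"
proof -
  define x where "x = exp (- (real n * p) / 2)"
  define \<S> where "\<S> = {S \<in> Pow {1..n}. S \<noteq> {} \<and> 2 * card S \<le> n}"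
  define D where "D S = (\<lambda>(a, b). {a, b}) ` (S \<times> ({1..n} - S))" for S :: "nat set"
  have D_sub: "D S \<subseteq> K" if "S \<in> \<S>" for S
    using that by (auto simp: D_def \<S>_def nsets_def card_insert_if)
  have fin: "finite \<S>" by (simp add: \<S>_def)
  have "prob {\<omega> \<in> space \<Omega>. \<not> connected_graph {1..n} (graph \<omega>)}
      \<le> prob (\<Union>S\<in>\<S>. {\<omega> \<in> space \<Omega>. D S \<inter> graph \<omega> = {}})"
  proof (rule finite_measure_mono)
    show "{\<omega> \<in> space \<Omega>. \<not> connected_graph {1..n} (graph \<omega>)} \<subseteq> (\<Union>S\<in>\<S>. {\<omega> \<in> space \<Omega>. D S \<inter> graph \<omega> = {}})"
    proof
      fix \<omega> assume "\<omega> \<in> {\<omega> \<in> space \<Omega>. \<not> connected_graph {1..n} (graph \<omega>)}"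
      then have w: "\<omega> \<in> space \<Omega>" "\<not> connected_graph {1..n} (graph \<omega>)" by auto
      obtain S where S: "S \<subseteq> {1..n}" "S \<noteq> {}" "2 * card S \<le> card {1..n}"
        "\<forall>a\<in>S. \<forall>b\<in>{1..n} - S. {a, b} \<notin> graph \<omega>"
        using not_connected_cut[OF _ _ graph_subset w(2)] n2 by auto
      then have "S \<in> \<S>" "D S \<inter> graph \<omega> = {}" unfolding \<S>_def D_def by auto
      with w(1) show "\<omega> \<in> (\<Union>S\<in>\<S>. {\<omega> \<in> space \<Omega>. D S \<inter> graph \<omega> = {}})" by blast
    qed
  qed (use fin in \<open>auto intro!: sets.finite_UN\<close>)
  also have "\<dots> \<le> (\<Sum>S\<in>\<S>. prob {\<omega> \<in> space \<Omega>. D S \<inter> graph \<omega> = {}})"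
    by (rule finite_measure_subadditive_finite) (use fin in auto)
  also have "\<dots> \<le> (\<Sum>S\<in>\<S>. x ^ card S)"
  proof (rule sum_mono)
    fix S assume S: "S \<in> \<S>"
    have c: "card (D S) = card S * (n - card S)"
    proof -
      have "card (D S) = card (S \<times> ({1..n} - S))"
        unfolding D_def by (rule card_image) (auto simp: inj_on_def doubleton_eq_iff)
      also have "\<dots> = card S * (n - card S)"
      proof -
        have "S \<subseteq> {1..n}" "finite S" using S by (auto simp: \<S>_def intro: finite_subset)
        then have "card ({1..n} - S) = n - card S" by (simp add: card_Diff_subset)
        then show ?thesis by (simp only: card_cartesian_product)
      qed
      finally show ?thesis .
    qed
    have "real (card S) * (real n / 2) \<le> real (card S) * real (n - card S)"
      using S by (intro mult_left_mono) (auto simp: \<S>_def)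
    then have c': "real (card S) * real n / 2 \<le> real (card (D S))" by (simp add: c)
    have "prob {\<omega> \<in> space \<Omega>. D S \<inter> graph \<omega> = {}} = (1 - p) ^ card (D S)"
      by (rule prob_no_edges[OF D_sub[OF S]])
    also have "\<dots> \<le> exp (- p) ^ card (D S)"
      using p_less_1 exp_ge_add_one_self[of "- p"] by (intro power_mono) auto
    also have "\<dots> = exp (- p * real (card (D S)))" by (simp add: exp_of_nat_mult[symmetric] mult.commute)
    also have "\<dots> \<le> exp (- p * (real (card S) * real n / 2))"
      using c' p_pos by simp
    also have "\<dots> = x ^ card S" by (simp add: x_def exp_of_nat_mult[symmetric] algebra_simps)
    finally show "prob {\<omega> \<in> space \<Omega>. D S \<inter> graph \<omega> = {}} \<le> x ^ card S" .
  qed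
  also have "\<dots> \<le> (\<Sum>S\<in>Pow {1..n} - {{}}. x ^ card S)"
    by (rule sum_mono2) (auto simp: \<S>_def x_def)
  also have "\<dots> = (\<Sum>S\<in>Pow {1..n}. x ^ card S) - 1"
    by (subst sum_diff1) auto
  also have "\<dots> = (1 + x) ^ n - 1" by (subst sum_Pow_power_card) auto
  finally show ?thesis by (simp add: x_def)
qed

section \<open>Vertex degrees\<close>

definition degree :: "'a \<Rightarrow> nat \<Rightarrow> nat" where
  "degree \<omega> u = card {h \<in> graph \<omega>. u \<in> h}"

lemma incident_card_le: "card {h \<in> K. u \<in> h} \<le> n"
proof -
  have "{h \<in> K. u \<in> h} \<subseteq> (\<lambda>w. {u, w}) ` {1..n}"
    using nsets_2_D[of _ "{1..n}" u] by blast
  from card_mono[OF _ this] show ?thesis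
    using card_image_le[of "{1..n}" "\<lambda>w. {u, w}"] by simp
qed

text \<open>Chernoff's bound with parameter 1: since \<open>exp 1 \<le> 3\<close>, the mean of
  \<open>exp (degree)\<close> is at most \<open>exp (2 n p)\<close>, and the threshold
  \<open>10 n p\<close> leaves the exponent \<open>- 8 n p\<close>.\<close>

lemma prob_degree:
  "prob {\<omega> \<in> space \<Omega>. 10 * (real n * p) < real (degree \<omega> u)} \<le> exp (- 8 * (real n * p))"
proof -
  define D where "D = {h \<in> K. u \<in> h}"
  have D: "D \<subseteq> K" "card D \<le> n" using incident_card_le by (auto simp: D_def)
  have fin: "finite D" using finite_subset[OF D(1)] by simp
  have exp_deg: "exp (real (degree \<omega> u)) = (\<Prod>h\<in>D. if Z h \<omega> then exp 1 else 1)" for \<omega>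
  proof -
    have "{h \<in> graph \<omega>. u \<in> h} = {h \<in> D. Z h \<omega>}" by (auto simp: in_graph_iff D_def)
    moreover have "(\<Prod>h\<in>D. if Z h \<omega> then exp 1 else 1 :: real) = (\<Prod>h\<in>{h \<in> D. Z h \<omega>}. exp 1)"
      using fin by (rule prod.inter_filter[symmetric])
    ultimately show ?thesis by (simp add: degree_def exp_of_nat_mult[of _ "1::real", simplified])
  qed
  have "ennreal (prob {\<omega> \<in> space \<Omega>. 10 * (real n * p) < real (degree \<omega> u)})
      = (\<integral>\<^sup>+\<omega>. indicator {\<omega> \<in> space \<Omega>. 10 * (real n * p) < real (degree \<omega> u)} \<omega> \<partial>\<Omega>)"
    unfolding degree_def by (subst nn_integral_indicator) (auto simp: emeasure_eq_measure)
  also have "\<dots> \<le> (\<integral>\<^sup>+\<omega>. ennreal (exp (- 10 * (real n * p))) * (\<Prod>h\<in>D. ennreal (if Z h \<omega> then exp 1 else 1)) \<partial>\<Omega>)"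
  proof (rule nn_integral_mono)
    fix \<omega>
    have "(\<Prod>h\<in>D. ennreal (if Z h \<omega> then exp 1 else 1)) = ennreal (exp (real (degree \<omega> u)))"
      unfolding exp_deg by (rule prod_ennreal) auto
    then have "ennreal (exp (- 10 * (real n * p))) * (\<Prod>h\<in>D. ennreal (if Z h \<omega> then exp 1 else 1))
        = ennreal (exp (real (degree \<omega> u) - 10 * (real n * p)))"
      by (simp add: ennreal_mult[symmetric] exp_add[symmetric])
    moreover have "1 \<le> exp (real (degree \<omega> u) - 10 * (real n * p))" if "10 * (real n * p) < real (degree \<omega> u)"
      using that by simp
    ultimately show "indicator {\<omega> \<in> space \<Omega>. 10 * (real n * p) < real (degree \<omega> u)} \<omega>
        \<le> ennreal (exp (- 10 * (real n * p))) * (\<Prod>h\<in>D. ennreal (if Z h \<omega> then exp 1 else 1))"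
      by (auto split: split_indicator simp del: one_le_exp_iff)
  qed
  also have "\<dots> = ennreal (exp (- 10 * (real n * p))) * (\<integral>\<^sup>+\<omega>. (\<Prod>h\<in>D. ennreal (if Z h \<omega> then exp 1 else 1)) \<partial>\<Omega>)"
  proof (rule nn_integral_cmult)
    show "(\<lambda>\<omega>. \<Prod>h\<in>D. ennreal (if Z h \<omega> then exp 1 else 1)) \<in> borel_measurable \<Omega>"
    proof (rule borel_measurable_prod_ennreal)
      fix h assume "h \<in> D"
      then have [measurable]: "random_variable (count_space UNIV) (Z h)" using D by auto
      show "(\<lambda>\<omega>. ennreal (if Z h \<omega> then exp 1 else 1)) \<in> borel_measurable \<Omega>" by measurable
    qed
  qed
  also have "(\<integral>\<^sup>+\<omega>. (\<Prod>h\<in>D. ennreal (if Z h \<omega> then exp 1 else 1)) \<partial>\<Omega>)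
      = (ennreal p * ennreal (exp 1) + ennreal (1 - p)) ^ card D"
    using nn_integral_presence_prod[OF D(1), of "\<lambda>b. ennreal (if b then exp 1 else 1)"] by simp
  also have "\<dots> = ennreal ((1 + p * (exp 1 - 1)) ^ card D)"
  proof -
    have "ennreal p * ennreal (exp 1) + ennreal (1 - p) = ennreal (p * exp 1 + (1 - p))"
      using p_pos p_less_1 by (simp add: ennreal_mult ennreal_plus)
    also have "p * exp 1 + (1 - p) = 1 + p * (exp 1 - 1)" by (simp add: algebra_simps)
    finally have "ennreal p * ennreal (exp 1) + ennreal (1 - p) = ennreal (1 + p * (exp 1 - 1))" .
    then show ?thesis using p_pos by (simp only:) (rule ennreal_power, simp)
  qed
  also have "ennreal (exp (- 10 * (real n * p))) * \<dots>
      = ennreal (exp (- 10 * (real n * p)) * (1 + p * (exp 1 - 1)) ^ card D)"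
    using p_pos by (subst ennreal_mult) auto
  also have "\<dots> \<le> ennreal (exp (- 8 * (real n * p)))"
  proof (rule ennreal_leI)
    have "(1 + p * (exp 1 - 1)) ^ card D \<le> (1 + p * (exp 1 - 1)) ^ n"
      using p_pos D by (intro power_increasing) auto
    also have "\<dots> \<le> (1 + p * 2) ^ n"
      using p_pos exp_le by (intro power_mono add_left_mono mult_left_mono) auto
    also have "\<dots> \<le> exp (p * 2) ^ n"
      using p_pos by (intro power_mono exp_ge_add_one_self) auto
    also have "\<dots> = exp (2 * (real n * p))" by (simp add: exp_of_nat_mult[symmetric] algebra_simps)
    finally have "exp (- 10 * (real n * p)) * (1 + p * (exp 1 - 1)) ^ card D
        \<le> exp (- 10 * (real n * p)) * exp (2 * (real n * p))"
      by (intro mult_left_mono) auto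
    also have "\<dots> = exp (- 8 * (real n * p))" by (simp add: exp_add[symmetric])
    finally show "exp (- 10 * (real n * p)) * (1 + p * (exp 1 - 1)) ^ card D \<le> exp (- 8 * (real n * p))" .
  qed
  finally show ?thesis by (subst (asm) ennreal_le_iff) auto
qed

text \<open>A condition on an edge set instead of a sample point, so that \<open>pred_graph\<close>
  and \<open>graph_cost_indep\<close> apply to it.\<close>

definition bounded_degrees :: "nat set set \<Rightarrow> bool" where
  "bounded_degrees E \<longleftrightarrow> (\<forall>u\<in>{1..n}. real (card {h \<in> E. u \<in> h}) \<le> 10 * (real n * p))"

lemma prob_unbounded_degrees:
  "prob {\<omega> \<in> space \<Omega>. \<not> bounded_degrees (graph \<omega>)} \<le> real n * exp (- 8 * (real n * p))"
proof -
  have "prob {\<omega> \<in> space \<Omega>. \<not> bounded_degrees (graph \<omega>)}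
      \<le> prob (\<Union>u\<in>{1..n}. {\<omega> \<in> space \<Omega>. 10 * (real n * p) < real (degree \<omega> u)})"
    unfolding degree_def by (rule finite_measure_mono) (auto simp: bounded_degrees_def not_le)
  also have "\<dots> \<le> (\<Sum>u\<in>{1..n}. prob {\<omega> \<in> space \<Omega>. 10 * (real n * p) < real (degree \<omega> u)})"
    unfolding degree_def by (rule finite_measure_subadditive_finite) auto
  also have "\<dots> \<le> (\<Sum>u\<in>{1..n}. exp (- 8 * (real n * p)))"
    by (intro sum_mono prob_degree)
  finally show ?thesis by simp
qed

lemma exp_le_powr:
  assumes "c * ln (real n) \<le> t"
  shows "exp (- t) \<le> real n powr (- c)"
  using assms n2 by (simp add: powr_def)

text \<open>The constant 10 makes \<open>exp (- n p / 2)\<close> at most the inverse fifth power of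
  \<open>n\<close>; a further factor \<open>n\<close> is spent in the union bounds. The remaining
  fourth power outweighs the factors up to order \<open>n^3\<close> by which these probabilities are
  multiplied later.\<close>

lemma prob_bad_le:
  assumes "10 * ln (real n) \<le> real n * p"
  shows "prob {\<omega> \<in> space \<Omega>. \<not> connected_graph {1..n} (graph \<omega>)} \<le> 2 / real n ^ 4"
    and "prob {\<omega> \<in> space \<Omega>. \<not> bounded_degrees (graph \<omega>)} \<le> 2 / real n ^ 4"
proof -
  have n0: "0 < real n" "1 \<le> real n" using n2 by auto
  define x where "x = exp (- (real n * p) / 2)"
  have "exp (- ((real n * p) / 2)) \<le> real n powr (- 5)"
    by (rule exp_le_powr) (use assms in simp)
  then have x: "x \<le> 1 / real n ^ 5" using n0 by (simp add: x_def powr_minus_divide powr_numeral)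
  have nx: "real n * x \<le> 1 / real n ^ 4"
  proof -
    have "real n * x \<le> real n * (1 / real n ^ 5)" using x n0 by (intro mult_left_mono) auto
    also have "\<dots> = 1 / real n ^ 4" using n0 by (simp add: field_simps eval_nat_numeral)
    finally show ?thesis .
  qed
  moreover have "1 / real n ^ 4 \<le> 1" using n0 by simp
  ultimately have "(1 + x) ^ n - 1 \<le> 2 * (real n * x)"
    by (intro power_1_plus_exp_bound) (auto simp: x_def)
  with prob_disconnected nx show "prob {\<omega> \<in> space \<Omega>. \<not> connected_graph {1..n} (graph \<omega>)} \<le> 2 / real n ^ 4"
    by (fold x_def) linarith
  have "ln (real n) \<ge> 0" using n0 by simp
  then have "exp (- (8 * (real n * p))) \<le> real n powr (- 5)"
    by (intro exp_le_powr) (use assms in linarith)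
  then have "exp (- 8 * (real n * p)) \<le> 1 / real n ^ 5" using n0 by (simp add: powr_minus_divide powr_numeral)
  then have "real n * exp (- 8 * (real n * p)) \<le> real n * (1 / real n ^ 5)" using n0 by (intro mult_left_mono) auto
  also have "\<dots> = 1 / real n ^ 4" using n0 by (simp add: field_simps eval_nat_numeral)
  also have "\<dots> \<le> 2 / real n ^ 4" by (intro divide_right_mono) auto
  finally show "prob {\<omega> \<in> space \<Omega>. \<not> bounded_degrees (graph \<omega>)} \<le> 2 / real n ^ 4"
    using prob_unbounded_degrees by linarith
qed

end

section \<open>Variance of the maximal forest\<close>

definition affected :: "nat \<Rightarrow> source \<Rightarrow> nat set set" where
  "affected n i = (case i of Presence h \<Rightarrow> {h} | Weight h \<Rightarrow> {h} | Location u \<Rightarrow> {h \<in> nsets {1..n} 2. u \<in> h})"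

text \<open>The functions with prefix \<open>src_\<close> are copies of \<open>graph\<close>,
  \<open>cost\<close> and \<open>val\<close> on tuples of source values, the space in which single
  coordinates are resampled.\<close>

definition src_graph :: "nat \<Rightarrow> (source \<Rightarrow> point) \<Rightarrow> nat set set" where
  "src_graph n x = {h \<in> nsets {1..n} 2. fst (x (Presence h)) = 1}"

definition src_cost :: "real \<Rightarrow> nat set \<Rightarrow> (source \<Rightarrow> point) \<Rightarrow> real" where
  "src_cost \<alpha> h x = \<bar>fst (x (Weight h))\<bar> * dist (x (Location (Min h))) (x (Location (Max h))) powr (- \<alpha>)"

definition src_val :: "real \<Rightarrow> nat set \<Rightarrow> (source \<Rightarrow> point) \<Rightarrow> real" where
  "src_val \<alpha> h x = (if fst (x (Presence h)) = 1 then src_cost \<alpha> h x else 0)"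

lemma src_cost_nonneg [simp]: "0 \<le> src_cost \<alpha> h x"
  by (simp add: src_cost_def)

lemma src_val_nonneg [simp]: "0 \<le> src_val \<alpha> h x"
  by (simp add: src_val_def)

lemma src_val_le_cost: "src_val \<alpha> h x \<le> src_cost \<alpha> h x"
  by (simp add: src_val_def)

lemma src_val_unaffected:
  assumes "h \<in> nsets {1..n} 2" "h \<notin> affected n i"
  shows "src_val \<alpha> h (x(i := z)) = src_val \<alpha> h x"
proof -
  have "Min h \<in> h" "Max h \<in> h" using nsets_2_Min_Max(1)[OF assms(1)] by blast+
  then show ?thesis
    using assms by (cases i) (auto simp: affected_def src_val_def src_cost_def)
qed

lemma fst_component_measurable:
  "i \<in> I \<Longrightarrow> (\<lambda>x. fst (x i)) \<in> borel_measurable (PiM I (\<lambda>_. borel :: point measure))"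
  by (rule measurable_compose[OF measurable_component_singleton])
    (auto intro!: borel_measurable_continuous_onI continuous_intros)

lemma src_measurable [measurable]:
  assumes h: "h \<in> nsets {1..n} 2"
  shows "src_cost \<alpha> h \<in> borel_measurable (PiM (sources n) (\<lambda>_. borel))"
    and "src_val \<alpha> h \<in> borel_measurable (PiM (sources n) (\<lambda>_. borel))"
    and "Measurable.pred (PiM (sources n) (\<lambda>_. borel)) (\<lambda>x. fst ((x :: source \<Rightarrow> point) (Presence h)) = 1)"
proof -
  note mm = nsets_2_Min_Max[OF h]
  have "Weight h \<in> sources n" and P: "Presence h \<in> sources n"
    and L: "Location (Min h) \<in> sources n" "Location (Max h) \<in> sources n"
    using h mm by (auto simp: sources_def)
  note [measurable] = fst_component_measurable[OF this(1)]
  have [measurable]: "(\<lambda>x. x i) \<in> measurable (PiM (sources n) (\<lambda>_. borel :: point measure)) borel"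
    if "i \<in> sources n" for i
    by (rule measurable_component_singleton[OF that])
  show c [measurable]: "src_cost \<alpha> h \<in> borel_measurable (PiM (sources n) (\<lambda>_. borel))"
    unfolding src_cost_def using L by measurable
  show P' [measurable]: "Measurable.pred (PiM (sources n) (\<lambda>_. borel)) (\<lambda>x. fst ((x :: source \<Rightarrow> point) (Presence h)) = 1)"
    using measurable_compose[OF fst_component_measurable[OF P], of "\<lambda>r. r = 1" "count_space UNIV"] by simp
  show "src_val \<alpha> h \<in> borel_measurable (PiM (sources n) (\<lambda>_. borel))"
    unfolding src_val_def by measurable
qed

text \<open>Double counting: every edge has two endpoints.\<close>

lemma sum_incident:
  fixes y :: "nat set \<Rightarrow> real"
  assumes T: "T \<subseteq> nsets {1..n} 2"
  shows "(\<Sum>u\<in>{1..n}. \<Sum>h\<in>{h \<in> T. u \<in> h}. y h) = 2 * (\<Sum>h\<in>T. y h)"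
proof -
  have fin: "finite T" using finite_subset[OF T] by simp
  have "(\<Sum>u\<in>{1..n}. \<Sum>h\<in>{h \<in> T. u \<in> h}. y h) = (\<Sum>u\<in>{1..n}. \<Sum>h\<in>T. if u \<in> h then y h else 0)"
    using fin by (simp add: sum.inter_filter)
  also have "\<dots> = (\<Sum>h\<in>T. \<Sum>u\<in>{1..n}. if u \<in> h then y h else 0)" by (rule sum.swap)
  also have "\<dots> = (\<Sum>h\<in>T. 2 * y h)"
  proof (rule sum.cong)
    fix h assume "h \<in> T"
    then have "h \<subseteq> {1..n}" "card h = 2" using T by (auto simp: nsets_def)
    then have "{u \<in> {1..n}. u \<in> h} = h" by auto
    then show "(\<Sum>u\<in>{1..n}. if u \<in> h then y h else 0) = 2 * y h"
      using \<open>card h = 2\<close> by (simp flip: sum.inter_filter)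
  qed simp
  finally show ?thesis by (simp add: sum_distrib_left)
qed

text \<open>A \<open>Presence\<close> or \<open>Weight\<close> source affects a single edge, so each
  of these two kinds contributes the sum of squares once. At a \<open>Location\<close> source
  Cauchy-Schwarz costs the factor \<open>\<Delta>\<close>, and the sum over vertices counts every
  edge twice. Together this is \<open>2 * \<Delta> + 2\<close>.\<close>

lemma sum_affected_squares_le:
  fixes y :: "nat set \<Rightarrow> real"
  assumes T: "T \<subseteq> nsets {1..n} 2" and E: "\<And>h. h \<in> nsets {1..n} 2 - E \<Longrightarrow> y h = 0"
    and deg: "\<And>u. u \<in> {1..n} \<Longrightarrow> real (card {h \<in> E. u \<in> h}) \<le> \<Delta>" and "finite E"
  shows "(\<Sum>i\<in>sources n. (\<Sum>h\<in>T \<inter> affected n i. y h)\<^sup>2) \<le> (2 * \<Delta> + 2) * (\<Sum>h\<in>T. (y h)\<^sup>2)"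
proof -
  let ?K = "nsets {1..n} 2"
  define g where "g i = (\<Sum>h\<in>T \<inter> affected n i. y h)\<^sup>2" for i
  have fin: "finite T" using finite_subset[OF T] by simp
  have single: "(\<Sum>h\<in>?K. (\<Sum>h\<in>T \<inter> {h}. y h)\<^sup>2) = (\<Sum>h\<in>T. (y h)\<^sup>2)"
  proof -
    have "(\<Sum>h\<in>?K. (\<Sum>h\<in>T \<inter> {h}. y h)\<^sup>2) = (\<Sum>h\<in>?K. if h \<in> T then (y h)\<^sup>2 else 0)"
      by (intro sum.cong) auto
    also have "\<dots> = (\<Sum>h\<in>?K \<inter> T. (y h)\<^sup>2)" by (simp add: sum.inter_restrict)
    also have "?K \<inter> T = T" using T by blast
    finally show ?thesis .
  qed
  have loc: "(\<Sum>u\<in>{1..n}. g (Location u)) \<le> \<Delta> * (2 * (\<Sum>h\<in>T. (y h)\<^sup>2))"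
  proof -
    have "g (Location u) \<le> \<Delta> * (\<Sum>h\<in>{h \<in> T. u \<in> h}. (y h)\<^sup>2)" if u: "u \<in> {1..n}" for u
    proof -
      define S where "S = {h \<in> T. u \<in> h}"
      have "T \<inter> affected n (Location u) = S" using T by (auto simp: affected_def S_def)
      then have "g (Location u) = (\<Sum>h\<in>S. y h)\<^sup>2" by (simp add: g_def)
      \<comment> \<open>The forest may have many edges at \<open>u\<close>, but only those in
        \<open>E\<close> have nonzero value; the degree bound concerns \<open>E\<close>, not
        \<open>T\<close>.\<close>
      also have "(\<Sum>h\<in>S. y h) = (\<Sum>h\<in>S \<inter> E. y h)"
        by (rule sum.mono_neutral_right) (use fin E T in \<open>auto simp: S_def\<close>)
      also have "(\<Sum>h\<in>S \<inter> E. y h)\<^sup>2 \<le> (\<Sum>h\<in>S \<inter> E. (y h)\<^sup>2) * real (card (S \<inter> E))"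
        by (rule sum_squared_le_sum_of_squares)
      also have "\<dots> \<le> (\<Sum>h\<in>S. (y h)\<^sup>2) * \<Delta>"
      proof (rule mult_mono)
        show "(\<Sum>h\<in>S \<inter> E. (y h)\<^sup>2) \<le> (\<Sum>h\<in>S. (y h)\<^sup>2)"
          by (rule sum_mono2) (use fin in \<open>auto simp: S_def\<close>)
        have "card (S \<inter> E) \<le> card {h \<in> E. u \<in> h}"
          by (rule card_mono) (use \<open>finite E\<close> in \<open>auto simp: S_def\<close>)
        with deg[OF u] show "real (card (S \<inter> E)) \<le> \<Delta>" by linarith
      qed (auto intro: sum_nonneg)
      finally show ?thesis by (simp add: S_def mult.commute)
    qed
    then have "(\<Sum>u\<in>{1..n}. g (Location u)) \<le> (\<Sum>u\<in>{1..n}. \<Delta> * (\<Sum>h\<in>{h \<in> T. u \<in> h}. (y h)\<^sup>2))"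
      by (rule sum_mono)
    also have "\<dots> = \<Delta> * (2 * (\<Sum>h\<in>T. (y h)\<^sup>2))"
      by (simp only: sum_distrib_left[symmetric] sum_incident[OF T])
    finally show ?thesis .
  qed
  have "(\<Sum>i\<in>sources n. g i) = (\<Sum>i\<in>Presence ` ?K. g i) + (\<Sum>i\<in>Weight ` ?K. g i) + (\<Sum>i\<in>Location ` {1..n}. g i)"
    unfolding sources_def by (subst sum.union_disjoint; (subst sum.union_disjoint)?) auto
  also have "\<dots> = (\<Sum>h\<in>?K. g (Presence h)) + (\<Sum>h\<in>?K. g (Weight h)) + (\<Sum>u\<in>{1..n}. g (Location u))"
    by (simp add: sum.reindex inj_on_def)
  also have "\<dots> \<le> (\<Sum>h\<in>T. (y h)\<^sup>2) + (\<Sum>h\<in>T. (y h)\<^sup>2) + \<Delta> * (2 * (\<Sum>h\<in>T. (y h)\<^sup>2))"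
    using single loc by (intro add_mono) (simp_all add: g_def affected_def)
  finally show ?thesis by (simp add: g_def algebra_simps)
qed

context homogeneous_graph
begin

abbreviation "YY \<omega> \<equiv> restrict (\<lambda>i. Y i \<omega>) (sources n)"

lemma src_Y:
  assumes "h \<in> K"
  shows "src_cost \<alpha> h (YY \<omega>) = cost \<alpha> h \<omega>" "src_val \<alpha> h (YY \<omega>) = val \<alpha> h \<omega>"
proof -
  note mm = nsets_2_Min_Max[OF assms]
  have "Weight h \<in> sources n" "Presence h \<in> sources n"
    "Location (Min h) \<in> sources n" "Location (Max h) \<in> sources n"
    using assms mm by (auto simp: sources_def)
  then show "src_cost \<alpha> h (YY \<omega>) = cost \<alpha> h \<omega>" "src_val \<alpha> h (YY \<omega>) = val \<alpha> h \<omega>"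
    by (auto simp: src_cost_def cost_def src_val_def val_def Y_def)
qed

lemma src_graph_Y: "src_graph n (YY \<omega>) = graph \<omega>"
  by (auto simp: src_graph_def in_graph_iff Y_def sources_def simp del: One_nat_def)

text \<open>The cap \<open>k\<close> supplies the boundedness required by
  \<open>efron_stein\<close>; all bounds will be independent of \<open>k\<close>.\<close>

definition F_trunc :: "real \<Rightarrow> nat \<Rightarrow> 'a \<Rightarrow> real" where
  "F_trunc \<alpha> k \<omega> = forest_max {1..n} (\<lambda>h. min (real k) (val \<alpha> h \<omega>))"

text \<open>The influence bound: changing one source alters the maximum by at most the values of the
  affected edges of one fixed optimal forest; summing the squares costs a factor of the maximal degree.\<close>

definition influence :: "real \<Rightarrow> real \<Rightarrow> nat set set \<Rightarrow> (nat set \<Rightarrow> real) \<Rightarrow> (nat set \<Rightarrow> real) \<Rightarrow> real" where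
  "influence \<alpha> \<tau> E y c = (if bounded_degrees E
     then (20 * (real n * p) + 2) * (real n * \<tau>\<^sup>2 + (\<Sum>h\<in>K. excess \<tau> (y h)))
     else (2 * real n + 2) * (\<Sum>h\<in>K. (c h)\<^sup>2))"

text \<open>With bounded degrees, \<open>\<Delta> = 10 n p\<close> and the sum of squares over the
  forest is controlled by its excess. Otherwise \<open>\<Delta> = n\<close>, and the full costs
  replace the values because, unlike the values, they are independent of the graph.\<close>

lemma influence_bound:
  assumes T: "T \<in> forests {1..n}" and "0 < \<tau>"
  shows "(\<Sum>i\<in>sources n. (\<Sum>h\<in>T \<inter> affected n i. src_val \<alpha> h x)\<^sup>2)
    \<le> influence \<alpha> \<tau> (src_graph n x) (\<lambda>h. src_val \<alpha> h x) (\<lambda>h. src_cost \<alpha> h x)"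
proof -
  have TK: "T \<subseteq> K" using T by (auto simp: forests_def)
  have E: "src_val \<alpha> h x = 0" if "h \<in> K - src_graph n x" for h
    using that by (auto simp: src_graph_def src_val_def)
  have finE: "finite (src_graph n x)" unfolding src_graph_def by simp
  show ?thesis
  proof (cases "bounded_degrees (src_graph n x)")
    case True
    have "(\<Sum>i\<in>sources n. (\<Sum>h\<in>T \<inter> affected n i. src_val \<alpha> h x)\<^sup>2)
        \<le> (2 * (10 * (real n * p)) + 2) * (\<Sum>h\<in>T. (src_val \<alpha> h x)\<^sup>2)"
      by (rule sum_affected_squares_le[OF TK E]) (use True finE in \<open>auto simp: bounded_degrees_def\<close>)
    also have "\<dots> \<le> (2 * (10 * (real n * p)) + 2) * (real (card {1..n}) * \<tau>\<^sup>2 + (\<Sum>h\<in>K. excess \<tau> (src_val \<alpha> h x)))"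
      by (intro mult_left_mono forest_sum_squares_le(1)) (use T \<open>0 < \<tau>\<close> p_pos in auto)
    finally show ?thesis using True by (simp add: influence_def)
  next
    case False
    have "(\<Sum>i\<in>sources n. (\<Sum>h\<in>T \<inter> affected n i. src_val \<alpha> h x)\<^sup>2)
        \<le> (2 * real n + 2) * (\<Sum>h\<in>T. (src_val \<alpha> h x)\<^sup>2)"
    proof (rule sum_affected_squares_le[OF TK E])
      fix u
      have "card {h \<in> src_graph n x. u \<in> h} \<le> card {h \<in> K. u \<in> h}"
        by (rule card_mono) (auto simp: src_graph_def)
      with incident_card_le[of u] show "real (card {h \<in> src_graph n x. u \<in> h}) \<le> real n" by linarith
    qed (use finE in auto)
    also have "\<dots> \<le> (2 * real n + 2) * (\<Sum>h\<in>K. (src_cost \<alpha> h x)\<^sup>2)"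
    proof (rule mult_left_mono)
      have "(\<Sum>h\<in>T. (src_val \<alpha> h x)\<^sup>2) \<le> (\<Sum>h\<in>K. (src_val \<alpha> h x)\<^sup>2)"
        by (rule sum_mono2) (use TK in auto)
      also have "\<dots> \<le> (\<Sum>h\<in>K. (src_cost \<alpha> h x)\<^sup>2)"
        by (intro sum_mono power_mono src_val_le_cost) auto
      finally show "(\<Sum>h\<in>T. (src_val \<alpha> h x)\<^sup>2) \<le> (\<Sum>h\<in>K. (src_cost \<alpha> h x)\<^sup>2)" .
    qed simp
    finally show ?thesis using False by (simp add: influence_def)
  qed
qed

text \<open>By independence the joint law of the sources is a product measure, so
  \<open>efron_stein\<close> applies on the product space and is transported back along
  \<open>YY\<close>.\<close>

lemma variance_F_trunc:
  assumes \<tau>: "0 < \<tau>"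
  shows "ennreal ((\<integral>\<omega>. (F_trunc \<alpha> k \<omega>)\<^sup>2 \<partial>\<Omega>) - (\<integral>\<omega>. F_trunc \<alpha> k \<omega> \<partial>\<Omega>)\<^sup>2)
    \<le> (\<integral>\<^sup>+\<omega>. ennreal (influence \<alpha> \<tau> (graph \<omega>) (\<lambda>h. val \<alpha> h \<omega>) (\<lambda>h. cost \<alpha> h \<omega>)) \<partial>\<Omega>)"
proof -
  let ?S = "sources n"
  \<comment> \<open>\<open>efron_stein\<close> wants a probability measure at every index, hence the
    point mass at indices that are not sources.\<close>
  define M where "M i = (if i \<in> ?S then distr \<Omega> borel (Y i) else return borel 0)" for i
  have M: "prob_space (M i)" for i
    unfolding M_def by (auto intro: prob_space_distr prob_space_return)
  have sets_M: "sets (M i) = sets borel" for i by (simp add: M_def)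
  define P where "P = PiM ?S M"
  have sets_P: "sets P = sets (PiM ?S (\<lambda>_. borel))"
    unfolding P_def by (rule sets_PiM_cong) (auto simp: sets_M)
  have ne: "?S \<noteq> {}" using edge_exists by (auto simp: sources_def)
  have YY_m [measurable]: "YY \<in> measurable \<Omega> (PiM ?S (\<lambda>_. borel))"
    by (rule measurable_restrict) auto
  have P_eq: "P = distr \<Omega> (PiM ?S (\<lambda>_. borel)) YY"
  proof -
    have "distr \<Omega> (PiM ?S (\<lambda>_. borel)) YY = PiM ?S (\<lambda>i. distr \<Omega> borel (Y i))"
      using indep_vars_iff_distr_eq_PiM'[OF ne, where M' = "\<lambda>_. borel" and X = Y] indep_Y by simp
    also have "\<dots> = P" unfolding P_def by (rule PiM_cong) (auto simp: M_def)
    finally show ?thesis by simp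
  qed
  define \<phi> where "\<phi> x = forest_max {1..n} (\<lambda>h. min (real k) (src_val \<alpha> h x))" for x
  define G where "G x = influence \<alpha> \<tau> (src_graph n x) (\<lambda>h. src_val \<alpha> h x) (\<lambda>h. src_cost \<alpha> h x)" for x
  have \<phi>_m [measurable]: "\<phi> \<in> borel_measurable (PiM ?S (\<lambda>_. borel))"
    unfolding \<phi>_def by (rule forest_max_measurable) auto
  have [measurable]: "Measurable.pred (PiM ?S (\<lambda>_. borel)) (\<lambda>x. bounded_degrees (src_graph n x))"
    unfolding src_graph_def by (rule pred_finite_subset) auto
  have G_m [measurable]: "G \<in> borel_measurable (PiM ?S (\<lambda>_. borel))"
    unfolding G_def influence_def by measurable
  have \<phi>_bound: "\<bar>\<phi> x\<bar> \<le> real n * real k" for x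
  proof -
    obtain T where T: "T \<in> forests {1..n}" "\<phi> x = (\<Sum>h\<in>T. min (real k) (src_val \<alpha> h x))"
      unfolding \<phi>_def using forest_max_attained[of "{1..n}"] by auto
    have "\<phi> x \<le> (\<Sum>h\<in>T. real k)" unfolding T(2) by (rule sum_mono) simp
    also have "\<dots> \<le> real n * real k"
      using forest_card_le[OF _ T(1)] by (simp add: mult_right_mono)
    finally show ?thesis using forest_max_nonneg[of "{1..n}"] by (simp add: \<phi>_def)
  qed
  have pointwise: "(\<Sum>i\<in>?S. \<integral>\<^sup>+z. ennreal ((max 0 (\<phi> x - \<phi> (x(i := z))))\<^sup>2) \<partial>M i) \<le> ennreal (G x)" for x
  proof -
    \<comment> \<open>\<open>T\<close> is chosen from \<open>x\<close> alone, before the source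
      \<open>i\<close> and its new value \<open>z\<close>, so the same forest bounds every
      summand.\<close>
    obtain T where T: "T \<in> forests {1..n}" "\<phi> x = (\<Sum>h\<in>T. min (real k) (src_val \<alpha> h x))"
      unfolding \<phi>_def using forest_max_attained[of "{1..n}"] by auto
    define b where "b i = (\<Sum>h\<in>T \<inter> affected n i. src_val \<alpha> h x)" for i
    have b0: "0 \<le> b i" for i by (simp add: b_def sum_nonneg)
    have diff: "\<phi> x - \<phi> (x(i := z)) \<le> b i" for i z
    proof -
      have "\<phi> x - \<phi> (x(i := z)) \<le> (\<Sum>h\<in>T \<inter> affected n i. min (real k) (src_val \<alpha> h x))"
        unfolding \<phi>_def
        by (rule forest_max_diff_le) (use T in \<open>auto simp: \<phi>_def src_val_unaffected simp del: One_nat_def\<close>)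
      also have "\<dots> \<le> b i" unfolding b_def by (rule sum_mono) simp
      finally show ?thesis .
    qed
    have "(\<Sum>i\<in>?S. \<integral>\<^sup>+z. ennreal ((max 0 (\<phi> x - \<phi> (x(i := z))))\<^sup>2) \<partial>M i) \<le> (\<Sum>i\<in>?S. ennreal ((b i)\<^sup>2))"
    proof (rule sum_mono)
      fix i
      interpret Mi: prob_space "M i" by (rule M)
      have "(\<integral>\<^sup>+z. ennreal ((max 0 (\<phi> x - \<phi> (x(i := z))))\<^sup>2) \<partial>M i) \<le> (\<integral>\<^sup>+z. ennreal ((b i)\<^sup>2) \<partial>M i)"
        by (intro nn_integral_mono ennreal_leI power_mono max.boundedI diff b0) auto
      then show "(\<integral>\<^sup>+z. ennreal ((max 0 (\<phi> x - \<phi> (x(i := z))))\<^sup>2) \<partial>M i) \<le> ennreal ((b i)\<^sup>2)"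
        by (simp add: Mi.emeasure_space_1)
    qed
    also have "\<dots> = ennreal (\<Sum>i\<in>?S. (b i)\<^sup>2)" by (simp add: sum_ennreal)
    also have "\<dots> \<le> ennreal (G x)"
      unfolding b_def G_def by (intro ennreal_leI influence_bound[OF T(1) \<tau>])
    finally show ?thesis .
  qed
  have eq: "\<phi> (YY \<omega>) = F_trunc \<alpha> k \<omega>" for \<omega>
    unfolding \<phi>_def F_trunc_def by (rule forest_max_cong) (auto simp: src_Y simp del: One_nat_def)
  have eqG: "G (YY \<omega>) = influence \<alpha> \<tau> (graph \<omega>) (\<lambda>h. val \<alpha> h \<omega>) (\<lambda>h. cost \<alpha> h \<omega>)" for \<omega>
    unfolding G_def influence_def src_graph_Y by (simp add: src_Y cong: sum.cong)
  have "ennreal ((\<integral>x. (\<phi> x)\<^sup>2 \<partial>P) - (\<integral>x. \<phi> x \<partial>P)\<^sup>2)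
      \<le> (\<integral>\<^sup>+x. (\<Sum>i\<in>?S. \<integral>\<^sup>+z. ennreal ((max 0 (\<phi> x - \<phi> (x(i := z))))\<^sup>2) \<partial>M i) \<partial>P)"
    unfolding P_def
  proof (rule efron_stein)
    show "\<phi> \<in> borel_measurable (PiM ?S M)"
      using \<phi>_m sets_P by (simp add: P_def cong: measurable_cong_sets)
  qed (use M \<phi>_bound in auto)
  also have "\<dots> \<le> (\<integral>\<^sup>+x. ennreal (G x) \<partial>P)" by (intro nn_integral_mono pointwise)
  finally show ?thesis
    unfolding P_eq by (simp add: integral_distr nn_integral_distr eq eqG)
qed

end

section \<open>Upper bounds\<close>

text \<open>All that the upper bounds use about weights and density is the estimate
  \<open>truncated\<close>, the integrated form of a tail of order
  \<open>t powr (- 2 / \<alpha>)\<close>. Keeping \<open>C\<close> fixed makes everything below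
  uniform in \<open>n\<close> and \<open>p\<close>.\<close>

locale truncated_moment_graph = homogeneous_graph \<Omega> n p \<mu> f Z W X
  for \<Omega> :: "'a measure" and n p \<mu> f Z W X +
  fixes \<alpha> C :: real
  assumes \<alpha>: "0 < \<alpha>" "\<alpha> < 1" and C: "0 \<le> C"
    and truncated: "\<And>h t. h \<in> nsets {1..n} 2 \<Longrightarrow> 0 < t \<Longrightarrow>
      (\<integral>\<^sup>+\<omega>. ennreal (excess t (cost \<alpha> h \<omega>)) \<partial>\<Omega>) \<le> ennreal (C * t powr (2 - 2 / \<alpha>))"
    and np: "10 * ln (real n) \<le> real n * p"
begin

definition \<tau> :: real where "\<tau> = (real n * p) powr (\<alpha> / 2)"

lemma np_ge_1: "1 \<le> real n * p"
proof -
  have "ln 2 \<le> ln (real n)" using n2 by simp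
  with ln2_ge_two_thirds np show ?thesis by linarith
qed

lemma tau_ge_1: "1 \<le> \<tau>"
  unfolding \<tau>_def using np_ge_1 \<alpha> by (intro ge_one_powr_ge_zero) auto

lemma tau_pos: "0 < \<tau>"
  using tau_ge_1 by linarith

lemma tau_square: "\<tau>\<^sup>2 = (real n * p) powr \<alpha>"
  using np_ge_1 by (simp add: \<tau>_def power2_eq_square powr_add[symmetric])

text \<open>The reason for the choice of \<open>\<tau>\<close>: the excess of one edge over
  \<open>\<tau>\<close> is of order \<open>\<tau>\<^sup>2 / (n p)\<close>, so about
  \<open>n^2 p\<close> present edges produce a total of order \<open>n \<tau>\<^sup>2\<close>, the
  same as \<open>n\<close> forest edges of cost \<open>\<tau>\<close>.\<close>

lemma tau_powr: "\<tau> powr (2 - 2 / \<alpha>) = \<tau>\<^sup>2 / (real n * p)"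
proof -
  have "\<tau> powr (2 - 2 / \<alpha>) = (real n * p) powr (\<alpha> - 1)"
  proof -
    have "\<alpha> / 2 * (2 - 2 / \<alpha>) = \<alpha> - 1" using \<alpha> by (simp add: right_diff_distrib)
    then show ?thesis by (simp only: \<tau>_def powr_powr)
  qed
  also have "\<dots> = \<tau>\<^sup>2 / (real n * p)"
    using np_ge_1 by (simp add: powr_diff tau_square)
  finally show ?thesis .
qed

text \<open>The common order of magnitude of all variance contributions.\<close>

definition scale :: real where "scale = (real n)\<^sup>2 * p * \<tau>\<^sup>2"

lemma scale_eq: "scale = real n * \<tau>\<^sup>2 * (real n * p)"
  by (simp add: scale_def power2_eq_square)

lemma scale_ge_1: "1 \<le> scale"
proof -
  have "1 * 1 \<le> real n * \<tau>\<^sup>2" using n2 tau_ge_1 by (intro mult_mono) auto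
  then have "1 * 1 \<le> real n * \<tau>\<^sup>2 * (real n * p)" using np_ge_1 by (intro mult_mono) auto
  then show ?thesis by (simp add: scale_eq)
qed

lemma nn_cost_square:
  assumes h: "h \<in> K"
  shows "(\<integral>\<^sup>+\<omega>. ennreal ((cost \<alpha> h \<omega>)\<^sup>2) \<partial>\<Omega>) \<le> ennreal (1 + C)"
proof -
  note [measurable] = cost_measurable[OF h]
  have "(\<integral>\<^sup>+\<omega>. ennreal ((cost \<alpha> h \<omega>)\<^sup>2) \<partial>\<Omega>) \<le> (\<integral>\<^sup>+\<omega>. 1 + ennreal (excess 1 (cost \<alpha> h \<omega>)) \<partial>\<Omega>)"
  proof (rule nn_integral_mono)
    fix \<omega>
    have "(cost \<alpha> h \<omega>)\<^sup>2 \<le> 1 + excess 1 (cost \<alpha> h \<omega>)"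
      by (simp add: excess_def power_le_one)
    then have "ennreal ((cost \<alpha> h \<omega>)\<^sup>2) \<le> ennreal (1 + excess 1 (cost \<alpha> h \<omega>))" by (rule ennreal_leI)
    then show "ennreal ((cost \<alpha> h \<omega>)\<^sup>2) \<le> 1 + ennreal (excess 1 (cost \<alpha> h \<omega>))" by simp
  qed
  also have "\<dots> = 1 + (\<integral>\<^sup>+\<omega>. ennreal (excess 1 (cost \<alpha> h \<omega>)) \<partial>\<Omega>)"
    by (subst nn_integral_add) (auto simp: emeasure_space_1)
  also have "\<dots> \<le> 1 + ennreal C"
    using truncated[OF h, of 1] by (intro add_left_mono) simp
  finally show ?thesis using C by simp
qed

text \<open>As \<open>P\<close> is any property of the graph, this covers both disconnectedness and
  large degrees. Independence turns each summand into a probability times a second moment, of which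
  there are at most \<open>n^2\<close>.\<close>

lemma nn_bad_event:
  "(\<integral>\<^sup>+\<omega>. indicator {\<omega>. P (graph \<omega>)} \<omega> * ennreal (\<Sum>h\<in>K. (cost \<alpha> h \<omega>)\<^sup>2) \<partial>\<Omega>)
    \<le> ennreal (prob {\<omega> \<in> space \<Omega>. P (graph \<omega>)} * ((real n)\<^sup>2 * (1 + C)))"
proof -
  let ?b = "prob {\<omega> \<in> space \<Omega>. P (graph \<omega>)}"
  have ind [measurable]: "(\<lambda>\<omega>. indicator {\<omega>. P (graph \<omega>)} \<omega> :: ennreal) \<in> borel_measurable \<Omega>"
    unfolding indicator_def by measurable
  have "(\<integral>\<^sup>+\<omega>. indicator {\<omega>. P (graph \<omega>)} \<omega> * ennreal (\<Sum>h\<in>K. (cost \<alpha> h \<omega>)\<^sup>2) \<partial>\<Omega>)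
      = (\<integral>\<^sup>+\<omega>. (\<Sum>h\<in>K. indicator {\<omega>. P (graph \<omega>)} \<omega> * ennreal ((cost \<alpha> h \<omega>)\<^sup>2)) \<partial>\<Omega>)"
    by (intro nn_integral_cong) (simp add: sum_ennreal sum_distrib_left[symmetric])
  also have "\<dots> = (\<Sum>h\<in>K. \<integral>\<^sup>+\<omega>. indicator {\<omega>. P (graph \<omega>)} \<omega> * ennreal ((cost \<alpha> h \<omega>)\<^sup>2) \<partial>\<Omega>)"
    by (rule nn_integral_sum) measurable
  also have "\<dots> = (\<Sum>h\<in>K. ennreal ?b * (\<integral>\<^sup>+\<omega>. ennreal ((cost \<alpha> h \<omega>)\<^sup>2) \<partial>\<Omega>))"
    by (intro sum.cong refl graph_cost_indep[where \<psi> = "\<lambda>c. ennreal (c\<^sup>2)"]) auto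
  also have "\<dots> \<le> (\<Sum>h\<in>K. ennreal ?b * ennreal (1 + C))"
    by (intro sum_mono mult_left_mono nn_cost_square) auto
  also have "\<dots> = ennreal (real (card K) * (?b * (1 + C)))"
    using C by (simp add: ennreal_mult ennreal_of_nat_eq_real_of_nat)
  also have "\<dots> \<le> ennreal ((real n)\<^sup>2 * (?b * (1 + C)))"
    using card_nsets_2_le[of n] C by (intro ennreal_leI mult_right_mono) auto
  finally show ?thesis by (simp add: algebra_simps)
qed

text \<open>An edge contributes only if it is present, and by independence this yields the factor
  \<open>p\<close>; the remaining factor is given by \<open>truncated\<close> at level
  \<open>\<tau>\<close> and simplified by \<open>tau_powr\<close>.\<close>

lemma nn_excess:
  "(\<integral>\<^sup>+\<omega>. ennreal (\<Sum>h\<in>K. excess \<tau> (val \<alpha> h \<omega>)) \<partial>\<Omega>) \<le> ennreal (C * (real n * \<tau>\<^sup>2))"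
proof -
  have eq: "ennreal (excess \<tau> (val \<alpha> h \<omega>)) = indicator {\<omega>. h \<in> graph \<omega>} \<omega> * ennreal (excess \<tau> (cost \<alpha> h \<omega>))"
    if "h \<in> K" for h \<omega>
    using that tau_pos by (auto simp: val_def excess_def in_graph_iff indicator_def simp del: One_nat_def)
  have present: "prob {\<omega> \<in> space \<Omega>. h \<in> graph \<omega>} = p" if "h \<in> K" for h
    using prob_present[OF that] that by (simp add: in_graph_iff)
  have "(\<integral>\<^sup>+\<omega>. ennreal (\<Sum>h\<in>K. excess \<tau> (val \<alpha> h \<omega>)) \<partial>\<Omega>)
      = (\<integral>\<^sup>+\<omega>. (\<Sum>h\<in>K. ennreal (excess \<tau> (val \<alpha> h \<omega>))) \<partial>\<Omega>)"
    by (simp add: sum_ennreal)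
  also have "\<dots> = (\<Sum>h\<in>K. \<integral>\<^sup>+\<omega>. ennreal (excess \<tau> (val \<alpha> h \<omega>)) \<partial>\<Omega>)"
    by (rule nn_integral_sum) measurable
  also have "\<dots> = (\<Sum>h\<in>K. \<integral>\<^sup>+\<omega>. indicator {\<omega>. h \<in> graph \<omega>} \<omega> * ennreal (excess \<tau> (cost \<alpha> h \<omega>)) \<partial>\<Omega>)"
    by (intro sum.cong nn_integral_cong eq) auto
  also have "\<dots> = (\<Sum>h\<in>K. ennreal p * (\<integral>\<^sup>+\<omega>. ennreal (excess \<tau> (cost \<alpha> h \<omega>)) \<partial>\<Omega>))"
  proof (rule sum.cong)
    fix h assume h: "h \<in> K"
    show "(\<integral>\<^sup>+\<omega>. indicator {\<omega>. h \<in> graph \<omega>} \<omega> * ennreal (excess \<tau> (cost \<alpha> h \<omega>)) \<partial>\<Omega>)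
        = ennreal p * (\<integral>\<^sup>+\<omega>. ennreal (excess \<tau> (cost \<alpha> h \<omega>)) \<partial>\<Omega>)"
      using graph_cost_indep[OF h, of "\<lambda>c. ennreal (excess \<tau> c)" "\<lambda>E. h \<in> E"] present[OF h] by simp
  qed simp
  also have "\<dots> \<le> (\<Sum>h\<in>K. ennreal p * ennreal (C * \<tau> powr (2 - 2 / \<alpha>)))"
    by (intro sum_mono mult_left_mono truncated tau_pos) auto
  also have "\<dots> = ennreal (real (card K) * (p * (C * \<tau> powr (2 - 2 / \<alpha>))))"
    using C p_pos by (simp add: ennreal_mult[symmetric] ennreal_of_nat_eq_real_of_nat)
  also have "\<dots> \<le> ennreal ((real n)\<^sup>2 * (p * (C * \<tau> powr (2 - 2 / \<alpha>))))"
    using card_nsets_2_le[of n] C p_pos by (intro ennreal_leI mult_right_mono) auto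
  also have "(real n)\<^sup>2 * (p * (C * \<tau> powr (2 - 2 / \<alpha>))) = C * (real n * \<tau>\<^sup>2)"
    unfolding tau_powr using n2 p_pos by (simp add: power2_eq_square)
  finally show ?thesis .
qed

text \<open>The constant is 22 + 8. Since \<open>n p \<ge> 1\<close>, the degree factor is at most
  \<open>22 n p\<close>. In the exceptional case a degree factor of order \<open>n\<close> and
  \<open>n^2\<close> second moments meet a probability of order \<open>1 / n^4\<close>, leaving at
  most \<open>8 * (1 + C)\<close>, which is absorbed by \<open>scale \<ge> 1\<close>.\<close>

lemma nn_influence:
  "(\<integral>\<^sup>+\<omega>. ennreal (influence \<alpha> \<tau> (graph \<omega>) (\<lambda>h. val \<alpha> h \<omega>) (\<lambda>h. cost \<alpha> h \<omega>)) \<partial>\<Omega>)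
    \<le> ennreal (30 * (1 + C) * scale)"
proof -
  define A where "A = 20 * (real n * p) + 2"
  define B where "B = 2 * real n + 2"
  have AB: "0 \<le> A" "0 \<le> B" using p_pos by (auto simp: A_def B_def)
  let ?bad = "{\<omega>. \<not> bounded_degrees (graph \<omega>)}"
  have ind [measurable]: "(\<lambda>\<omega>. indicator ?bad \<omega> :: ennreal) \<in> borel_measurable \<Omega>"
    unfolding indicator_def by measurable
  have "(\<integral>\<^sup>+\<omega>. ennreal (influence \<alpha> \<tau> (graph \<omega>) (\<lambda>h. val \<alpha> h \<omega>) (\<lambda>h. cost \<alpha> h \<omega>)) \<partial>\<Omega>)
      \<le> (\<integral>\<^sup>+\<omega>. ennreal (A * (real n * \<tau>\<^sup>2)) + ennreal A * ennreal (\<Sum>h\<in>K. excess \<tau> (val \<alpha> h \<omega>))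
          + ennreal B * (indicator ?bad \<omega> * ennreal (\<Sum>h\<in>K. (cost \<alpha> h \<omega>)\<^sup>2)) \<partial>\<Omega>)"
  proof (rule nn_integral_mono)
    fix \<omega>
    have s: "0 \<le> (\<Sum>h\<in>K. excess \<tau> (val \<alpha> h \<omega>))" "0 \<le> (\<Sum>h\<in>K. (cost \<alpha> h \<omega>)\<^sup>2)"
      by (auto intro: sum_nonneg)
    show "ennreal (influence \<alpha> \<tau> (graph \<omega>) (\<lambda>h. val \<alpha> h \<omega>) (\<lambda>h. cost \<alpha> h \<omega>))
      \<le> ennreal (A * (real n * \<tau>\<^sup>2)) + ennreal A * ennreal (\<Sum>h\<in>K. excess \<tau> (val \<alpha> h \<omega>))
          + ennreal B * (indicator ?bad \<omega> * ennreal (\<Sum>h\<in>K. (cost \<alpha> h \<omega>)\<^sup>2))"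
    proof (cases "bounded_degrees (graph \<omega>)")
      case True
      then show ?thesis
        using AB s by (simp add: influence_def A_def[symmetric] distrib_left ennreal_mult[symmetric]
            flip: ennreal_plus)
    next
      case False
      then have "ennreal (influence \<alpha> \<tau> (graph \<omega>) (\<lambda>h. val \<alpha> h \<omega>) (\<lambda>h. cost \<alpha> h \<omega>))
        = ennreal B * (indicator ?bad \<omega> * ennreal (\<Sum>h\<in>K. (cost \<alpha> h \<omega>)\<^sup>2))"
        using AB s by (simp add: influence_def B_def ennreal_mult)
      then show ?thesis by (simp add: add_increasing)
    qed
  qed
  also have "\<dots> = ennreal (A * (real n * \<tau>\<^sup>2)) + ennreal A * (\<integral>\<^sup>+\<omega>. ennreal (\<Sum>h\<in>K. excess \<tau> (val \<alpha> h \<omega>)) \<partial>\<Omega>)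
      + ennreal B * (\<integral>\<^sup>+\<omega>. indicator ?bad \<omega> * ennreal (\<Sum>h\<in>K. (cost \<alpha> h \<omega>)\<^sup>2) \<partial>\<Omega>)"
    by (simp add: nn_integral_add nn_integral_cmult emeasure_space_1)
  also have "\<dots> \<le> ennreal (A * (real n * \<tau>\<^sup>2)) + ennreal A * ennreal (C * (real n * \<tau>\<^sup>2))
      + ennreal B * ennreal (2 / real n ^ 4 * ((real n)\<^sup>2 * (1 + C)))"
  proof (intro add_mono mult_left_mono nn_excess order_refl)
    have "prob {\<omega> \<in> space \<Omega>. \<not> bounded_degrees (graph \<omega>)} * ((real n)\<^sup>2 * (1 + C))
        \<le> 2 / real n ^ 4 * ((real n)\<^sup>2 * (1 + C))"
      using prob_bad_le(2)[OF np] C by (intro mult_right_mono) auto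
    with nn_bad_event[of "\<lambda>E. \<not> bounded_degrees E"]
    show "(\<integral>\<^sup>+\<omega>. indicator ?bad \<omega> * ennreal (\<Sum>h\<in>K. (cost \<alpha> h \<omega>)\<^sup>2) \<partial>\<Omega>)
        \<le> ennreal (2 / real n ^ 4 * ((real n)\<^sup>2 * (1 + C)))"
      by (meson ennreal_leI order_trans)
  qed auto
  also have "\<dots> = ennreal (A * ((1 + C) * (real n * \<tau>\<^sup>2)) + B * (2 / real n ^ 4 * ((real n)\<^sup>2 * (1 + C))))"
    using AB C by (simp add: ennreal_mult[symmetric] distrib_right distrib_left flip: ennreal_plus)
  also have "\<dots> \<le> ennreal (30 * (1 + C) * scale)"
  proof (rule ennreal_leI)
    have "A * ((1 + C) * (real n * \<tau>\<^sup>2)) \<le> 22 * (real n * p) * ((1 + C) * (real n * \<tau>\<^sup>2))"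
    proof (rule mult_right_mono)
      show "A \<le> 22 * (real n * p)" using np_ge_1 unfolding A_def by linarith
    qed (use C in simp)
    moreover have "B * (2 / real n ^ 4 * ((real n)\<^sup>2 * (1 + C))) \<le> 8 * (1 + C)"
    proof -
      have "B * (2 / real n ^ 4 * ((real n)\<^sup>2 * (1 + C))) = (B / real n) * (2 / real n) * (1 + C)"
        using n2 by (simp add: field_simps eval_nat_numeral)
      also have "\<dots> \<le> 4 * 2 * (1 + C)"
        using n2 C AB by (intro mult_mono) (auto simp: B_def field_simps)
      finally show ?thesis by simp
    qed
    moreover have "8 * (1 + C) \<le> 8 * (1 + C) * scale" using scale_ge_1 C by simp
    ultimately show "A * ((1 + C) * (real n * \<tau>\<^sup>2)) + B * (2 / real n ^ 4 * ((real n)\<^sup>2 * (1 + C)))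
        \<le> 30 * (1 + C) * scale"
      by (simp add: scale_eq algebra_simps)
  qed
  finally show ?thesis .
qed

lemma integrable_cost_square: "h \<in> K \<Longrightarrow> integrable \<Omega> (\<lambda>\<omega>. (cost \<alpha> h \<omega>)\<^sup>2)"
proof (rule integrableI_nonneg)
  assume h: "h \<in> K"
  show "(\<lambda>\<omega>. (cost \<alpha> h \<omega>)\<^sup>2) \<in> borel_measurable \<Omega>" using h by measurable
  show "(\<integral>\<^sup>+\<omega>. ennreal ((cost \<alpha> h \<omega>)\<^sup>2) \<partial>\<Omega>) < \<infinity>"
    using nn_cost_square[OF h] by (auto simp: less_top[symmetric] top_unique)
qed auto

lemma F_square_le: "(F \<alpha> \<omega>)\<^sup>2 \<le> real n * (\<Sum>h\<in>K. (cost \<alpha> h \<omega>)\<^sup>2)"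
proof -
  have "(F \<alpha> \<omega>)\<^sup>2 \<le> real (card {1..n}) * (\<Sum>h\<in>K. (val \<alpha> h \<omega>)\<^sup>2)"
    unfolding F_def by (rule forest_max_square_le) auto
  also have "\<dots> \<le> real n * (\<Sum>h\<in>K. (cost \<alpha> h \<omega>)\<^sup>2)"
    by (intro mult_mono sum_mono power_mono val_le_cost) (auto intro: sum_nonneg)
  finally show ?thesis .
qed

lemma integrable_F_square: "integrable \<Omega> (\<lambda>\<omega>. (F \<alpha> \<omega>)\<^sup>2)"
proof (rule Bochner_Integration.integrable_bound)
  show "integrable \<Omega> (\<lambda>\<omega>. real n * (\<Sum>h\<in>K. (cost \<alpha> h \<omega>)\<^sup>2))"
    using integrable_cost_square by (intro integrable_mult_right Bochner_Integration.integrable_sum) auto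
  show "AE \<omega> in \<Omega>. norm ((F \<alpha> \<omega>)\<^sup>2) \<le> norm (real n * (\<Sum>h\<in>K. (cost \<alpha> h \<omega>)\<^sup>2))"
    using F_square_le by (intro AE_I2) (auto intro: order_trans[OF _ abs_ge_self])
qed measurable

lemma integrable_F: "integrable \<Omega> (F \<alpha>)"
  by (rule square_integrable_imp_integrable[OF F_measurable integrable_F_square])

lemma expectation_F_le: "expectation (F \<alpha>) \<le> (1 + C) * (real n * \<tau>)"
proof -
  have "ennreal (expectation (F \<alpha>)) = (\<integral>\<^sup>+\<omega>. ennreal (F \<alpha> \<omega>) \<partial>\<Omega>)"
    using integrable_F F_nonneg by (intro nn_integral_eq_integral[symmetric]) auto
  also have "\<dots> \<le> (\<integral>\<^sup>+\<omega>. ennreal (real n * \<tau>) + ennreal (1 / \<tau>) * ennreal (\<Sum>h\<in>K. excess \<tau> (val \<alpha> h \<omega>)) \<partial>\<Omega>)"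
  proof (rule nn_integral_mono)
    fix \<omega>
    obtain T where T: "T \<in> forests {1..n}" "F \<alpha> \<omega> = (\<Sum>h\<in>T. val \<alpha> h \<omega>)"
      unfolding F_def using forest_max_attained[of "{1..n}"] by auto
    have "F \<alpha> \<omega> \<le> real n * \<tau> + (1 / \<tau>) * (\<Sum>h\<in>K. excess \<tau> (val \<alpha> h \<omega>))"
      unfolding T(2) using forest_sum_squares_le(2)[OF _ T(1) tau_pos, of "\<lambda>h. val \<alpha> h \<omega>"] by simp
    then have "ennreal (F \<alpha> \<omega>) \<le> ennreal (real n * \<tau> + (1 / \<tau>) * (\<Sum>h\<in>K. excess \<tau> (val \<alpha> h \<omega>)))"
      by (rule ennreal_leI)
    also have "\<dots> = ennreal (real n * \<tau>) + ennreal (1 / \<tau>) * ennreal (\<Sum>h\<in>K. excess \<tau> (val \<alpha> h \<omega>))"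
      using tau_pos by (subst ennreal_plus; (subst ennreal_mult)?) (auto intro!: sum_nonneg divide_nonneg_pos)
    finally show "ennreal (F \<alpha> \<omega>) \<le> ennreal (real n * \<tau>) + ennreal (1 / \<tau>) * ennreal (\<Sum>h\<in>K. excess \<tau> (val \<alpha> h \<omega>))" .
  qed
  also have "\<dots> = ennreal (real n * \<tau>) + ennreal (1 / \<tau>) * (\<integral>\<^sup>+\<omega>. ennreal (\<Sum>h\<in>K. excess \<tau> (val \<alpha> h \<omega>)) \<partial>\<Omega>)"
    by (simp add: nn_integral_add nn_integral_cmult emeasure_space_1)
  also have "\<dots> \<le> ennreal (real n * \<tau>) + ennreal (1 / \<tau>) * ennreal (C * (real n * \<tau>\<^sup>2))"
    by (intro add_left_mono mult_left_mono nn_excess) auto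
  also have "\<dots> = ennreal ((1 + C) * (real n * \<tau>))"
    using C tau_pos by (simp add: ennreal_mult[symmetric] power2_eq_square distrib_right flip: ennreal_plus)
  finally show ?thesis using C tau_pos by (subst (asm) ennreal_le_iff) auto
qed

lemma F_trunc_measurable [measurable]: "F_trunc \<alpha> k \<in> borel_measurable \<Omega>"
  unfolding F_trunc_def by (rule forest_max_measurable) auto

lemma F_trunc_bounds: "0 \<le> F_trunc \<alpha> k \<omega>" "F_trunc \<alpha> k \<omega> \<le> F \<alpha> \<omega>"
  unfolding F_trunc_def F_def by (auto intro!: forest_max_nonneg forest_max_mono)

lemma F_trunc_tendsto: "(\<lambda>k. F_trunc \<alpha> k \<omega>) \<longlonglongrightarrow> F \<alpha> \<omega>"
proof (rule tendsto_eventually)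
  obtain k0 where k0: "(\<Sum>h\<in>K. val \<alpha> h \<omega>) \<le> real k0" using real_arch_simple by blast
  show "\<forall>\<^sub>F k in sequentially. F_trunc \<alpha> k \<omega> = F \<alpha> \<omega>"
    using eventually_ge_at_top[of k0]
  proof eventually_elim
    case (elim k)
    have "val \<alpha> h \<omega> \<le> real k" if "h \<in> K" for h
      using member_le_sum[OF that, of "\<lambda>h. val \<alpha> h \<omega>"] k0 elim by simp
    then show ?case
      unfolding F_trunc_def F_def by (intro forest_max_cong) auto
  qed
qed

text \<open>The bound for the capped maximum is uniform in the cap, and dominated convergence
  removes the cap; at each sample point it is inactive for large \<open>k\<close>.\<close>

lemma variance_F: "expectation (\<lambda>\<omega>. (F \<alpha> \<omega>)\<^sup>2) - (expectation (F \<alpha>))\<^sup>2 \<le> 30 * (1 + C) * scale"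
proof -
  have l1: "(\<lambda>k. expectation (F_trunc \<alpha> k)) \<longlonglongrightarrow> expectation (F \<alpha>)"
    by (rule integral_dominated_convergence[where w = "F \<alpha>"])
      (use integrable_F F_trunc_tendsto F_trunc_bounds in auto)
  have l2: "(\<lambda>k. expectation (\<lambda>\<omega>. (F_trunc \<alpha> k \<omega>)\<^sup>2)) \<longlonglongrightarrow> expectation (\<lambda>\<omega>. (F \<alpha> \<omega>)\<^sup>2)"
    by (rule integral_dominated_convergence[where w = "\<lambda>\<omega>. (F \<alpha> \<omega>)\<^sup>2"])
      (use integrable_F_square F_trunc_tendsto F_trunc_bounds in \<open>auto intro!: tendsto_power power_mono\<close>)
  have "(\<lambda>k. expectation (\<lambda>\<omega>. (F_trunc \<alpha> k \<omega>)\<^sup>2) - (expectation (F_trunc \<alpha> k))\<^sup>2)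
      \<longlonglongrightarrow> expectation (\<lambda>\<omega>. (F \<alpha> \<omega>)\<^sup>2) - (expectation (F \<alpha>))\<^sup>2"
    by (intro tendsto_diff tendsto_power l1 l2)
  moreover have "expectation (\<lambda>\<omega>. (F_trunc \<alpha> k \<omega>)\<^sup>2) - (expectation (F_trunc \<alpha> k))\<^sup>2 \<le> 30 * (1 + C) * scale" for k
  proof -
    have "0 \<le> 30 * (1 + C) * scale" using C scale_ge_1 by simp
    then show ?thesis
      using order_trans[OF variance_F_trunc[OF tau_pos] nn_influence, of k]
      by (subst (asm) ennreal_le_iff) auto
  qed
  ultimately show ?thesis by (intro LIMSEQ_le_const2) auto
qed

section \<open>Transfer from the maximal forest to the spanning tree\<close>

context
  fixes L :: "nat \<Rightarrow> nat set set \<Rightarrow> nat set"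
  assumes rule: "largest_component_rule L"
begin

abbreviation "\<X> \<equiv> chi L \<alpha> n Z W X"

lemmas chi_m [measurable] = chi_measurable[OF rule, of \<alpha>]

lemma AE_chi_bounds: "AE \<omega> in \<Omega>. 0 \<le> \<X> \<omega> \<and> \<X> \<omega> \<le> F \<alpha> \<omega>"
  using AE_W_pos by eventually_elim (use chi_bounds[OF rule] in auto)

lemma integrable_chi_square: "integrable \<Omega> (\<lambda>\<omega>. (\<X> \<omega>)\<^sup>2)"
proof (rule Bochner_Integration.integrable_bound[OF integrable_F_square])
  show "AE \<omega> in \<Omega>. norm ((\<X> \<omega>)\<^sup>2) \<le> norm ((F \<alpha> \<omega>)\<^sup>2)"
    using AE_chi_bounds by eventually_elim (auto intro: power_mono)
qed measurable

lemma integrable_chi: "integrable \<Omega> \<X>"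
  by (rule square_integrable_imp_integrable[OF chi_m integrable_chi_square])

lemma expectation_chi_le: "expectation \<X> \<le> (1 + C) * (real n * \<tau>)"
proof -
  have "expectation \<X> \<le> expectation (F \<alpha>)"
    by (rule integral_mono_AE[OF integrable_chi integrable_F]) (use AE_chi_bounds in auto)
  with expectation_F_le show ?thesis by linarith
qed

text \<open>The two quantities differ only on disconnected graphs, where the square of the
  difference is at most \<open>(F \<alpha> \<omega>)\<^sup>2\<close> because the tree cost lies
  between 0 and \<open>F\<close>.\<close>

lemma chi_F_distance: "expectation (\<lambda>\<omega>. (\<X> \<omega> - F \<alpha> \<omega>)\<^sup>2) \<le> 2 * (1 + C) * scale"
proof -
  let ?disc = "{\<omega>. \<not> connected_graph {1..n} (graph \<omega>)}"
  have [measurable]: "(\<lambda>\<omega>. indicator ?disc \<omega> :: ennreal) \<in> borel_measurable \<Omega>"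
    unfolding indicator_def by measurable
  have "ennreal (expectation (\<lambda>\<omega>. (\<X> \<omega> - F \<alpha> \<omega>)\<^sup>2)) \<le> (\<integral>\<^sup>+\<omega>. ennreal ((\<X> \<omega> - F \<alpha> \<omega>)\<^sup>2) \<partial>\<Omega>)"
  proof (subst nn_integral_eq_integral)
    show "integrable \<Omega> (\<lambda>\<omega>. (\<X> \<omega> - F \<alpha> \<omega>)\<^sup>2)"
    proof (rule Bochner_Integration.integrable_bound[OF integrable_F_square])
      show "AE \<omega> in \<Omega>. norm ((\<X> \<omega> - F \<alpha> \<omega>)\<^sup>2) \<le> norm ((F \<alpha> \<omega>)\<^sup>2)"
        using AE_chi_bounds by eventually_elim (auto intro!: abs_le_square_iff[THEN iffD1])
    qed measurable
  qed auto
  also have "\<dots> \<le> (\<integral>\<^sup>+\<omega>. ennreal (real n) * (indicator ?disc \<omega> * ennreal (\<Sum>h\<in>K. (cost \<alpha> h \<omega>)\<^sup>2)) \<partial>\<Omega>)"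
  proof (rule nn_integral_mono_AE)
    show "AE \<omega> in \<Omega>. ennreal ((\<X> \<omega> - F \<alpha> \<omega>)\<^sup>2)
        \<le> ennreal (real n) * (indicator ?disc \<omega> * ennreal (\<Sum>h\<in>K. (cost \<alpha> h \<omega>)\<^sup>2))"
      using AE_W_pos AE_chi_bounds
    proof eventually_elim
      case (elim \<omega>)
      show ?case
      proof (cases "connected_graph {1..n} (graph \<omega>)")
        case True
        then show ?thesis using chi_eq_F[OF rule elim(1)] by simp
      next
        case False
        have "(\<X> \<omega> - F \<alpha> \<omega>)\<^sup>2 \<le> (F \<alpha> \<omega>)\<^sup>2" using elim(2) by (auto intro!: abs_le_square_iff[THEN iffD1])
        also have "\<dots> \<le> real n * (\<Sum>h\<in>K. (cost \<alpha> h \<omega>)\<^sup>2)" by (rule F_square_le)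
        finally have "ennreal ((\<X> \<omega> - F \<alpha> \<omega>)\<^sup>2) \<le> ennreal (real n * (\<Sum>h\<in>K. (cost \<alpha> h \<omega>)\<^sup>2))" by (rule ennreal_leI)
        then show ?thesis using False by (simp add: ennreal_mult sum_nonneg)
      qed
    qed
  qed
  also have "\<dots> = ennreal (real n) * (\<integral>\<^sup>+\<omega>. indicator ?disc \<omega> * ennreal (\<Sum>h\<in>K. (cost \<alpha> h \<omega>)\<^sup>2) \<partial>\<Omega>)"
    by (rule nn_integral_cmult) measurable
  also have "\<dots> \<le> ennreal (real n) * ennreal (2 / real n ^ 4 * ((real n)\<^sup>2 * (1 + C)))"
  proof (rule mult_left_mono)
    have "prob {\<omega> \<in> space \<Omega>. \<not> connected_graph {1..n} (graph \<omega>)} * ((real n)\<^sup>2 * (1 + C))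
        \<le> 2 / real n ^ 4 * ((real n)\<^sup>2 * (1 + C))"
      using prob_bad_le(1)[OF np] C by (intro mult_right_mono) auto
    with nn_bad_event[of "\<lambda>E. \<not> connected_graph {1..n} E"]
    show "(\<integral>\<^sup>+\<omega>. indicator ?disc \<omega> * ennreal (\<Sum>h\<in>K. (cost \<alpha> h \<omega>)\<^sup>2) \<partial>\<Omega>)
        \<le> ennreal (2 / real n ^ 4 * ((real n)\<^sup>2 * (1 + C)))"
      by (meson ennreal_leI order_trans)
  qed simp
  also have "\<dots> = ennreal (real n * (2 / real n ^ 4 * ((real n)\<^sup>2 * (1 + C))))"
    using C by (subst ennreal_mult) auto
  \<comment> \<open>A factor \<open>n\<close> from Cauchy-Schwarz and \<open>n^2\<close> from the
    number of edges still leave \<open>1 / n\<close>.\<close>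
  also have "real n * (2 / real n ^ 4 * ((real n)\<^sup>2 * (1 + C))) = 2 * (1 + C) * (1 / real n)"
    using n2 by (simp add: field_simps eval_nat_numeral)
  finally have "expectation (\<lambda>\<omega>. (\<X> \<omega> - F \<alpha> \<omega>)\<^sup>2) \<le> 2 * (1 + C) * (1 / real n)"
    using C by (subst (asm) ennreal_le_iff) auto
  also have "\<dots> \<le> 2 * (1 + C) * scale"
  proof (rule mult_left_mono)
    have "1 / real n \<le> 1" using n2 by simp
    with scale_ge_1 show "1 / real n \<le> scale" by linarith
  qed (use C in simp)
  finally show ?thesis .
qed

text \<open>The variance is at most the mean squared deviation from any constant, here the mean of
  \<open>F\<close>. Splitting with
  \<open>(a + b)\<^sup>2 \<le> 2 * a\<^sup>2 + 2 * b\<^sup>2\<close> gives 2 * 2 + 2 * 30 =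
  64.\<close>

lemma variance_chi_le: "variance \<X> \<le> 64 * (1 + C) * scale"
proof -
  define m where "m = expectation (F \<alpha>)"
  have int_XF: "integrable \<Omega> (\<lambda>\<omega>. (\<X> \<omega> - F \<alpha> \<omega>)\<^sup>2)"
  proof (rule Bochner_Integration.integrable_bound[OF integrable_F_square])
    show "AE \<omega> in \<Omega>. norm ((\<X> \<omega> - F \<alpha> \<omega>)\<^sup>2) \<le> norm ((F \<alpha> \<omega>)\<^sup>2)"
      using AE_chi_bounds by eventually_elim (auto intro!: abs_le_square_iff[THEN iffD1])
  qed measurable
  have int_F: "integrable \<Omega> (\<lambda>\<omega>. (F \<alpha> \<omega> - m)\<^sup>2)"
    using integrable_F integrable_F_square by (simp add: power2_diff)
  have int_X: "integrable \<Omega> (\<lambda>\<omega>. (\<X> \<omega> - m)\<^sup>2)"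
    using integrable_chi integrable_chi_square by (simp add: power2_diff)
  have "variance \<X> = expectation (\<lambda>\<omega>. (\<X> \<omega> - m)\<^sup>2) - (expectation \<X> - m)\<^sup>2"
    using integrable_chi integrable_chi_square
    by (simp add: variance_eq power2_diff prob_space) (simp add: algebra_simps power2_eq_square)
  also have "\<dots> \<le> expectation (\<lambda>\<omega>. (\<X> \<omega> - m)\<^sup>2)" by simp
  also have "\<dots> \<le> expectation (\<lambda>\<omega>. 2 * (\<X> \<omega> - F \<alpha> \<omega>)\<^sup>2 + 2 * (F \<alpha> \<omega> - m)\<^sup>2)"
  proof (rule integral_mono[OF int_X])
    show "integrable \<Omega> (\<lambda>\<omega>. 2 * (\<X> \<omega> - F \<alpha> \<omega>)\<^sup>2 + 2 * (F \<alpha> \<omega> - m)\<^sup>2)"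
      using int_XF int_F by auto
    fix \<omega>
    have "(a + b)\<^sup>2 \<le> 2 * a\<^sup>2 + 2 * b\<^sup>2" for a b :: real
      using sum_squares_bound[of a b] by (simp add: power2_sum)
    from this[of "\<X> \<omega> - F \<alpha> \<omega>" "F \<alpha> \<omega> - m"]
    show "(\<X> \<omega> - m)\<^sup>2 \<le> 2 * (\<X> \<omega> - F \<alpha> \<omega>)\<^sup>2 + 2 * (F \<alpha> \<omega> - m)\<^sup>2" by simp
  qed
  also have "\<dots> = 2 * expectation (\<lambda>\<omega>. (\<X> \<omega> - F \<alpha> \<omega>)\<^sup>2) + 2 * variance (F \<alpha>)"
    using int_XF int_F by (simp add: m_def)
  also have "\<dots> \<le> 2 * (2 * (1 + C) * scale) + 2 * (30 * (1 + C) * scale)"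
    using chi_F_distance variance_F variance_eq[OF integrable_F integrable_F_square] by linarith
  finally show ?thesis by (simp add: algebra_simps)
qed

text \<open>For \<alpha> < 2/3 Chebyshev's inequality gives an error of order \<open>p\<close>. For
  larger \<alpha> the level carries the factor \<open>ln n\<close>, and Markov's inequality gives an
  error of order \<open>1 / ln n\<close>.\<close>

lemma chi_upper_tail:
  assumes \<gamma>: "\<gamma> = 256 * (1 + C)"
  shows "1 - \<gamma> / ln (real n) - \<gamma> * p
    \<le> prob {\<omega> \<in> space \<Omega>. \<X> \<omega> \<le> \<gamma> * real n * nu \<alpha> n * (real n * p) powr (\<alpha> / 2)}"
proof -
  have \<gamma>_pos: "0 < \<gamma>" "256 \<le> \<gamma>" using C by (auto simp: \<gamma>)
  have ln_pos: "0 < ln (real n)" using n2 by simp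
  have nt: "0 < real n * \<tau>" using n2 tau_pos by simp
  define t where "t = \<gamma> * real n * nu \<alpha> n * \<tau>"
  have "prob {\<omega> \<in> space \<Omega>. \<not> \<X> \<omega> \<le> t} \<le> \<gamma> / ln (real n) + \<gamma> * p"
  proof (cases "\<alpha> < 2 / 3")
    case True
    have t: "t = \<gamma> * (real n * \<tau>)" using True by (simp add: t_def nu_def)
    \<comment> \<open>Half of \<open>t\<close>: the mean is at most \<open>a\<close>, so exceeding
      \<open>t\<close> is a deviation by at least \<open>a\<close>.\<close>
    define a where "a = \<gamma> / 2 * (real n * \<tau>)"
    have a: "0 < a" using \<gamma>_pos nt by (simp add: a_def)
    have "(1 + C) * (real n * \<tau>) \<le> a" unfolding a_def using nt C by (intro mult_right_mono) (auto simp: \<gamma>)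
    then have E: "expectation \<X> \<le> a" using expectation_chi_le by linarith
    have "prob {\<omega> \<in> space \<Omega>. \<not> \<X> \<omega> \<le> t} \<le> prob {\<omega> \<in> space \<Omega>. a \<le> \<bar>\<X> \<omega> - expectation \<X>\<bar>}"
    proof (rule finite_measure_mono)
      have "t = 2 * a" by (simp add: t a_def)
      then have "a \<le> \<bar>\<X> \<omega> - expectation \<X>\<bar>" if "\<not> \<X> \<omega> \<le> t" for \<omega>
        using that E by linarith
      then show "{\<omega> \<in> space \<Omega>. \<not> \<X> \<omega> \<le> t} \<subseteq> {\<omega> \<in> space \<Omega>. a \<le> \<bar>\<X> \<omega> - expectation \<X>\<bar>}" by blast
    qed measurable
    also have "\<dots> \<le> variance \<X> / a\<^sup>2"
      by (rule Chebyshev_inequality[OF chi_m integrable_chi_square a])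
    also have "\<dots> \<le> (64 * (1 + C) * scale) / a\<^sup>2"
      using variance_chi_le by (intro divide_right_mono) auto
    also have "\<dots> = p / \<gamma>"
    proof -
      define Q where "Q = (real n)\<^sup>2 * \<tau>\<^sup>2"
      have Q: "0 < Q" using n2 tau_pos by (simp add: Q_def)
      have a2: "a\<^sup>2 = \<gamma> * \<gamma> / 4 * Q" by (simp add: a_def Q_def power2_eq_square)
      \<comment> \<open>The factor 256 in \<open>\<gamma>\<close> is four times the variance
        constant 64, so one power of \<open>\<gamma>\<close> cancels against
        \<open>a\<^sup>2\<close>.\<close>
      have "64 * (1 + C) * scale = \<gamma> / 4 * Q * p"
        by (simp add: \<gamma> scale_def Q_def)
      then have "(64 * (1 + C) * scale) / a\<^sup>2 = (\<gamma> / 4 * Q * p) / (\<gamma> * \<gamma> / 4 * Q)" by (simp only: a2)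
      also have "\<dots> = p / \<gamma>" using \<gamma>_pos Q by (simp add: field_simps)
      finally show ?thesis .
    qed
    also have "\<dots> \<le> \<gamma> * p"
    proof -
      have "p / \<gamma> \<le> p / 1" using \<gamma>_pos p_pos by (intro divide_left_mono) auto
      also have "\<dots> \<le> \<gamma> * p" using \<gamma>_pos p_pos by simp
      finally show ?thesis .
    qed
    finally show ?thesis using \<gamma>_pos ln_pos by (simp add: add_increasing)
  next
    case False
    have t: "t = \<gamma> * ln (real n) * (real n * \<tau>)" using False by (simp add: t_def nu_def)
    have t0: "0 < t" unfolding t by (rule mult_pos_pos[OF mult_pos_pos[OF \<gamma>_pos(1) ln_pos] nt])
    have "prob {\<omega> \<in> space \<Omega>. \<not> \<X> \<omega> \<le> t} \<le> prob {\<omega> \<in> space \<Omega>. t \<le> \<X> \<omega>}"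
      by (intro finite_measure_mono) auto
    also have "\<dots> \<le> expectation \<X> / t"
    proof (rule integral_Markov_inequality_measure[OF integrable_chi])
      show "AE \<omega> in \<Omega>. 0 \<le> \<X> \<omega>" using AE_chi_bounds by auto
    qed (use t0 in auto)
    also have "\<dots> \<le> ((1 + C) * (real n * \<tau>)) / t"
      using expectation_chi_le t0 by (intro divide_right_mono) auto
    also have "\<dots> = (1 + C) / \<gamma> / ln (real n)" 
    proof -
      have "real n * \<tau> \<noteq> 0" using nt by linarith
      from mult_divide_mult_cancel_right[OF this, of "1 + C" "\<gamma> * ln (real n)"]
      show ?thesis by (simp only: t divide_divide_eq_left)
    qed
    also have "\<dots> \<le> \<gamma> / ln (real n)"
    proof (rule divide_right_mono)
      have "(1 + C) / \<gamma> = 1 / 256" using C by (simp add: \<gamma>)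
      then show "(1 + C) / \<gamma> \<le> \<gamma>" using \<gamma>_pos by linarith
    qed (use ln_pos in simp)
    finally show ?thesis using \<gamma>_pos p_pos by (simp add: add_increasing2)
  qed
  moreover have "prob {\<omega> \<in> space \<Omega>. \<not> \<X> \<omega> \<le> t} = 1 - prob {\<omega> \<in> space \<Omega>. \<X> \<omega> \<le> t}"
    by (rule prob_neg) measurable
  ultimately show ?thesis by (simp add: t_def \<tau>_def)
qed

end

end

section \<open>Lower bound\<close>

text \<open>The minimum places the right endpoint \<open>s = 1\<close> into the last cell, so that
  \<open>k\<close> cells cover the closed unit interval.\<close>

definition coord_cell :: "nat \<Rightarrow> real \<Rightarrow> int" where
  "coord_cell k s = min (int k - 1) \<lfloor>real k * s\<rfloor>"

definition cell :: "nat \<Rightarrow> point \<Rightarrow> int \<times> int" where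
  "cell k x = (coord_cell k (fst x), coord_cell k (snd x))"

definition cells :: "nat \<Rightarrow> (int \<times> int) set" where
  "cells k = {0..<int k} \<times> {0..<int k}"

lemma finite_cells [simp]: "finite (cells k)"
  by (simp add: cells_def)

lemma card_cells: "card (cells k) = k\<^sup>2"
  by (simp add: cells_def power2_eq_square)

lemma coord_cell_bounds:
  assumes "1 \<le> k" "s \<in> {0..1}"
  shows "0 \<le> coord_cell k s" "coord_cell k s < int k"
    "real_of_int (coord_cell k s) \<le> real k * s" "real k * s \<le> real_of_int (coord_cell k s) + 1"
proof -
  have s: "0 \<le> real k * s" "real k * s \<le> real k" using assms by (auto simp: mult_left_le)
  show "0 \<le> coord_cell k s" "coord_cell k s < int k" using assms s by (auto simp: coord_cell_def)
  show "real_of_int (coord_cell k s) \<le> real k * s" unfolding coord_cell_def by linarith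
  show "real k * s \<le> real_of_int (coord_cell k s) + 1"
    using s unfolding coord_cell_def by linarith
qed

lemma cell_in_cells: "1 \<le> k \<Longrightarrow> x \<in> unit_square \<Longrightarrow> cell k x \<in> cells k"
  using coord_cell_bounds(1,2)[of k "fst x"] coord_cell_bounds(1,2)[of k "snd x"]
  by (auto simp: cell_def cells_def unit_square_def)

lemma coord_cell_dist:
  assumes "1 \<le> k" "s \<in> {0..1}" "t \<in> {0..1}" "coord_cell k s = coord_cell k t"
  shows "\<bar>s - t\<bar> \<le> 1 / real k"
proof -
  have "\<bar>real k * s - real k * t\<bar> \<le> 1"
    using coord_cell_bounds(3,4)[OF assms(1,2)] coord_cell_bounds(3,4)[OF assms(1,3)] assms(4) by linarith
  then have "real k * \<bar>s - t\<bar> \<le> 1" by (simp add: abs_mult right_diff_distrib[symmetric])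
  then show ?thesis using assms(1) by (simp add: field_simps)
qed

lemma cell_dist:
  assumes "1 \<le> k" "x \<in> unit_square" "y \<in> unit_square" "cell k x = cell k y"
  shows "dist x y \<le> 2 / real k"
proof -
  have "dist x y \<le> \<bar>fst x - fst y\<bar> + \<bar>snd x - snd y\<bar>"
    unfolding dist_prod_def dist_real_def
    using sqrt_sum_squares_le_sum_abs[of "\<bar>fst x - fst y\<bar>" "\<bar>snd x - snd y\<bar>"] by simp
  also have "\<dots> \<le> 1 / real k + 1 / real k"
    using assms by (intro add_mono coord_cell_dist) (auto simp: cell_def unit_square_def)
  finally show ?thesis by simp
qed

lemma pred_cell [measurable]: "Measurable.pred borel (\<lambda>x. cell k x = c)"
proof -
  have cc: "coord_cell k \<in> measurable borel (count_space UNIV)"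
    unfolding coord_cell_def by measurable
  have [measurable]: "(fst :: point \<Rightarrow> real) \<in> borel_measurable borel" "(snd :: point \<Rightarrow> real) \<in> borel_measurable borel"
    by (intro borel_measurable_continuous_onI continuous_intros)+
  have [measurable]: "(\<lambda>x. coord_cell k (fst x)) \<in> measurable (borel :: point measure) (count_space UNIV)"
    "(\<lambda>x. coord_cell k (snd x)) \<in> measurable (borel :: point measure) (count_space UNIV)"
    by (rule measurable_compose[OF _ cc]; measurable)+
  have "(\<lambda>x. cell k x = c) = (\<lambda>x. coord_cell k (fst x) = fst c \<and> coord_cell k (snd x) = snd c)"
    by (auto simp: cell_def fun_eq_iff)
  then show ?thesis by simp
qed

lemma location_law_cell_ge:
  assumes f: "set_borel_measurable lborel unit_square f" and lower: "\<And>x. x \<in> unit_square \<Longrightarrow> \<epsilon> \<le> f x"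
    and "0 < \<epsilon>" and c: "c \<in> cells k" and D: "prob_space (location_law f)"
  shows "\<epsilon> / (real k)\<^sup>2 \<le> measure (location_law f) {x. cell k x = c}"
proof -
  interpret D: prob_space "location_law f" by fact
  obtain i j where ij: "c = (i, j)" "0 \<le> i" "i < int k" "0 \<le> j" "j < int k"
    using c by (auto simp: cells_def)
  have k: "0 < real k" using ij by simp
  \<comment> \<open>The half-open square of side \<open>1 / k\<close> on which the floors are exact.
    It omits at most boundary points of the unit square that belong to the cell.\<close>
  define S where "S = {real_of_int i / k..<real_of_int (i + 1) / k} \<times> {real_of_int j / k..<real_of_int (j + 1) / k}"
  have coord: "coord_cell k s = l \<and> s \<in> {0..1}"
    if "s \<in> {real_of_int l / k..<real_of_int (l + 1) / k}" "0 \<le> l" "l < int k" for s l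
  proof -
    have s: "real_of_int l \<le> real k * s" "real k * s < real_of_int l + 1"
      using that(1) k by (auto simp: field_simps)
    then have "\<lfloor>real k * s\<rfloor> = l" by linarith
    moreover have "0 \<le> real k * s" "real k * s \<le> real k" using s that by linarith+
    then have "0 \<le> s" "s \<le> 1" using k by (auto simp: zero_le_mult_iff mult_le_cancel_left1)
    ultimately show ?thesis using that by (auto simp: coord_cell_def)
  qed
  have S: "cell k x = c \<and> x \<in> unit_square" if "x \<in> S" for x
    using that coord[of "fst x" i] coord[of "snd x" j] ij
    by (auto simp: S_def cell_def unit_square_def)
  have S_borel: "S \<in> sets borel" unfolding S_def by (simp add: borel_prod[symmetric])
  have emS: "emeasure lborel S = ennreal (1 / (real k)\<^sup>2)"
  proof -
    have side: "emeasure lborel {real_of_int l / k..<real_of_int (l + 1) / k} = ennreal (1 / real k)" for l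
    proof -
      have "real_of_int (l + 1) / k - real_of_int l / k = 1 / real k"
        by (simp add: diff_divide_distrib[symmetric])
      moreover have "real_of_int l / k \<le> real_of_int (l + 1) / k" using k by (simp add: divide_right_mono)
      ultimately show ?thesis using emeasure_lborel_Ico[of "real_of_int l / k" "real_of_int (l + 1) / k"] by simp
    qed
    have "emeasure lborel S = emeasure (lborel \<Otimes>\<^sub>M lborel) S" by (simp add: lborel_prod)
    also have "\<dots> = ennreal (1 / real k) * ennreal (1 / real k)"
      unfolding S_def by (subst lborel.emeasure_pair_measure_Times) (simp_all only: side sets_lborel atLeastLessThan_borel)
    also have "\<dots> = ennreal (1 / (real k)\<^sup>2)"
      by (subst ennreal_mult[symmetric]) (auto simp: power2_eq_square)
    finally show ?thesis .
  qed
  have "ennreal (\<epsilon> / (real k)\<^sup>2) = (\<integral>\<^sup>+x. ennreal \<epsilon> * indicator S x \<partial>lborel)"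
    using S_borel \<open>0 < \<epsilon>\<close> by (simp add: nn_integral_cmult emS ennreal_mult[symmetric])
  also have "\<dots> \<le> (\<integral>\<^sup>+x. ennreal (indicator unit_square x * f x) * indicator {x. cell k x = c} x \<partial>lborel)"
    by (intro nn_integral_mono) (auto split: split_indicator simp: S lower ennreal_leI)
  also have "\<dots> = emeasure (location_law f) {x. cell k x = c}"
    unfolding location_law_def using measurable_density_fun[OF f]
    by (subst emeasure_density) auto
  also have "\<dots> = ennreal (measure (location_law f) {x. cell k x = c})"
    by (rule D.emeasure_eq_measure)
  finally show ?thesis by (subst (asm) ennreal_le_iff) auto
qed

section \<open>Almost sure properties of locations and costs\<close>

context homogeneous_graph
begin

lemma AE_X_unit_square: "AE \<omega> in \<Omega>. \<forall>u\<in>{1..n}. X u \<omega> \<in> unit_square"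
proof (rule AE_finite_allI)
  fix u assume u: "u \<in> {1..n}"
  have X: "random_variable lborel (X u)" "(\<lambda>x. ennreal (indicator unit_square x * f x)) \<in> borel_measurable lborel"
    using X_density[OF u] by (auto simp: distributed_def)
  have "AE x in density lborel (\<lambda>x. ennreal (indicator unit_square x * f x)). x \<in> unit_square"
    using X(2) by (subst AE_density) (auto split: split_indicator)
  moreover have "distr \<Omega> lborel (X u) = density lborel (\<lambda>x. ennreal (indicator unit_square x * f x))"
    using X_density[OF u] by (simp add: distributed_def)
  ultimately have "AE x in distr \<Omega> lborel (X u). x \<in> unit_square" by (simp only:)
  moreover have "{x \<in> space lborel. x \<in> unit_square} \<in> sets lborel"
    by (simp add: unit_square_def borel_prod[symmetric])
  ultimately show "AE \<omega> in \<Omega>. X u \<omega> \<in> unit_square"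
    using X(1) by (subst (asm) AE_distr_iff) auto
qed simp

lemma AE_weight_law_pos: "AE w in \<mu>. 0 < w"
proof -
  have "AE \<omega> in \<Omega>. 0 < W {1, 2} \<omega>" by (rule W_pos[OF edge_exists])
  then have "AE w in distr \<Omega> borel (W {1, 2}). 0 < w"
    using W_measurable[OF edge_exists] by (subst AE_distr_iff) auto
  then show ?thesis unfolding W_law[OF edge_exists] .
qed

text \<open>With positive weight the cost vanishes only at coinciding locations, where
  \<open>0 powr _\<close> is 0, and a law with a density has no atoms. For \<alpha> = 0 coincidences
  matter as well, by the same convention.\<close>

lemma AE_cost_pos: "AE \<omega> in \<Omega>. \<forall>h\<in>K. 0 < cost \<alpha> h \<omega>"
proof (rule AE_finite_allI)
  fix h assume h: "h \<in> K"
  note [measurable] = cost_measurable[OF h]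
  interpret D: prob_space "location_law f" by (rule prob_location_law)
  have single: "AE y in location_law f. y \<noteq> x" for x :: point
  proof -
    have "(\<lambda>x. ennreal (indicator unit_square x * f x)) \<in> borel_measurable lborel"
      using X_density[of 1] n2 by (simp add: distributed_def)
    then show ?thesis
      unfolding location_law_def using AE_lborel_singleton[of x] by (subst AE_density) auto
  qed
  have "(\<integral>\<^sup>+\<omega>. indicator {0} (cost \<alpha> h \<omega>) \<partial>\<Omega>)
    = (\<integral>\<^sup>+w. \<integral>\<^sup>+x. \<integral>\<^sup>+y. indicator {0} (\<bar>w\<bar> * dist x y powr (- \<alpha>)) \<partial>location_law f \<partial>location_law f \<partial>\<mu>)"
    by (rule nn_integral_cost[OF h]) simp
  also have "\<dots> = (\<integral>\<^sup>+w. 0 \<partial>\<mu>)"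
  proof (rule nn_integral_cong_AE, rule AE_mp[OF AE_weight_law_pos], intro AE_I2 impI)
    fix w :: real assume w: "0 < w"
    have "(\<integral>\<^sup>+y. indicator {0} (\<bar>w\<bar> * dist x y powr (- \<alpha>)) \<partial>location_law f) = (\<integral>\<^sup>+y. 0 \<partial>location_law f)" for x :: point
      by (rule nn_integral_cong_AE, rule AE_mp[OF single[of x]]) (use w in \<open>auto simp: indicator_def\<close>)
    then show "(\<integral>\<^sup>+x. \<integral>\<^sup>+y. indicator {0} (\<bar>w\<bar> * dist x y powr (- \<alpha>)) \<partial>location_law f \<partial>location_law f) = 0"
      by simp
  qed
  finally have "(\<integral>\<^sup>+\<omega>. indicator {0} (cost \<alpha> h \<omega>) \<partial>\<Omega>) = (0 :: ennreal)" by simp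
  then have "AE \<omega> in \<Omega>. indicator {0} (cost \<alpha> h \<omega>) = (0 :: ennreal)"
    by (subst (asm) nn_integral_0_iff_AE) auto
  then show "AE \<omega> in \<Omega>. 0 < cost \<alpha> h \<omega>"
    by eventually_elim (auto simp: indicator_def less_le split: if_splits)
qed simp

section \<open>Present edges of weight bounded below\<close>

definition strong :: "real \<Rightarrow> nat set \<Rightarrow> 'a \<Rightarrow> bool" where
  "strong w h \<omega> \<longleftrightarrow> Z h \<omega> \<and> w \<le> W h \<omega>"

lemma pred_strong [measurable]: "h \<in> K \<Longrightarrow> Measurable.pred \<Omega> (strong w h)"
  unfolding strong_def by measurable

lemma prob_strong:
  assumes h: "h \<in> K"
  shows "prob {\<omega> \<in> space \<Omega>. strong w h \<omega>} = p * measure \<mu> {w..}"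
proof -
  have fm: "(fst :: point \<Rightarrow> real) \<in> borel_measurable borel"
    by (intro borel_measurable_continuous_onI continuous_intros)
  define g where "g i x = (case i of Presence _ \<Rightarrow> indicator {1} (fst x) | Weight _ \<Rightarrow> indicator {w..} (fst x)
      | Location _ \<Rightarrow> (1 :: ennreal))"
    for i :: source and x :: point
  have gm: "g i \<in> borel_measurable borel" for i
  proof -
    have "(\<lambda>x :: point. indicator {1} (fst x) :: ennreal) \<in> borel_measurable borel"
      by (rule measurable_compose[OF fm]) measurable
    moreover have "(\<lambda>x :: point. indicator {w..} (fst x) :: ennreal) \<in> borel_measurable borel"
      by (rule measurable_compose[OF fm]) measurable
    ultimately show ?thesis unfolding g_def by (cases i) simp_all
  qed
  note [measurable] = W_measurable[OF h] Z_measurable[OF h]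
  have "ennreal (prob {\<omega> \<in> space \<Omega>. strong w h \<omega>}) = (\<integral>\<^sup>+\<omega>. indicator {\<omega> \<in> space \<Omega>. strong w h \<omega>} \<omega> \<partial>\<Omega>)"
    using pred_strong[OF h] by (subst nn_integral_indicator) (auto simp: emeasure_eq_measure)
  also have "\<dots> = (\<integral>\<^sup>+\<omega>. (\<Prod>i\<in>{Presence h, Weight h}. g i (Y i \<omega>)) \<partial>\<Omega>)"
    by (intro nn_integral_cong) (auto simp: g_def Y_def strong_def indicator_def)
  also have "\<dots> = (\<Prod>i\<in>{Presence h, Weight h}. \<integral>\<^sup>+\<omega>. g i (Y i \<omega>) \<partial>\<Omega>)"
    by (rule prod_sources) (use h gm in \<open>auto simp: sources_def\<close>)
  also have "\<dots> = (\<integral>\<^sup>+\<omega>. indicator {\<omega> \<in> space \<Omega>. Z h \<omega>} \<omega> \<partial>\<Omega>) * (\<integral>\<^sup>+\<omega>. indicator {w..} (W h \<omega>) \<partial>\<Omega>)"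
  proof -
    have "(\<integral>\<^sup>+\<omega>. g (Presence h) (Y (Presence h) \<omega>) \<partial>\<Omega>) = (\<integral>\<^sup>+\<omega>. indicator {\<omega> \<in> space \<Omega>. Z h \<omega>} \<omega> \<partial>\<Omega>)"
      by (intro nn_integral_cong) (auto simp: g_def Y_def indicator_def)
    moreover have "(\<integral>\<^sup>+\<omega>. g (Weight h) (Y (Weight h) \<omega>) \<partial>\<Omega>) = (\<integral>\<^sup>+\<omega>. indicator {w..} (W h \<omega>) \<partial>\<Omega>)"
      by (intro nn_integral_cong) (auto simp: g_def Y_def)
    ultimately show ?thesis by simp
  qed
  also have "(\<integral>\<^sup>+\<omega>. indicator {\<omega> \<in> space \<Omega>. Z h \<omega>} \<omega> \<partial>\<Omega>) = ennreal p"
    using prob_present[OF h] by (subst nn_integral_indicator) (auto simp: emeasure_eq_measure)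
  also have "(\<integral>\<^sup>+\<omega>. indicator {w..} (W h \<omega>) \<partial>\<Omega>) = ennreal (measure \<mu> {w..})"
  proof -
    interpret M: prob_space "distr \<Omega> borel (W h)" by (rule prob_space_distr) simp
    have "(\<integral>\<^sup>+\<omega>. indicator {w..} (W h \<omega>) \<partial>\<Omega>) = (\<integral>\<^sup>+r. indicator {w..} r \<partial>distr \<Omega> borel (W h))"
      by (subst nn_integral_distr) auto
    also have "\<dots> = ennreal (measure (distr \<Omega> borel (W h)) {w..})" by (simp add: M.emeasure_eq_measure)
    finally show ?thesis by (simp add: W_law[OF h])
  qed
  finally show ?thesis using p_pos by (simp add: ennreal_mult[symmetric])
qed

text \<open>The presence and the weight of an edge form a block of two sources; blocks of distinct
  edges are disjoint, hence independent.\<close>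

lemma prob_no_strong:
  assumes D: "D \<subseteq> K"
  shows "(\<integral>\<^sup>+\<omega>. indicator {\<omega>. \<forall>h\<in>D. \<not> strong w h \<omega>} \<omega> \<partial>\<Omega>) = ennreal ((1 - p * measure \<mu> {w..}) ^ card D)"
proof -
  define J where "J h = {Presence h, Weight h}" for h
  define \<psi> where "\<psi> h x = (if fst (x (Presence h)) = 1 \<and> w \<le> fst (x (Weight h)) then 0 else 1 :: ennreal)"
    for h and x :: "source \<Rightarrow> point"
  have fin: "finite D" using finite_subset[OF D] by simp
  have \<psi>m: "\<psi> h \<in> borel_measurable (PiM (J h) (\<lambda>_. borel))" for h
  proof -
    have [measurable]: "Measurable.pred (PiM (J h) (\<lambda>_. borel)) (\<lambda>x. fst ((x :: source \<Rightarrow> point) (Presence h)) = 1)"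
      using measurable_compose[OF fst_component_measurable[of "Presence h" "J h"], of "\<lambda>r. r = 1" "count_space UNIV"]
      by (simp add: J_def)
    have [measurable]: "Measurable.pred (PiM (J h) (\<lambda>_. borel)) (\<lambda>x. w \<le> fst ((x :: source \<Rightarrow> point) (Weight h)))"
      using measurable_compose[OF fst_component_measurable[of "Weight h" "J h"], of "\<lambda>r. w \<le> r" "count_space UNIV"]
      by (simp add: J_def)
    show ?thesis unfolding \<psi>_def by measurable
  qed
  have \<psi>Y: "\<psi> h (restrict (\<lambda>i. Y i \<omega>) (J h)) = (if strong w h \<omega> then 0 else 1)" for h \<omega>
    by (simp add: \<psi>_def J_def Y_def strong_def)
  have "indep_vars (\<lambda>_. borel) (\<lambda>h \<omega>. \<psi> h (restrict (\<lambda>i. Y i \<omega>) (J h))) D"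
    by (rule indep_vars_compose2[OF indep_vars_restrict[OF indep_Y] \<psi>m])
      (use D in \<open>auto simp: J_def sources_def disjoint_family_on_def\<close>)
  then have ind: "indep_vars (\<lambda>_. borel) (\<lambda>h \<omega>. if strong w h \<omega> then 0 else 1 :: ennreal) D" by (simp only: \<psi>Y)
  have "(\<integral>\<^sup>+\<omega>. indicator {\<omega>. \<forall>h\<in>D. \<not> strong w h \<omega>} \<omega> \<partial>\<Omega>)
      = (\<integral>\<^sup>+\<omega>. (\<Prod>h\<in>D. if strong w h \<omega> then 0 else 1) \<partial>\<Omega>)"
  proof (rule nn_integral_cong)
    fix \<omega>
    show "indicator {\<omega>. \<forall>h\<in>D. \<not> strong w h \<omega>} \<omega> = (\<Prod>h\<in>D. if strong w h \<omega> then 0 else 1 :: ennreal)"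
      using fin by (cases "\<exists>h\<in>D. strong w h \<omega>") (auto simp: indicator_def)
  qed
  also have "\<dots> = (\<Prod>h\<in>D. \<integral>\<^sup>+\<omega>. (if strong w h \<omega> then 0 else 1) \<partial>\<Omega>)"
    by (rule indep_vars_nn_integral[OF fin ind]) simp
  also have "\<dots> = (\<Prod>h\<in>D. ennreal (1 - p * measure \<mu> {w..}))"
  proof (rule prod.cong)
    fix h assume "h \<in> D"
    then have h: "h \<in> K" using D by auto
    note [measurable] = pred_strong[OF h, of w]
    have "(\<integral>\<^sup>+\<omega>. (if strong w h \<omega> then 0 else 1) \<partial>\<Omega>) = (\<integral>\<^sup>+\<omega>. indicator {\<omega> \<in> space \<Omega>. \<not> strong w h \<omega>} \<omega> \<partial>\<Omega>)"
      by (intro nn_integral_cong) (auto simp: indicator_def)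
    also have "\<dots> = ennreal (prob {\<omega> \<in> space \<Omega>. \<not> strong w h \<omega>})"
      by (subst nn_integral_indicator) (auto simp: emeasure_eq_measure)
    also have "prob {\<omega> \<in> space \<Omega>. \<not> strong w h \<omega>} = 1 - p * measure \<mu> {w..}"
      using prob_neg[of "strong w h"] prob_strong[OF h, of w] by simp
    finally show "(\<integral>\<^sup>+\<omega>. (if strong w h \<omega> then 0 else 1) \<partial>\<Omega>) = ennreal (1 - p * measure \<mu> {w..})" .
  qed simp
  also have "\<dots> = ennreal ((1 - p * measure \<mu> {w..}) ^ card D)"
  proof (cases "D = {}")
    case False
    then obtain h where "h \<in> K" using D by auto
    then have "p * measure \<mu> {w..} \<le> 1" using prob_strong[of h w] prob_le_1 by metis
    then show ?thesis by (simp add: ennreal_power)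
  qed simp
  finally show ?thesis .
qed

end

section \<open>Strong neighbours within a cell\<close>

definition cell_pairs :: "('v \<Rightarrow> 'c) \<Rightarrow> 'v set \<Rightarrow> 'v set \<Rightarrow> 'v set set" where
  "cell_pairs \<kappa> S B = (\<lambda>(u, v). {u, v}) ` (SIGMA u:S. {v \<in> B. \<kappa> v = \<kappa> u})"

text \<open>Because \<open>S\<close> and \<open>B\<close> are disjoint, an unordered pair determines
  its end in \<open>S\<close>, and no pair is counted twice.\<close>

lemma card_cell_pairs_ge:
  assumes "finite S" "finite B" "S \<inter> B = {}"
    and "\<And>u. u \<in> S \<Longrightarrow> t \<le> real (card {v \<in> B. \<kappa> v = \<kappa> u})"
  shows "real (card S) * t \<le> real (card (cell_pairs \<kappa> S B))"
proof -
  have "inj_on (\<lambda>(u, v). {u, v}) (SIGMA u:S. {v \<in> B. \<kappa> v = \<kappa> u})"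
    using assms(3) by (auto simp: inj_on_def doubleton_eq_iff)
  then have "card (cell_pairs \<kappa> S B) = (\<Sum>u\<in>S. card {v \<in> B. \<kappa> v = \<kappa> u})"
    unfolding cell_pairs_def using assms by (simp add: card_image card_SigmaI)
  then have "real (card (cell_pairs \<kappa> S B)) = (\<Sum>u\<in>S. real (card {v \<in> B. \<kappa> v = \<kappa> u}))" by simp
  also have "\<dots> \<ge> (\<Sum>u\<in>S. t)" by (rule sum_mono) (use assms in auto)
  finally show ?thesis by simp
qed

context homogeneous_graph
begin

lemma prob_cell: "u \<in> {1..n} \<Longrightarrow> prob {\<omega> \<in> space \<Omega>. cell k (X u \<omega>) = c} = measure (location_law f) {x. cell k x = c}"
proof -
  assume u: "u \<in> {1..n}"
  have "{x. cell k x = c} \<in> sets borel"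
    using pred_cell[of k c] by (simp add: pred_def)
  then have "measure (distr \<Omega> borel (X u)) {x. cell k x = c} = prob (X u -` {x. cell k x = c} \<inter> space \<Omega>)"
    using X_measurable[OF u] by (rule measure_distr[rotated])
  also have "X u -` {x. cell k x = c} \<inter> space \<Omega> = {\<omega> \<in> space \<Omega>. cell k (X u \<omega>) = c}" by auto
  finally show ?thesis by (simp only: location_law[OF u])
qed

lemma pred_cell_X [measurable]: "u \<in> {1..n} \<Longrightarrow> Measurable.pred \<Omega> (\<lambda>\<omega>. cell k (X u \<omega>) = c)"
  using measurable_compose[OF X_measurable pred_cell] by simp

text \<open>Chernoff's bound with parameter -1: each vertex contributes a factor at most
  \<open>1 - \<pi> / 2 \<le> exp (- q / 2)\<close>, in total \<open>exp (- 2 * t)\<close> for the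
  threshold \<open>t = card B * q / 4\<close>, and the factor \<open>exp t\<close> leaves
  \<open>exp (- t)\<close>.\<close>

lemma prob_few_in_cell:
  assumes B: "B \<subseteq> {1..n}" and q: "0 \<le> q" "q \<le> measure (location_law f) {x. cell k x = c}"
  shows "prob {\<omega> \<in> space \<Omega>. real (card {v \<in> B. cell k (X v \<omega>) = c}) < real (card B) * q / 4}
    \<le> exp (- (real (card B) * q / 4))"
proof -
  define \<pi> where "\<pi> = measure (location_law f) {x. cell k x = c}"
  interpret D: prob_space "location_law f" by (rule prob_location_law)
  have \<pi>: "0 \<le> \<pi>" "\<pi> \<le> 1" "q \<le> \<pi>" using q by (auto simp: \<pi>_def)
  define t where "t = real (card B) * q / 4"
  have fin: "finite B" using B finite_subset by blast
  define N where "N \<omega> = card {v \<in> B. cell k (X v \<omega>) = c}" for \<omega>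
  define g where "g x = ennreal (if cell k x = c then exp (- 1) else 1)" for x :: point
  have gm [measurable]: "g \<in> borel_measurable borel" unfolding g_def by measurable
  have inj: "inj_on Location B" by (auto simp: inj_on_def)
  have prod: "(\<Prod>v\<in>B. g (X v \<omega>)) = ennreal (exp (- real (N \<omega>)))" for \<omega>
  proof -
    have "(\<Prod>v\<in>B. if cell k (X v \<omega>) = c then exp (- 1) else 1 :: real) = (\<Prod>v\<in>{v \<in> B. cell k (X v \<omega>) = c}. exp (- 1))"
      using fin by (rule prod.inter_filter[symmetric])
    also have "\<dots> = exp (- real (N \<omega>))" by (simp add: N_def exp_of_nat_mult[symmetric])
    finally show ?thesis unfolding g_def by (subst prod_ennreal) auto
  qed
  have N_m: "(\<lambda>\<omega>. real (N \<omega>)) \<in> borel_measurable \<Omega>"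
  proof -
    have "N \<omega> = (\<Sum>v\<in>B. if cell k (X v \<omega>) = c then 1 else 0)" for \<omega>
      using fin by (simp add: N_def flip: sum.inter_filter)
    moreover have "(\<lambda>\<omega>. real (\<Sum>v\<in>B. if cell k (X v \<omega>) = c then 1 else 0)) \<in> borel_measurable \<Omega>"
      unfolding of_nat_sum by (rule borel_measurable_sum) (use B pred_cell_X in \<open>auto intro!: measurable_If\<close>)
    ultimately show ?thesis by presburger
  qed
  note [measurable] = N_m
  have fac: "(\<integral>\<^sup>+\<omega>. g (X v \<omega>) \<partial>\<Omega>) \<le> ennreal (exp (- (q / 2)))" if v: "v \<in> B" for v
  proof -
    have v': "v \<in> {1..n}" using v B by auto
    note [measurable] = pred_cell_X[OF v']
    have "(\<integral>\<^sup>+\<omega>. g (X v \<omega>) \<partial>\<Omega>)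
       = (\<integral>\<^sup>+\<omega>. ennreal (exp (- 1)) * indicator {\<omega> \<in> space \<Omega>. cell k (X v \<omega>) = c} \<omega>
          + indicator {\<omega> \<in> space \<Omega>. \<not> cell k (X v \<omega>) = c} \<omega> \<partial>\<Omega>)"
      by (intro nn_integral_cong) (auto simp: g_def indicator_def)
    also have "\<dots> = ennreal (exp (- 1)) * ennreal \<pi> + ennreal (1 - \<pi>)"
      using prob_cell[OF v', of k c] prob_neg[of "\<lambda>\<omega>. cell k (X v \<omega>) = c"]
      by (subst nn_integral_add) (auto simp: nn_integral_cmult emeasure_eq_measure \<pi>_def)
    also have "\<dots> = ennreal (exp (- 1) * \<pi> + (1 - \<pi>))"
      using \<pi> by (simp add: ennreal_mult)
    also have "\<dots> \<le> ennreal (exp (- (q / 2)))"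
    proof (rule ennreal_leI)
      have "2 \<le> exp (1 :: real)" using exp_ge_add_one_self[of "1 :: real"] by simp
      then have "exp (- 1) \<le> (1 / 2 :: real)" by (simp add: exp_minus field_simps)
      then have "exp (- 1) * \<pi> + (1 - \<pi>) \<le> (1 / 2) * \<pi> + (1 - \<pi>)"
        using \<pi> by (intro add_right_mono mult_right_mono) auto
      also have "\<dots> \<le> 1 + - (q / 2)" using \<pi> by simp
      also have "\<dots> \<le> exp (- (q / 2))" by (rule exp_ge_add_one_self)
      finally show "exp (- 1) * \<pi> + (1 - \<pi>) \<le> exp (- (q / 2))" .
    qed
    finally show ?thesis .
  qed
  have "ennreal (prob {\<omega> \<in> space \<Omega>. real (N \<omega>) < t}) = (\<integral>\<^sup>+\<omega>. indicator {\<omega> \<in> space \<Omega>. real (N \<omega>) < t} \<omega> \<partial>\<Omega>)"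
    by (subst nn_integral_indicator) (auto simp: emeasure_eq_measure)
  also have "\<dots> \<le> (\<integral>\<^sup>+\<omega>. ennreal (exp t) * (\<Prod>v\<in>B. g (X v \<omega>)) \<partial>\<Omega>)"
  proof (rule nn_integral_mono)
    fix \<omega>
    have "1 \<le> exp (t - real (N \<omega>))" if "real (N \<omega>) < t" using that by simp
    then show "indicator {\<omega> \<in> space \<Omega>. real (N \<omega>) < t} \<omega> \<le> ennreal (exp t) * (\<Prod>v\<in>B. g (X v \<omega>))"
      unfolding prod by (auto simp: ennreal_mult[symmetric] exp_add[symmetric] split: split_indicator)
  qed
  also have "\<dots> = ennreal (exp t) * (\<integral>\<^sup>+\<omega>. (\<Prod>v\<in>B. g (X v \<omega>)) \<partial>\<Omega>)"
    unfolding prod by (rule nn_integral_cmult) measurable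
  also have "(\<integral>\<^sup>+\<omega>. (\<Prod>v\<in>B. g (X v \<omega>)) \<partial>\<Omega>) = (\<Prod>v\<in>B. \<integral>\<^sup>+\<omega>. g (X v \<omega>) \<partial>\<Omega>)"
  proof -
    have "(\<integral>\<^sup>+\<omega>. (\<Prod>i\<in>Location ` B. g (Y i \<omega>)) \<partial>\<Omega>) = (\<Prod>i\<in>Location ` B. \<integral>\<^sup>+\<omega>. g (Y i \<omega>) \<partial>\<Omega>)"
      by (rule prod_sources) (use B in \<open>auto simp: sources_def\<close>)
    then show ?thesis by (simp add: prod.reindex[OF inj] Y_def)
  qed
  also have "\<dots> \<le> (\<Prod>v\<in>B. ennreal (exp (- (q / 2))))"
    using fin fac by (induction B rule: finite_induct) (auto intro: mult_mono)
  also have "\<dots> = ennreal (exp (- (2 * t)))"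
    by (simp add: ennreal_power exp_of_nat_mult[symmetric] t_def)
  also have "ennreal (exp t) * \<dots> = ennreal (exp (- t))"
    by (simp add: ennreal_mult[symmetric] exp_add[symmetric])
  finally have "ennreal (prob {\<omega> \<in> space \<Omega>. real (N \<omega>) < t}) \<le> ennreal (exp (- t))"
    by (simp add: mult_left_mono)
  then show ?thesis by (subst (asm) ennreal_le_iff) (auto simp: N_def t_def)
qed

text \<open>Cells take finitely many values, so conditioning on the locations is replaced by a
  finite sum over assignments \<kappa>.\<close>

definition cell_assignment :: "nat \<Rightarrow> 'a \<Rightarrow> (nat \<Rightarrow> int \<times> int) \<Rightarrow> bool" where
  "cell_assignment k \<omega> \<kappa> \<longleftrightarrow> (\<forall>u\<in>{1..n}. cell k (X u \<omega>) = \<kappa> u)"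

lemma pred_cell_assignment [measurable]: "Measurable.pred \<Omega> (\<lambda>\<omega>. cell_assignment k \<omega> \<kappa>)"
  unfolding cell_assignment_def by (intro pred_intros_finite pred_cell_X) auto

text \<open>Locations are independent of presences and weights. The edge set \<open>D\<close> may be
  chosen according to \<kappa>, but it is not random, and this makes the factorisation
  possible.\<close>

lemma prob_cells_no_strong:
  assumes D: "D \<subseteq> K"
  shows "prob {\<omega> \<in> space \<Omega>. cell_assignment k \<omega> \<kappa> \<and> (\<forall>h\<in>D. \<not> strong w h \<omega>)}
    = prob {\<omega> \<in> space \<Omega>. cell_assignment k \<omega> \<kappa>} * (1 - p * measure \<mu> {w..}) ^ card D"
proof -
  define A where "A = Location ` {1..n}"
  define B where "B = Presence ` K \<union> Weight ` K"
  have sub: "A \<inter> B = {}" "A \<subseteq> sources n" "B \<subseteq> sources n"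
    by (auto simp: A_def B_def sources_def)
  have finD: "finite D" using finite_subset[OF D] by simp
  define \<phi> where "\<phi> x = (if \<forall>u\<in>{1..n}. cell k (x (Location u)) = \<kappa> u then 1 else 0 :: ennreal)"
    for x :: "source \<Rightarrow> point"
  define \<psi> where "\<psi> x = (if \<forall>h\<in>D. \<not> (fst (x (Presence h)) = 1 \<and> w \<le> fst (x (Weight h))) then 1 else 0 :: ennreal)"
    for x :: "source \<Rightarrow> point"
  have \<phi>m: "\<phi> \<in> borel_measurable (PiM A (\<lambda>_. borel))"
  proof -
    have [measurable]: "Measurable.pred (PiM A (\<lambda>_. borel)) (\<lambda>x. \<forall>u\<in>{1..n}. cell k (x (Location u)) = \<kappa> u)"
    proof (intro pred_intros_finite)
      fix u assume "u \<in> {1..n}"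
      then have "(\<lambda>x. x (Location u)) \<in> measurable (PiM A (\<lambda>_. borel :: point measure)) borel"
        by (intro measurable_component_singleton) (auto simp: A_def)
      from measurable_compose[OF this pred_cell]
      show "Measurable.pred (PiM A (\<lambda>_. borel)) (\<lambda>x. cell k (x (Location u)) = \<kappa> u)" .
    qed simp
    show ?thesis unfolding \<phi>_def by measurable
  qed
  have \<psi>m: "\<psi> \<in> borel_measurable (PiM B (\<lambda>_. borel))"
  proof -
    have 1: "Measurable.pred (PiM B (\<lambda>_. borel)) (\<lambda>x. fst ((x :: source \<Rightarrow> point) (Presence h)) = 1)" if "h \<in> D" for h
      using measurable_compose[OF fst_component_measurable[of "Presence h" B], of "\<lambda>r. r = 1" "count_space UNIV"] that D
      by (auto simp: B_def)
    have 2: "Measurable.pred (PiM B (\<lambda>_. borel)) (\<lambda>x. w \<le> fst ((x :: source \<Rightarrow> point) (Weight h)))" if "h \<in> D" for h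
      using measurable_compose[OF fst_component_measurable[of "Weight h" B], of "\<lambda>r. w \<le> r" "count_space UNIV"] that D
      by (auto simp: B_def)
    have [measurable]: "Measurable.pred (PiM B (\<lambda>_. borel))
        (\<lambda>x. \<forall>h\<in>D. \<not> (fst ((x :: source \<Rightarrow> point) (Presence h)) = 1 \<and> w \<le> fst (x (Weight h))))"
      by (intro pred_intros_finite pred_intros_logic 1 2 finD)
    show ?thesis unfolding \<psi>_def by measurable
  qed
  have \<phi>Y: "\<phi> (restrict (\<lambda>i. Y i \<omega>) A) = indicator {\<omega>. cell_assignment k \<omega> \<kappa>} \<omega>" for \<omega>
    by (auto simp: \<phi>_def A_def Y_def cell_assignment_def indicator_def)
  have \<psi>Y: "\<psi> (restrict (\<lambda>i. Y i \<omega>) B) = indicator {\<omega>. \<forall>h\<in>D. \<not> strong w h \<omega>} \<omega>" for \<omega>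
  proof -
    have "(fst (restrict (\<lambda>i. Y i \<omega>) B (Presence h)) = 1 \<and> w \<le> fst (restrict (\<lambda>i. Y i \<omega>) B (Weight h)))
        \<longleftrightarrow> strong w h \<omega>" if "h \<in> D" for h
      using that D by (auto simp: B_def Y_def strong_def)
    then show ?thesis by (simp add: \<psi>_def indicator_def)
  qed
  have strong_m: "Measurable.pred \<Omega> (strong w h)" if "h \<in> D" for h using that D pred_strong by blast
  have ev: "{\<omega> \<in> space \<Omega>. cell_assignment k \<omega> \<kappa> \<and> (\<forall>h\<in>D. \<not> strong w h \<omega>)} \<in> events"
    unfolding pred_def[symmetric]
    by (intro pred_intros_logic pred_intros_finite finD pred_cell_assignment strong_m)
  have "ennreal (prob {\<omega> \<in> space \<Omega>. cell_assignment k \<omega> \<kappa> \<and> (\<forall>h\<in>D. \<not> strong w h \<omega>)})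
      = (\<integral>\<^sup>+\<omega>. indicator {\<omega> \<in> space \<Omega>. cell_assignment k \<omega> \<kappa> \<and> (\<forall>h\<in>D. \<not> strong w h \<omega>)} \<omega> \<partial>\<Omega>)"
    using ev by (simp add: emeasure_eq_measure)
  also have "\<dots> = (\<integral>\<^sup>+\<omega>. indicator {\<omega>. cell_assignment k \<omega> \<kappa>} \<omega> * indicator {\<omega>. \<forall>h\<in>D. \<not> strong w h \<omega>} \<omega> \<partial>\<Omega>)"
    by (intro nn_integral_cong) (auto simp: indicator_def)
  also have "\<dots> = (\<integral>\<^sup>+\<omega>. indicator {\<omega>. cell_assignment k \<omega> \<kappa>} \<omega> \<partial>\<Omega>)
      * (\<integral>\<^sup>+\<omega>. indicator {\<omega>. \<forall>h\<in>D. \<not> strong w h \<omega>} \<omega> \<partial>\<Omega>)"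
    using indep_sources[OF sub \<phi>m \<psi>m] by (simp only: \<phi>Y \<psi>Y)
  also have "(\<integral>\<^sup>+\<omega>. indicator {\<omega>. cell_assignment k \<omega> \<kappa>} \<omega> \<partial>\<Omega>) = (\<integral>\<^sup>+\<omega>. indicator {\<omega> \<in> space \<Omega>. cell_assignment k \<omega> \<kappa>} \<omega> \<partial>\<Omega>)"
    by (intro nn_integral_cong) (auto simp: indicator_def)
  also have "\<dots> = ennreal (prob {\<omega> \<in> space \<Omega>. cell_assignment k \<omega> \<kappa>})"
    by (subst nn_integral_indicator) (auto simp: emeasure_eq_measure)
  also have "(\<integral>\<^sup>+\<omega>. indicator {\<omega>. \<forall>h\<in>D. \<not> strong w h \<omega>} \<omega> \<partial>\<Omega>) = ennreal ((1 - p * measure \<mu> {w..}) ^ card D)"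
    by (rule prob_no_strong[OF D])
  finally have e: "ennreal (prob {\<omega> \<in> space \<Omega>. cell_assignment k \<omega> \<kappa> \<and> (\<forall>h\<in>D. \<not> strong w h \<omega>)})
      = ennreal (prob {\<omega> \<in> space \<Omega>. cell_assignment k \<omega> \<kappa>}) * ennreal ((1 - p * measure \<mu> {w..}) ^ card D)" .
  have nonneg: "0 \<le> (1 - p * measure \<mu> {w..}) ^ card D"
  proof (cases "D = {}")
    case False
    then obtain h where "h \<in> K" using D by auto
    then have "p * measure \<mu> {w..} \<le> 1" using prob_strong[of h w] prob_le_1 by metis
    then show ?thesis by simp
  qed simp
  show ?thesis
    using e nonneg by (simp add: ennreal_mult[symmetric])
qed

text \<open>A union bound over the vertex sets \<open>S\<close> and over the assignments \<open>\<kappa>\<close> of vertices to cells.\<close>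

lemma prob_few_strong_neighbours:
  assumes A: "A \<subseteq> {1..n}" "B \<subseteq> {1..n}" "A \<inter> B = {}" and t: "0 \<le> t"
  shows "prob {\<omega> \<in> space \<Omega>. \<exists>\<kappa>\<in>Pi\<^sub>E {1..n} (\<lambda>_. cells k). cell_assignment k \<omega> \<kappa> \<and>
      (\<forall>c\<in>cells k. t \<le> real (card {v \<in> B. \<kappa> v = c})) \<and>
      (\<exists>S\<in>Pow A. card A \<le> 2 * card S \<and> (\<forall>h\<in>cell_pairs \<kappa> S B. \<not> strong w h \<omega>))}
    \<le> 2 ^ card A * exp (- (p * measure \<mu> {w..} * real (card A) * t / 2))"
proof -
  define q where "q = measure \<mu> {w..}"
  have q: "0 \<le> q" "p * q \<le> 1"
  proof -
    have "p * q = prob {\<omega> \<in> space \<Omega>. strong w {1, 2} \<omega>}"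
      unfolding q_def by (rule prob_strong[OF edge_exists, symmetric])
    then show "p * q \<le> 1" by (simp only: prob_le_1)
  qed (simp add: q_def)
  define \<K> where "\<K> = {\<kappa> \<in> Pi\<^sub>E {1..n} (\<lambda>_. cells k). \<forall>c\<in>cells k. t \<le> real (card {v \<in> B. \<kappa> v = c})}"
  define \<S> where "\<S> = {S \<in> Pow A. card A \<le> 2 * card S}"
  define Ev where "Ev \<kappa> S = {\<omega> \<in> space \<Omega>. cell_assignment k \<omega> \<kappa> \<and> (\<forall>h\<in>cell_pairs \<kappa> S B. \<not> strong w h \<omega>)}" for \<kappa> S
  define e where "e = exp (- (p * q * real (card A) * t / 2))"
  have finA: "finite A" "finite B" using A finite_subset by blast+
  have fin: "finite \<K>" "finite \<S>"
  proof -
    have "\<K> \<subseteq> Pi\<^sub>E {1..n} (\<lambda>_. cells k)" "finite (Pi\<^sub>E {1..n} (\<lambda>_. cells k))"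
      by (auto simp: \<K>_def intro!: finite_PiE)
    then show "finite \<K>" by (rule finite_subset)
    show "finite \<S>" using finA by (simp add: \<S>_def)
  qed
  have cpK: "cell_pairs \<kappa> S B \<subseteq> K" if "S \<in> \<S>" for \<kappa> S
    using that A by (auto simp: cell_pairs_def \<S>_def nsets_def card_insert_if)
  have Ev_m: "Ev \<kappa> S \<in> events" if "S \<in> \<S>" for \<kappa> S
    unfolding Ev_def pred_def[symmetric] using cpK[OF that, of \<kappa>]
    by (intro pred_intros_logic pred_intros_finite pred_cell_assignment pred_strong)
      (auto intro: finite_subset)
  have bound: "prob (Ev \<kappa> S) \<le> prob {\<omega> \<in> space \<Omega>. cell_assignment k \<omega> \<kappa>} * e" if "\<kappa> \<in> \<K>" "S \<in> \<S>" for \<kappa> S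
  proof -
    have S: "S \<subseteq> A" "card A \<le> 2 * card S" using that by (auto simp: \<S>_def)
    have "real (card S) * t \<le> real (card (cell_pairs \<kappa> S B))"
    proof (rule card_cell_pairs_ge)
      fix u assume "u \<in> S"
      then have "\<kappa> u \<in> cells k" using S A that by (auto simp: \<K>_def PiE_iff)
      then show "t \<le> real (card {v \<in> B. \<kappa> v = \<kappa> u})" using that by (auto simp: \<K>_def)
    qed (use S A finA in \<open>auto intro: finite_subset\<close>)
    \<comment> \<open>Sets \<open>S\<close> with at least half of \<open>A\<close> suffice, because
      the aim is a strong neighbour for half of \<open>A\<close> only.\<close>
    moreover have "real (card A) / 2 * t \<le> real (card S) * t" using S t by (intro mult_right_mono) auto
    ultimately have c: "real (card A) * t / 2 \<le> real (card (cell_pairs \<kappa> S B))" by simp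
    have "prob (Ev \<kappa> S) = prob {\<omega> \<in> space \<Omega>. cell_assignment k \<omega> \<kappa>} * (1 - p * q) ^ card (cell_pairs \<kappa> S B)"
      unfolding Ev_def q_def by (rule prob_cells_no_strong[OF cpK[OF that(2)]])
    also have "\<dots> \<le> prob {\<omega> \<in> space \<Omega>. cell_assignment k \<omega> \<kappa>} * e"
    proof (rule mult_left_mono)
      have "(1 - p * q) ^ card (cell_pairs \<kappa> S B) \<le> exp (- (p * q)) ^ card (cell_pairs \<kappa> S B)"
        using q exp_ge_add_one_self[of "- (p * q)"] by (intro power_mono) auto
      also have "\<dots> = exp (- (p * q * real (card (cell_pairs \<kappa> S B))))"
        by (simp add: exp_of_nat_mult[symmetric] mult.commute)
      also have "\<dots> \<le> e"
        unfolding e_def using mult_left_mono[OF c, of "p * q"] q p_pos by (simp add: mult.assoc)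
      finally show "(1 - p * q) ^ card (cell_pairs \<kappa> S B) \<le> e" .
    qed simp
    finally show ?thesis .
  qed
  have "prob {\<omega> \<in> space \<Omega>. \<exists>\<kappa>\<in>Pi\<^sub>E {1..n} (\<lambda>_. cells k). cell_assignment k \<omega> \<kappa> \<and>
      (\<forall>c\<in>cells k. t \<le> real (card {v \<in> B. \<kappa> v = c})) \<and>
      (\<exists>S\<in>Pow A. card A \<le> 2 * card S \<and> (\<forall>h\<in>cell_pairs \<kappa> S B. \<not> strong w h \<omega>))}
      = prob (\<Union>(\<kappa>, S)\<in>\<K> \<times> \<S>. Ev \<kappa> S)"
    by (rule arg_cong[where f = prob]) (auto simp: \<K>_def \<S>_def Ev_def)
  also have "\<dots> \<le> (\<Sum>(\<kappa>, S)\<in>\<K> \<times> \<S>. prob (Ev \<kappa> S))"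
  proof -
    have "(\<lambda>(\<kappa>, S). Ev \<kappa> S) ` (\<K> \<times> \<S>) \<subseteq> events" using Ev_m by auto
    from finite_measure_subadditive_finite[OF _ this] show ?thesis
      using fin by (simp add: case_prod_unfold)
  qed
  also have "\<dots> = (\<Sum>\<kappa>\<in>\<K>. \<Sum>S\<in>\<S>. prob (Ev \<kappa> S))" by (rule sum.cartesian_product[symmetric])
  also have "\<dots> \<le> (\<Sum>\<kappa>\<in>\<K>. \<Sum>S\<in>\<S>. prob {\<omega> \<in> space \<Omega>. cell_assignment k \<omega> \<kappa>} * e)"
    by (intro sum_mono bound)
  also have "\<dots> = (\<Sum>\<kappa>\<in>\<K>. prob {\<omega> \<in> space \<Omega>. cell_assignment k \<omega> \<kappa>}) * (real (card \<S>) * e)"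
    by (simp add: sum_distrib_left mult_ac)
  also have "\<dots> \<le> 1 * (2 ^ card A * e)"
  proof (intro mult_mono)
    \<comment> \<open>Different assignments are disjoint events, so the union over \<kappa> costs
      nothing; only the at most \<open>2 ^ card A\<close> sets \<open>S\<close> are paid
      for.\<close>
    have "(\<Sum>\<kappa>\<in>\<K>. prob {\<omega> \<in> space \<Omega>. cell_assignment k \<omega> \<kappa>}) = prob (\<Union>\<kappa>\<in>\<K>. {\<omega> \<in> space \<Omega>. cell_assignment k \<omega> \<kappa>})"
    proof (rule finite_measure_finite_Union[symmetric])
      show "disjoint_family_on (\<lambda>\<kappa>. {\<omega> \<in> space \<Omega>. cell_assignment k \<omega> \<kappa>}) \<K>"
      proof (unfold disjoint_family_on_def, intro ballI impI)
        fix \<kappa> \<kappa>' assume "\<kappa> \<in> \<K>" "\<kappa>' \<in> \<K>" "\<kappa> \<noteq> \<kappa>'"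
        then obtain u where "u \<in> {1..n}" "\<kappa> u \<noteq> \<kappa>' u"
          unfolding \<K>_def by (metis (mono_tags, lifting) PiE_ext mem_Collect_eq)
        then show "{\<omega> \<in> space \<Omega>. cell_assignment k \<omega> \<kappa>} \<inter> {\<omega> \<in> space \<Omega>. cell_assignment k \<omega> \<kappa>'} = {}"
          unfolding cell_assignment_def by fastforce
      qed
    qed (use fin in auto)
    then show "(\<Sum>\<kappa>\<in>\<K>. prob {\<omega> \<in> space \<Omega>. cell_assignment k \<omega> \<kappa>}) \<le> 1" by simp
    have "card \<S> \<le> card (Pow A)" by (rule card_mono) (use finA in \<open>auto simp: \<S>_def\<close>)
    also have "\<dots> = 2 ^ card A" by (rule card_Pow[OF finA(1)])
    finally show "real (card \<S>) \<le> 2 ^ card A" by (metis of_nat_le_iff of_nat_numeral of_nat_power)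
  qed (auto simp: e_def)
  finally show ?thesis by (simp add: e_def q_def)
qed

end

section \<open>The star forest and the probability of the lower bound\<close>

context homogeneous_graph
begin

text \<open>Two points of one cell are at distance at most \<open>2 / k\<close>. Positivity of the
  cost is used to exclude distance 0, where \<open>powr\<close> would give 0 instead of a large
  value.\<close>

lemma strong_edge_cost:
  assumes "0 \<le> \<alpha>" "1 \<le> k" "0 < w" and h: "h \<in> K" "h = {u, v}"
    and same: "cell k (X u \<omega>) = cell k (X v \<omega>)" and strong: "strong w h \<omega>"
    and X: "\<forall>u\<in>{1..n}. X u \<omega> \<in> unit_square" and pos: "0 < cost \<alpha> h \<omega>"
  shows "w * (real k / 2) powr \<alpha> \<le> cost \<alpha> h \<omega>"
proof -
  note mm = nsets_2_Min_Max[OF h(1)]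
  define d where "d = dist (X (Min h) \<omega>) (X (Max h) \<omega>)"
  have "{Min h, Max h} = {u, v}" using mm(1) h(2) by simp
  then have "cell k (X (Min h) \<omega>) = cell k (X (Max h) \<omega>)"
    using same by (auto simp: doubleton_eq_iff simp del: One_nat_def)
  then have d: "d \<le> 2 / real k"
    unfolding d_def using cell_dist[OF assms(2)] X mm by blast
  have "d \<noteq> 0" using pos by (auto simp: cost_def d_def)
  then have d0: "0 < d" unfolding d_def by (simp add: less_le)
  have "(real k / 2) powr \<alpha> = (2 / real k) powr (- \<alpha>)"
    using assms(2) by (simp add: powr_minus powr_divide)
  also have "\<dots> \<le> d powr (- \<alpha>)" using assms(1) d d0 by (intro powr_mono2') auto
  finally show ?thesis
    using strong \<open>0 < w\<close> unfolding cost_def d_def[symmetric] strong_def by (intro mult_mono) auto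
qed

text \<open>At least half of the vertices of \<open>A\<close> have a strong neighbour in
  \<open>B\<close> in their own cell. One edge for each of them is a star forest centred in
  \<open>B\<close>, and \<open>chi_ge_forest\<close> applies to it.\<close>

lemma chi_lower_bound_deterministic:
  assumes rule: "largest_component_rule L" and "0 \<le> \<alpha>" "1 \<le> k" "0 < w"
    and A: "A \<subseteq> {1..n}" "B \<subseteq> {1..n}" "A \<inter> B = {}"
    and W: "\<forall>h\<in>K. 0 < W h \<omega>" and X: "\<forall>u\<in>{1..n}. X u \<omega> \<in> unit_square"
    and pos: "\<forall>h\<in>K. 0 < cost \<alpha> h \<omega>"
    and conn: "connected_graph {1..n} (graph \<omega>)"
    and \<kappa>: "cell_assignment k \<omega> \<kappa>"
    and dense: "\<And>S. S \<subseteq> A \<Longrightarrow> card A \<le> 2 * card S \<Longrightarrow> \<exists>h\<in>cell_pairs \<kappa> S B. strong w h \<omega>"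
  shows "real (card A) / 2 * (w * (real k / 2) powr \<alpha>) \<le> chi L \<alpha> n Z W X \<omega>"
proof -
  define A' where "A' = {u \<in> A. \<exists>v\<in>B. \<kappa> v = \<kappa> u \<and> strong w {u, v} \<omega>}"
  have finA: "finite A" using A finite_subset by blast
  have A': "A' \<subseteq> A" by (auto simp: A'_def)
  \<comment> \<open>Otherwise \<open>dense\<close>, applied to \<open>A - A'\<close>, yields a
    strong neighbour for a vertex outside \<open>A'\<close>.\<close>
  have "\<not> card A \<le> 2 * card (A - A')"
  proof
    assume "card A \<le> 2 * card (A - A')"
    from dense[OF _ this] obtain h where h: "h \<in> cell_pairs \<kappa> (A - A') B" "strong w h \<omega>" by auto
    then obtain u v where "u \<in> A - A'" "v \<in> B" "\<kappa> v = \<kappa> u" "h = {u, v}" by (auto simp: cell_pairs_def)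
    with h(2) show False unfolding A'_def by blast
  qed
  moreover have "card (A - A') = card A - card A'" "card A' \<le> card A"
    using A' finA by (auto simp: card_Diff_subset finite_subset card_mono)
  ultimately have cA': "real (card A) / 2 \<le> real (card A')" by linarith
  have "\<forall>u\<in>A'. \<exists>v. v \<in> B \<and> \<kappa> v = \<kappa> u \<and> strong w {u, v} \<omega>" by (auto simp: A'_def)
  then obtain b where b: "\<And>u. u \<in> A' \<Longrightarrow> b u \<in> B \<and> \<kappa> (b u) = \<kappa> u \<and> strong w {u, b u} \<omega>" by metis
  define T where "T = (\<lambda>u. {u, b u}) ` A'"
  have "acyclic_edges T \<and> card T = card A'"
    unfolding T_def
  proof (rule star_forest)
    show "finite A'" by (rule finite_subset[OF A' finA])
    show "b u \<notin> A'" if "u \<in> A'" for u using b[OF that] A' A(3) by blast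
  qed
  then have T: "acyclic_edges T" "card T = card A'" by auto
  have TE: "h \<in> K \<and> h \<in> graph \<omega> \<and> w * (real k / 2) powr \<alpha> \<le> cost \<alpha> h \<omega>" if hT: "h \<in> T" for h
  proof -
    obtain u where u: "u \<in> A'" "h = {u, b u}" using hT by (auto simp: T_def)
    have mem: "u \<in> A" "b u \<in> B" using subsetD[OF A' u(1)] b[OF u(1)] by simp_all
    have uv: "u \<in> {1..n}" "b u \<in> {1..n}" "u \<noteq> b u"
      using subsetD[OF A(1) mem(1)] subsetD[OF A(2) mem(2)] mem A(3) by auto
    then have h: "h \<in> K" using u(2) by (auto simp: nsets_def card_insert_if)
    have "cell k (X u \<omega>) = cell k (X (b u) \<omega>)"
    proof -
      have "cell k (X u \<omega>) = \<kappa> u" "cell k (X (b u) \<omega>) = \<kappa> (b u)"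
        using \<kappa> uv(1,2) unfolding cell_assignment_def by blast+
      with b[OF u(1)] show ?thesis by argo
    qed
    moreover have s: "strong w h \<omega>" using b[OF u(1)] u(2) by simp
    moreover have "h \<in> graph \<omega>" using h s by (simp add: in_graph_iff strong_def)
    ultimately show ?thesis
      using strong_edge_cost[OF assms(2-4) h u(2)] h X pos by blast
  qed
  have "real (card A) / 2 * (w * (real k / 2) powr \<alpha>) \<le> real (card A') * (w * (real k / 2) powr \<alpha>)"
    using cA' \<open>0 < w\<close> by (intro mult_right_mono) auto
  also have "\<dots> = (\<Sum>h\<in>T. w * (real k / 2) powr \<alpha>)" by (simp add: T(2))
  also have "\<dots> \<le> (\<Sum>h\<in>T. cost \<alpha> h \<omega>)" by (rule sum_mono) (use TE in auto)
  also have "\<dots> \<le> chi L \<alpha> n Z W X \<omega>"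
    by (rule chi_ge_forest[OF rule W conn _ T(1)]) (use TE in auto)
  finally show ?thesis .
qed

text \<open>Three events can fail: connectedness, a sufficient number of vertices of
  \<open>B\<close> in every cell, and a strong neighbour for half of \<open>A\<close>. The second
  one produces the term \<open>n * exp (- \<theta> / p)\<close>; the other two are exponentially
  small in \<open>n p\<close>.\<close>

lemma prob_chi_lower_bound:
  assumes rule: "largest_component_rule L" and \<alpha>: "0 \<le> \<alpha>" and w: "0 < w"
    and f: "set_borel_measurable lborel unit_square f" "\<And>x. x \<in> unit_square \<Longrightarrow> \<epsilon> \<le> f x" "0 < \<epsilon>"
    and a: "0 < a" "a \<le> 1" "a\<^sup>2 \<le> measure \<mu> {w..} * \<epsilon> / 32"
    and np: "4 * ln (real n) \<le> real n * p" "16 \<le> real n * p" "1 \<le> a\<^sup>2 * (real n * p)"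
    and \<theta>: "0 < \<theta>" "\<theta> \<le> 1 / 8" "\<theta> \<le> \<epsilon> / (8 * a\<^sup>2)" "\<theta> \<le> w * (a / 4) powr \<alpha> / 6"
  shows "1 - exp (- \<theta> * real n * p) - real n * exp (- \<theta> / p)
    \<le> prob {\<omega> \<in> space \<Omega>. connected_graph {1..n} (graph \<omega>) \<and>
        \<theta> * real n * (real n * p) powr (\<alpha> / 2) \<le> chi L \<alpha> n Z W X \<omega>}"
proof -
  define q where "q = measure \<mu> {w..}"
  have q: "0 \<le> q" by (simp add: q_def)
  \<comment> \<open>Cells of side about \<open>1 / s\<close> number about
    \<open>a\<^sup>2 n p\<close>, so each holds at least order \<open>1 / (a\<^sup>2 p)\<close>
    vertices. A small \<open>a\<close> makes cells large enough for several strong neighbours per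
    vertex.\<close>
  define s where "s = a * sqrt (real n * p)"
  have s2: "s\<^sup>2 = a\<^sup>2 * (real n * p)" using np by (simp add: s_def power_mult_distrib)
  have s1: "1 \<le> s"
  proof (rule power2_le_imp_le)
    show "1\<^sup>2 \<le> s\<^sup>2" using np(3) s2 by simp
    show "0 \<le> s" using a(1) np(2) by (simp add: s_def)
  qed
  define k where "k = nat \<lfloor>s\<rfloor>"
  have k: "1 \<le> k" "real k \<le> s" "s / 2 \<le> real k" 
  proof -
    have "1 \<le> \<lfloor>s\<rfloor>" using s1 by simp
    then have "real k = real_of_int \<lfloor>s\<rfloor>" "1 \<le> real_of_int \<lfloor>s\<rfloor>" by (auto simp: k_def)
    then show "1 \<le> k" "real k \<le> s" "s / 2 \<le> real k"
      using of_int_floor_le[of s] real_of_int_floor_add_one_gt[of s] by linarith+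
  qed
  define m where "m = n div 2"
  define A where "A = {1..m}"
  define B where "B = {m + 1..n}"
  have AB: "A \<subseteq> {1..n}" "B \<subseteq> {1..n}" "A \<inter> B = {}" by (auto simp: A_def B_def m_def)
  have cards: "real n / 3 \<le> real (card A)" "real n / 2 \<le> real (card B)"
  proof -
    have "n \<le> 3 * m" "n \<le> 2 * (n - m)" using n2 unfolding m_def by presburger+
    then show "real n / 3 \<le> real (card A)" "real n / 2 \<le> real (card B)"
      by (auto simp: A_def B_def)
  qed
  have n0: "0 < real n" using n2 by simp
  define r where "r = \<epsilon> / (real k)\<^sup>2"
  define t where "t = real (card B) * r / 4"
  have r0: "0 \<le> r" using f(3) by (simp add: r_def)
  have t0: "0 \<le> t" using r0 by (simp add: t_def)
  \<comment> \<open>From \<open>card B \<ge> n / 2\<close>,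
    \<open>k\<^sup>2 \<le> a\<^sup>2 n p\<close> and the factor 1/4 in \<open>t\<close>.\<close>
  have t_ge: "\<epsilon> / (8 * a\<^sup>2 * p) \<le> t"
  proof -
    have "(real k)\<^sup>2 \<le> s\<^sup>2" using k by (intro power_mono) auto
    then have k2: "(real k)\<^sup>2 \<le> a\<^sup>2 * (real n * p)" by (simp add: s2)
    have "\<epsilon> / (8 * a\<^sup>2 * p) = real n / 2 * (\<epsilon> / (a\<^sup>2 * (real n * p))) / 4"
      using n0 by (simp add: field_simps)
    also have "\<dots> \<le> real (card B) * r / 4"
    proof (intro divide_right_mono mult_mono cards(2))
      have "0 < a\<^sup>2 * (real n * p)" using a n0 p_pos by simp
      then show "\<epsilon> / (a\<^sup>2 * (real n * p)) \<le> r"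
        unfolding r_def using k2 k(1) f(3) by (intro divide_left_mono) auto
      then show "0 \<le> \<epsilon> / (a\<^sup>2 * (real n * p))"
        using \<open>0 < a\<^sup>2 * (real n * p)\<close> f(3) by (intro divide_nonneg_pos) auto
    qed auto
    finally show ?thesis by (simp add: t_def)
  qed
  define E1 where "E1 = {\<omega> \<in> space \<Omega>. \<not> connected_graph {1..n} (graph \<omega>)}"
  define E2 where "E2 c = {\<omega> \<in> space \<Omega>. real (card {v \<in> B. cell k (X v \<omega>) = c}) < real (card B) * r / 4}" for c
  define E3 where "E3 = {\<omega> \<in> space \<Omega>. \<exists>\<kappa>\<in>Pi\<^sub>E {1..n} (\<lambda>_. cells k). cell_assignment k \<omega> \<kappa> \<and>
      (\<forall>c\<in>cells k. t \<le> real (card {v \<in> B. \<kappa> v = c})) \<and>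
      (\<exists>S\<in>Pow A. card A \<le> 2 * card S \<and> (\<forall>h\<in>cell_pairs \<kappa> S B. \<not> strong w h \<omega>))}"
  define goal where "goal \<omega> \<longleftrightarrow> connected_graph {1..n} (graph \<omega>) \<and>
        \<theta> * real n * (real n * p) powr (\<alpha> / 2) \<le> chi L \<alpha> n Z W X \<omega>" for \<omega>
  note [measurable] = chi_measurable[OF rule, of \<alpha>]
  have goal_m [measurable]: "Measurable.pred \<Omega> goal" unfolding goal_def by measurable
  have finB: "finite B" "finite A" by (auto simp: A_def B_def)
  have E1_m: "E1 \<in> events" unfolding E1_def by measurable
  have E2_m: "E2 c \<in> events" for c
  proof -
    have "(\<lambda>\<omega>. real (\<Sum>v\<in>B. if cell k (X v \<omega>) = c then 1 else 0)) \<in> borel_measurable \<Omega>"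
      unfolding of_nat_sum by (rule borel_measurable_sum) (use AB pred_cell_X in \<open>auto intro!: measurable_If\<close>)
    moreover have "card {v \<in> B. cell k (X v \<omega>) = c} = (\<Sum>v\<in>B. if cell k (X v \<omega>) = c then 1 else 0)" for \<omega>
      using finB by (simp flip: sum.inter_filter)
    ultimately have [measurable]: "(\<lambda>\<omega>. real (card {v \<in> B. cell k (X v \<omega>) = c})) \<in> borel_measurable \<Omega>"
      by presburger
    show ?thesis unfolding E2_def by measurable
  qed
  have E3_m: "E3 \<in> events"
    unfolding E3_def pred_def[symmetric]
  proof (intro pred_intros_finite pred_intros_logic pred_cell_assignment)
    show "finite (Pi\<^sub>E {1..n} (\<lambda>_. cells k))" by (intro finite_PiE) auto
    show "finite (Pow A)" using finB by simp
    fix \<kappa> :: "nat \<Rightarrow> int \<times> int" and S assume S: "S \<in> Pow A"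
    have "finite S" using S finB finite_subset by blast
    then show "finite (cell_pairs \<kappa> S B)" unfolding cell_pairs_def using finB by auto
    fix h assume "h \<in> cell_pairs \<kappa> S B"
    then have "h \<in> K" using S AB by (auto simp: cell_pairs_def nsets_def card_insert_if)
    then show "Measurable.pred \<Omega> (strong w h)" by (rule pred_strong)
  qed auto
  \<comment> \<open>The exceptional null set consists of sample points with a nonpositive weight, a
    location outside the square or a vanishing cost.\<close>
  have cover: "AE \<omega> in \<Omega>. \<omega> \<in> {\<omega> \<in> space \<Omega>. \<not> goal \<omega>} \<longrightarrow> \<omega> \<in> E1 \<union> (\<Union>c\<in>cells k. E2 c) \<union> E3"
    using AE_W_pos AE_X_unit_square AE_cost_pos[of \<alpha>]
  proof eventually_elim
    case (elim \<omega>)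
    show ?case
    proof (rule impI, rule ccontr)
      assume w1: "\<omega> \<in> {\<omega> \<in> space \<Omega>. \<not> goal \<omega>}" and "\<omega> \<notin> E1 \<union> (\<Union>c\<in>cells k. E2 c) \<union> E3"
      then have sp: "\<omega> \<in> space \<Omega>" and conn: "connected_graph {1..n} (graph \<omega>)"
        and full: "\<And>c. c \<in> cells k \<Longrightarrow> t \<le> real (card {v \<in> B. cell k (X v \<omega>) = c})"
        and n3: "\<omega> \<notin> E3"
        by (auto simp: E1_def E2_def t_def not_less)
      define \<kappa> where "\<kappa> = restrict (\<lambda>u. cell k (X u \<omega>)) {1..n}"
      have \<kappa>1: "\<kappa> \<in> Pi\<^sub>E {1..n} (\<lambda>_. cells k)"
        unfolding \<kappa>_def using elim(2) cell_in_cells[OF k(1)] by auto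
      have \<kappa>2: "cell_assignment k \<omega> \<kappa>" by (simp add: cell_assignment_def \<kappa>_def)
      have "{v \<in> B. \<kappa> v = c} = {v \<in> B. cell k (X v \<omega>) = c}" for c
        using AB(2) by (auto simp: \<kappa>_def)
      with full have \<kappa>3: "\<forall>c\<in>cells k. t \<le> real (card {v \<in> B. \<kappa> v = c})" by simp
      have dense: "\<exists>h\<in>cell_pairs \<kappa> S B. strong w h \<omega>" if "S \<subseteq> A" "card A \<le> 2 * card S" for S
        using n3 \<kappa>1 \<kappa>2 \<kappa>3 sp that unfolding E3_def by blast
      have low: "real (card A) / 2 * (w * (real k / 2) powr \<alpha>) \<le> chi L \<alpha> n Z W X \<omega>"
        by (rule chi_lower_bound_deterministic[OF rule \<alpha> k(1) w AB elim conn \<kappa>2 dense])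
      have "(a / 4) powr \<alpha> * (real n * p) powr (\<alpha> / 2) = (s / 4) powr \<alpha>"
      proof -
        have "(real n * p) powr (\<alpha> / 2) = sqrt (real n * p) powr \<alpha>"
          using np(2) by (simp add: powr_half_sqrt[symmetric] powr_powr)
        then show ?thesis using a np(2) by (simp add: s_def powr_mult[symmetric])
      qed
      also have "\<dots> \<le> (real k / 2) powr \<alpha>" using k s1 \<alpha> by (intro powr_mono2) auto
      finally have pw: "(a / 4) powr \<alpha> * (real n * p) powr (\<alpha> / 2) \<le> (real k / 2) powr \<alpha>" .
      have "\<theta> * real n * (real n * p) powr (\<alpha> / 2)
          \<le> (w * (a / 4) powr \<alpha> / 6) * real n * (real n * p) powr (\<alpha> / 2)"
        using \<theta>(4) by (intro mult_right_mono) auto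
      \<comment> \<open>The 6 in the bound on \<open>\<theta>\<close>: \<open>A\<close> has at least
        \<open>n / 3\<close> vertices, half of which are used.\<close>
      also have "\<dots> = real n / 3 / 2 * (w * ((a / 4) powr \<alpha> * (real n * p) powr (\<alpha> / 2)))" by simp
      also have "\<dots> \<le> real (card A) / 2 * (w * (real k / 2) powr \<alpha>)"
        using cards(1) w pw by (intro mult_mono divide_right_mono) auto
      finally show False using low conn w1 by (simp add: goal_def)
    qed
  qed
  have pE1: "prob E1 \<le> 2 * exp (- (real n * p) / 4)"
  proof -
    define x where "x = exp (- (real n * p) / 2)"
    \<comment> \<open>The assumption \<open>4 * ln n \<le> n p\<close> lets the number of vertices
      consume half of the exponent \<open>n p / 2\<close>.\<close>
    have "real n = exp (ln (real n))" using n0 by simp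
    also have "\<dots> \<le> exp ((real n * p) / 4)" using np(1) by (subst exp_le_cancel_iff) linarith
    finally have "real n * x \<le> exp ((real n * p) / 4) * x" by (intro mult_right_mono) (auto simp: x_def)
    also have "\<dots> = exp (- (real n * p) / 4)" by (simp add: x_def exp_add[symmetric])
    finally have nx: "real n * x \<le> exp (- (real n * p) / 4)" .
    also have "\<dots> \<le> 1" using np(2) by simp
    finally have "(1 + x) ^ n - 1 \<le> 2 * (real n * x)" by (intro power_1_plus_exp_bound) (auto simp: x_def)
    then show ?thesis using prob_disconnected nx unfolding E1_def x_def by linarith
  qed
  have pE2: "prob (E2 c) \<le> exp (- t)" if c: "c \<in> cells k" for c
  proof -
    have "r \<le> measure (location_law f) {x. cell k x = c}"
      unfolding r_def by (rule location_law_cell_ge[OF f c prob_location_law])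
    from prob_few_in_cell[OF AB(2) r0 this] show ?thesis by (simp add: E2_def t_def)
  qed
  have pE2': "prob (\<Union>c\<in>cells k. E2 c) \<le> real n * exp (- \<theta> / p)"
  proof -
    have "prob (\<Union>c\<in>cells k. E2 c) \<le> (\<Sum>c\<in>cells k. prob (E2 c))"
      by (rule finite_measure_subadditive_finite) (use E2_m in auto)
    also have "\<dots> \<le> (\<Sum>c\<in>cells k. exp (- t))" by (intro sum_mono pE2)
    also have "\<dots> = (real k)\<^sup>2 * exp (- t)" by (simp add: card_cells)
    also have "\<dots> \<le> real n * exp (- \<theta> / p)"
    proof (rule mult_mono)
      have "(real k)\<^sup>2 \<le> s\<^sup>2" using k by (intro power_mono) auto
      \<comment> \<open>Since \<open>a\<close> and \<open>p\<close> are at most 1, there are at most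
        \<open>n\<close> cells.\<close>
      also have "\<dots> \<le> 1 * (real n * 1)"
        unfolding s2 using a p_pos p_less_1 by (intro mult_mono power_le_one) auto
      finally show "(real k)\<^sup>2 \<le> real n" by simp
      have "\<theta> / p \<le> (\<epsilon> / (8 * a\<^sup>2)) / p" using \<theta>(3) p_pos by (intro divide_right_mono) auto
      also have "\<dots> \<le> t" using t_ge by simp
      finally show "exp (- t) \<le> exp (- \<theta> / p)" by simp
    qed auto
    finally show ?thesis .
  qed
  have pE3: "prob E3 \<le> exp (- (real n * p) / 4)"
  proof -
    have "prob E3 \<le> 2 ^ card A * exp (- (p * q * real (card A) * t / 2))"
      unfolding E3_def q_def by (rule prob_few_strong_neighbours[OF AB t0])
    also have "\<dots> \<le> exp (real (card A)) * exp (- (2 * real (card A)))"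
    proof (rule mult_mono)
      have "(2 :: real) \<le> exp 1" using exp_ge_add_one_self[of "1 :: real"] by simp
      then have "(2 :: real) ^ card A \<le> exp 1 ^ card A" by (intro power_mono) auto
      then show "2 ^ card A \<le> exp (real (card A))" by (simp add: exp_of_nat_mult[symmetric])
      \<comment> \<open>The bound on \<open>a\<^sup>2\<close> is used here:
        \<open>p * q * t\<close>, a lower bound for the mean number of strong neighbours in a filled
        cell, is at least 4. The resulting \<open>exp (- 2 * card A)\<close> beats the
        \<open>2 ^ card A\<close> sets.\<close>
      have "4 \<le> q * \<epsilon> / (8 * a\<^sup>2)" using a by (simp add: q_def field_simps)
      also have "\<dots> = p * q * (\<epsilon> / (8 * a\<^sup>2 * p))" using p_pos by simp
      also have "\<dots> \<le> p * q * t" using t_ge q p_pos by (intro mult_left_mono) auto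
      finally have "4 * real (card A) \<le> p * q * t * real (card A)" by (intro mult_right_mono) auto
      then show "exp (- (p * q * real (card A) * t / 2)) \<le> exp (- (2 * real (card A)))" by (simp add: mult_ac)
    qed auto
    also have "\<dots> = exp (- real (card A))" by (simp add: exp_add[symmetric])
    also have "\<dots> \<le> exp (- (real n * p) / 4)"
    proof -
      have "real n * p \<le> real n" using p_less_1 n0 by simp
      then have "(real n * p) / 4 \<le> real (card A)" using cards(1) n0 by linarith
      then show ?thesis by simp
    qed
    finally show ?thesis .
  qed
  have "prob {\<omega> \<in> space \<Omega>. \<not> goal \<omega>} \<le> prob (E1 \<union> (\<Union>c\<in>cells k. E2 c) \<union> E3)"
    by (rule finite_measure_mono_AE[OF cover]) (use E1_m E2_m E3_m in auto)
  also have "\<dots> \<le> prob (E1 \<union> (\<Union>c\<in>cells k. E2 c)) + prob E3"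
    by (rule measure_Un_le) (use E1_m E2_m E3_m in auto)
  also have "prob (E1 \<union> (\<Union>c\<in>cells k. E2 c)) \<le> prob E1 + prob (\<Union>c\<in>cells k. E2 c)"
    by (rule measure_Un_le) (use E1_m E2_m in auto)
  finally have "prob {\<omega> \<in> space \<Omega>. \<not> goal \<omega>} \<le> 3 * exp (- (real n * p) / 4) + real n * exp (- \<theta> / p)"
    using pE1 pE2' pE3 by linarith
  \<comment> \<open>The factor 3 is absorbed by half of the exponent, as \<open>n p \<ge> 16\<close>
    gives \<open>3 \<le> exp 2 \<le> exp (n p / 8)\<close>; the other half covers
    \<open>\<theta> \<le> 1 / 8\<close>.\<close>
  moreover have "3 * exp (- (real n * p) / 4) \<le> exp (- \<theta> * real n * p)"
  proof -
    have "3 \<le> exp (2 :: real)" using exp_ge_add_one_self[of "2 :: real"] by simp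
    also have "\<dots> \<le> exp ((real n * p) / 8)" using np(2) by simp
    finally have "3 * exp (- (real n * p) / 4) \<le> exp ((real n * p) / 8) * exp (- (real n * p) / 4)"
      by (intro mult_right_mono) auto
    also have "\<dots> = exp (- (1 / 8 * (real n * p)))" by (simp add: exp_add[symmetric])
    also have "\<dots> \<le> exp (- \<theta> * real n * p)"
      using mult_right_mono[OF \<theta>(2), of "real n * p"] np(2) by (simp add: mult.assoc)
    finally show ?thesis .
  qed
  moreover have "prob {\<omega> \<in> space \<Omega>. \<not> goal \<omega>} = 1 - prob {\<omega> \<in> space \<Omega>. goal \<omega>}"
    by (rule prob_neg) measurable
  ultimately show ?thesis unfolding goal_def by linarith
qed

end

text \<open>If all sets \<open>{w..}\<close> with \<open>w > 0\<close> were null, so would be their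
  countable union over the values \<open>w = 1 / (m + 1)\<close>, which contains all positive
  numbers.\<close>

lemma positive_law_lower_quantile:
  fixes \<mu> :: "real measure"
  assumes "real_distribution \<mu>" "AE w in \<mu>. 0 < w"
  shows "\<exists>w>0. 0 < measure \<mu> {w..}"
proof (rule ccontr)
  assume "\<not> ?thesis"
  then have zero: "\<And>w. 0 < w \<Longrightarrow> measure \<mu> {w..} = 0" by (auto simp: zero_less_measure_iff)
  interpret real_distribution \<mu> by fact
  have "{inverse (real (Suc m))..} \<in> null_sets \<mu>" for m
    using zero[of "inverse (real (Suc m))"] by (intro null_setsI) (simp_all add: emeasure_eq_measure)
  then have N: "(\<Union>m. {inverse (real (Suc m))..}) \<in> null_sets \<mu>" by (intro null_sets_UN) auto
  have "AE w in \<mu>. w \<notin> (\<Union>m. {inverse (real (Suc m))..})" by (rule AE_not_in[OF N])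
  with assms(2) have "AE w in \<mu>. False"
  proof eventually_elim
    case (elim w)
    then obtain m where "inverse (real (Suc m)) < w" using reals_Archimedean by blast
    with elim(2) show False by (auto intro: less_imp_le)
  qed
  then show False by simp
qed

section \<open>Choice of the constants\<close>

lemma homogeneous_sequenceD:
  assumes "homogeneous_sequence p \<mu> f \<Omega> Z W X" "2 \<le> n"
  shows "homogeneous_graph (\<Omega> n) n (p n) \<mu> f (Z n) (W n) (X n)"
  using assms unfolding homogeneous_sequence_def homogeneous_graph_def homogeneous_graph_axioms_def by blast

theorem theorem3:
  fixes \<alpha> \<epsilon>\<^sub>1 \<epsilon>\<^sub>2 \<delta>\<^sub>0 \<delta>\<^sub>1 :: real
    and f :: "point \<Rightarrow> real"
    and \<mu> :: "real measure"
    and L :: "nat \<Rightarrow> nat set set \<Rightarrow> nat set"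
  assumes alpha: "0 \<le> \<alpha>"
    and eps: "0 < \<epsilon>\<^sub>1" "0 < \<epsilon>\<^sub>2"
    and f_measurable: "set_borel_measurable lborel unit_square f"
    and f_bounds: "\<And>x. x \<in> unit_square \<Longrightarrow> \<epsilon>\<^sub>1 \<le> f x \<and> f x \<le> \<epsilon>\<^sub>2"
    and f_density: "(\<integral>\<^sup>+x\<in>unit_square. ennreal (f x) \<partial>lborel) = 1"
    and weight_law: "real_distribution \<mu>" "AE w in \<mu>. 0 < w"
    and delta: "0 < \<delta>\<^sub>0" "0 < \<delta>\<^sub>1"
    and second_moment: "integrable \<mu> (\<lambda>w. w\<^sup>2)"
    and moment_bounds: "\<delta>\<^sub>0 \<le> (\<integral>w. w \<partial>\<mu>)\<^sup>2" "(\<integral>w. w \<partial>\<mu>)\<^sup>2 \<le> (\<integral>w. w\<^sup>2 \<partial>\<mu>)" "(\<integral>w. w\<^sup>2 \<partial>\<mu>) \<le> \<delta>\<^sub>1"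
    and rule: "largest_component_rule L"
  shows
    "(\<exists>M>0. \<exists>\<theta>>0. \<forall>p (\<Omega> :: nat \<Rightarrow> 'a measure) Z W X. homogeneous_sequence p \<mu> f \<Omega> Z W X \<longrightarrow>
        (\<forall>n\<ge>2. p n \<ge> M * ln (real n) / real n \<longrightarrow>
           measure (\<Omega> n) {\<omega> \<in> space (\<Omega> n). connected_graph {1..n} (graph_edges n (Z n) \<omega>) \<and>
               chi L \<alpha> n (Z n) (W n) (X n) \<omega> \<ge> \<theta> * real n * (real n * p n) powr (\<alpha> / 2)}
             \<ge> 1 - exp (- \<theta> * real n * p n) - real n * exp (- \<theta> / p n)))
     \<and>
     (0 < \<alpha> \<and> \<alpha> < 1 \<and> (\<exists>s \<ge> 2 / \<alpha> + 1. integrable \<mu> (\<lambda>w. w powr s)) \<longrightarrow>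
      (\<exists>\<gamma>>0. \<exists>\<gamma>\<^sub>0>0. \<forall>p (\<Omega> :: nat \<Rightarrow> 'a measure) Z W X. homogeneous_sequence p \<mu> f \<Omega> Z W X \<longrightarrow>
        (\<forall>n\<ge>2. p n \<ge> \<gamma> * ln (real n) / real n \<longrightarrow>
           integrable (\<Omega> n) (chi L \<alpha> n (Z n) (W n) (X n)) \<and>
           prob_space.expectation (\<Omega> n) (chi L \<alpha> n (Z n) (W n) (X n))
             \<le> \<gamma> * real n * (real n * p n) powr (\<alpha> / 2) \<and>
           measure (\<Omega> n) {\<omega> \<in> space (\<Omega> n).
               chi L \<alpha> n (Z n) (W n) (X n) \<omega> \<le> \<gamma> * real n * nu \<alpha> n * (real n * p n) powr (\<alpha> / 2)}
             \<ge> 1 - \<gamma> / ln (real n) - \<gamma> * p n \<and>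
           (\<alpha> < 2 / 3 \<longrightarrow>
             integrable (\<Omega> n) (\<lambda>\<omega>. (chi L \<alpha> n (Z n) (W n) (X n) \<omega>)\<^sup>2) \<and>
             prob_space.variance (\<Omega> n) (chi L \<alpha> n (Z n) (W n) (X n))
               \<le> \<gamma>\<^sub>0 * (real n)\<^sup>2 * p n * (real n * p n) powr \<alpha>))))" (is "?lower \<and> (?cond \<longrightarrow> ?upper)")
proof (rule conjI)
  obtain w where w: "0 < w" "0 < measure \<mu> {w..}"
    using positive_law_lower_quantile[OF weight_law] by blast
  \<comment> \<open>The largest value allowed by the two constraints on \<open>a\<close> in
    \<open>prob_chi_lower_bound\<close>.\<close>
  define a where "a = min 1 (sqrt (measure \<mu> {w..} * \<epsilon>\<^sub>1 / 32))"
  have a: "0 < a" "a \<le> 1" using w eps by (auto simp: a_def)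
  have a2: "a\<^sup>2 \<le> measure \<mu> {w..} * \<epsilon>\<^sub>1 / 32"
  proof -
    have "a\<^sup>2 \<le> (sqrt (measure \<mu> {w..} * \<epsilon>\<^sub>1 / 32))\<^sup>2" using a by (intro power_mono) (auto simp: a_def)
    also have "\<dots> = measure \<mu> {w..} * \<epsilon>\<^sub>1 / 32" using eps by (intro real_sqrt_pow2) auto
    finally show ?thesis .
  qed
  \<comment> \<open>With \<open>ln n \<ge> 2 / 3\<close> for \<open>n \<ge> 2\<close>, the summand
    32 yields both \<open>n p \<ge> 4 * ln n\<close> and \<open>n p \<ge> 16\<close>, and
    \<open>2 / a\<^sup>2\<close> yields \<open>a\<^sup>2 n p \<ge> 4 / 3\<close>.\<close>
  define M where "M = 32 + 2 / a\<^sup>2"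
  define \<theta> where "\<theta> = min (1 / 8) (min (\<epsilon>\<^sub>1 / (8 * a\<^sup>2)) (w * (a / 4) powr \<alpha> / 6))"
  have M: "0 < M" "32 \<le> M" "2 / a\<^sup>2 \<le> M" using a 
  proof -
    have "0 < 2 / a\<^sup>2" using a by simp
    then show "0 < M" "32 \<le> M" "2 / a\<^sup>2 \<le> M" unfolding M_def by linarith+
  qed
  have \<theta>: "0 < \<theta>" "\<theta> \<le> 1 / 8" "\<theta> \<le> \<epsilon>\<^sub>1 / (8 * a\<^sup>2)" "\<theta> \<le> w * (a / 4) powr \<alpha> / 6"
    using a eps w by (auto simp: \<theta>_def)
  show ?lower
  proof (rule exI[of _ M], intro conjI exI[of _ \<theta>] allI impI M(1) \<theta>(1))
    fix p and \<Omega> :: "nat \<Rightarrow> 'a measure" and Z W X and n :: nat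
    assume seq: "homogeneous_sequence p \<mu> f \<Omega> Z W X" and n: "2 \<le> n"
      and pn: "M * ln (real n) / real n \<le> p n"
    interpret homogeneous_graph "\<Omega> n" n "p n" \<mu> f "Z n" "W n" "X n"
      by (rule homogeneous_sequenceD[OF seq n])
    have np: "M * ln (real n) \<le> real n * p n" using pn n by (simp add: field_simps)
    have "ln 2 \<le> ln (real n)" using n by simp
    with ln2_ge_two_thirds have ln: "2 / 3 \<le> ln (real n)" by linarith
    have "32 * ln (real n) \<le> M * ln (real n)" using M(2) ln by (intro mult_right_mono) auto
    with np ln have np1: "4 * ln (real n) \<le> real n * p n" "16 \<le> real n * p n" by linarith+
    have "2 / a\<^sup>2 * (2 / 3) \<le> M * ln (real n)" using M ln by (intro mult_mono) auto
    then have "2 / a\<^sup>2 * (2 / 3) \<le> real n * p n" using np by linarith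
    then have "4 / 3 \<le> a\<^sup>2 * (real n * p n)" using a by (simp add: field_simps)
    then have np2: "1 \<le> a\<^sup>2 * (real n * p n)" by linarith
    show "1 - exp (- \<theta> * real n * p n) - real n * exp (- \<theta> / p n)
        \<le> measure (\<Omega> n) {\<omega> \<in> space (\<Omega> n). connected_graph {1..n} (graph_edges n (Z n) \<omega>) \<and>
               chi L \<alpha> n (Z n) (W n) (X n) \<omega> \<ge> \<theta> * real n * (real n * p n) powr (\<alpha> / 2)}"
      using prob_chi_lower_bound[OF rule alpha w(1) f_measurable _ eps(1) a a2 np1 np2 \<theta>] f_bounds
      by (simp add: graph_def)
  qed
next
  show "?cond \<longrightarrow> ?upper"
  proof
    assume ?cond
    then obtain s where \<alpha>: "0 < \<alpha>" "\<alpha> < 1" and s: "2 / \<alpha> + 1 \<le> s" "integrable \<mu> (\<lambda>w. w powr s)" by blast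
    have int: "integrable \<mu> (\<lambda>w. w powr (2 / \<alpha>))"
      by (rule powr_integrable_mono[OF weight_law s(2)]) (use s(1) \<alpha> in auto)
    \<comment> \<open>The constant of \<open>truncated_second_moment\<close>; it depends only on
      \<alpha>, the upper bound of the density and the law of the weights.\<close>
    define C where "C = \<epsilon>\<^sub>2 * (4 / (1 - \<alpha>)\<^sup>2) * (\<integral>w. w powr (2 / \<alpha>) \<partial>\<mu>)"
    have C: "0 \<le> C" using eps \<alpha> by (simp add: C_def)
    \<comment> \<open>The value demanded by \<open>chi_upper_tail\<close>; it also dominates
      \<open>1 + C\<close> for the expectation and 10 for the lower bound on
      \<open>n p\<close>.\<close>
    define \<gamma> where "\<gamma> = 256 * (1 + C)"
    define \<gamma>\<^sub>0 where "\<gamma>\<^sub>0 = 64 * (1 + C)"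
    have \<gamma>: "0 < \<gamma>" "0 < \<gamma>\<^sub>0" "10 \<le> \<gamma>" using C by (auto simp: \<gamma>_def \<gamma>\<^sub>0_def)
    show ?upper
    proof (rule exI[of _ \<gamma>], rule conjI[OF \<gamma>(1)], rule exI[of _ \<gamma>\<^sub>0], rule conjI[OF \<gamma>(2)], intro allI impI)
      fix p and \<Omega> :: "nat \<Rightarrow> 'a measure" and Z W X and n :: nat
      assume seq: "homogeneous_sequence p \<mu> f \<Omega> Z W X" and n: "2 \<le> n"
        and pn: "\<gamma> * ln (real n) / real n \<le> p n"
      interpret G: homogeneous_graph "\<Omega> n" n "p n" \<mu> f "Z n" "W n" "X n"
        by (rule homogeneous_sequenceD[OF seq n])
      interpret G: truncated_moment_graph "\<Omega> n" n "p n" \<mu> f "Z n" "W n" "X n" \<alpha> C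
      proof
        fix h and t :: real assume h: "h \<in> nsets {1..n} 2" and t: "0 < t"
        have ex: "ennreal (excess t y) = ennreal (y\<^sup>2) * indicator {t<..} y" for y
          by (simp add: excess_def indicator_def)
        have "(\<integral>\<^sup>+\<omega>. ennreal (excess t (G.cost \<alpha> h \<omega>)) \<partial>\<Omega> n)
          = (\<integral>\<^sup>+w. \<integral>\<^sup>+x. \<integral>\<^sup>+y. ennreal (excess t (\<bar>w\<bar> * dist x y powr (- \<alpha>))) \<partial>location_law f \<partial>location_law f \<partial>\<mu>)"
          by (rule G.nn_integral_cost[OF h]) measurable
        also have "\<dots> \<le> ennreal (C * t powr (2 - 2 / \<alpha>))"
          unfolding ex C_def
          by (rule truncated_second_moment[OF \<alpha> weight_law int f_measurable _ _ G.prob_location_law t])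
            (use f_bounds eps in auto)
        finally show "(\<integral>\<^sup>+\<omega>. ennreal (excess t (G.cost \<alpha> h \<omega>)) \<partial>\<Omega> n) \<le> ennreal (C * t powr (2 - 2 / \<alpha>))" .
      next
        have "10 * ln (real n) \<le> \<gamma> * ln (real n)" using \<gamma>(3) n by (intro mult_right_mono) auto
        also have "\<dots> \<le> real n * p n" using pn n by (simp add: field_simps)
        finally show "10 * ln (real n) \<le> real n * p n" .
      qed (use \<alpha> C in auto)
      have nt: "0 \<le> real n * G.\<tau>" using G.tau_pos by simp
      have "G.expectation (chi L \<alpha> n (Z n) (W n) (X n)) \<le> (1 + C) * (real n * G.\<tau>)"
        by (rule G.expectation_chi_le[OF rule])
      also have "\<dots> \<le> \<gamma> * (real n * G.\<tau>)"
        using C nt by (intro mult_right_mono) (auto simp: \<gamma>_def)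
      finally have E: "G.expectation (chi L \<alpha> n (Z n) (W n) (X n)) \<le> \<gamma> * real n * (real n * p n) powr (\<alpha> / 2)"
        by (simp add: G.\<tau>_def mult.assoc)
      have V: "G.variance (chi L \<alpha> n (Z n) (W n) (X n)) \<le> \<gamma>\<^sub>0 * (real n)\<^sup>2 * p n * (real n * p n) powr \<alpha>"
        using G.variance_chi_le[OF rule] by (simp add: \<gamma>\<^sub>0_def G.scale_def G.tau_square mult.assoc)
      show "integrable (\<Omega> n) (chi L \<alpha> n (Z n) (W n) (X n)) \<and>
           G.expectation (chi L \<alpha> n (Z n) (W n) (X n))
             \<le> \<gamma> * real n * (real n * p n) powr (\<alpha> / 2) \<and>
           measure (\<Omega> n) {\<omega> \<in> space (\<Omega> n).
               chi L \<alpha> n (Z n) (W n) (X n) \<omega> \<le> \<gamma> * real n * nu \<alpha> n * (real n * p n) powr (\<alpha> / 2)}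
             \<ge> 1 - \<gamma> / ln (real n) - \<gamma> * p n \<and>
           (\<alpha> < 2 / 3 \<longrightarrow>
             integrable (\<Omega> n) (\<lambda>\<omega>. (chi L \<alpha> n (Z n) (W n) (X n) \<omega>)\<^sup>2) \<and>
             G.variance (chi L \<alpha> n (Z n) (W n) (X n))
               \<le> \<gamma>\<^sub>0 * (real n)\<^sup>2 * p n * (real n * p n) powr \<alpha>)"
        using G.integrable_chi[OF rule] E G.chi_upper_tail[OF rule \<gamma>_def] G.integrable_chi_square[OF rule] V
        by blast
    qed
  qed
qed

end
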